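(* Fix an integer $q\ge 2$. For every $c\in\mathbb{R}$, the function $f_c(x)=\log\left|\frac{\sin \pi q(x+c)}{\sin\pi(x+c)}\right|$ on $\mathbb{T}$ has a unique maximizing measure $\nu_c$ (a $T$-invariant Borel probability measure with $\int f_c\,d\nu_c=\beta(c)$), and $\nu_c$ is a $q$-Sturmian measure. Moreover, there exists a constant $C>0$, independent of $c$, such that $$\sum_{i=0}^{n-1}f_c(q^i x)-n\beta(c)\le C$$ for every $x\in\mathbb{R}$ and every $n\ge 1$.
   Context: $\mathbb{T}=\mathbb{R}/\mathbb{Z}$, $T(x)=qx\bmod 1$, $\mathcal{M}_T$ is the set of $T$-invariant Borel probability measures, and $\beta(c)=\sup_{\mu\in\mathcal{M}_T}\int f_c\,d\mu$. A $q$-Sturmian measure is a $T$-invariant Borel probability measure supported in a closed arc of $\mathbb{T}$ of length $1/q$. *)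

theory Defs
  imports "HOL-Probability.Probability"
begin

text \<open>The circle T = R/Z is represented by the fundamental domain [0,1) with its Borel
  sigma-algebra; the map T(x) = q x mod 1.\<close>

definition torus :: "real measure" where
  "torus = restrict_space borel {0..<1}"

definition Tmap :: "nat \<Rightarrow> real \<Rightarrow> real" where
  "Tmap q x = frac (real q * x)"

definition invariant_measures :: "nat \<Rightarrow> real measure set" where
  "invariant_measures q =
     {M. prob_space M \<and> sets M = sets torus \<and> Tmap q \<in> measurable M M \<and> distr M M (Tmap q) = M}"

text \<open>f_c(x) = log |sin(pi q (x+c)) / sin(pi (x+c))|, extended-real valued: at zeros of
  sin(pi(x+c)) it takes its continuous extension ln q, at the other zeros of the numerator it is -\<infinity>.\<close>
definition fc :: "nat \<Rightarrow> real \<Rightarrow> real \<Rightarrow> ereal" where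
  "fc q c x = (let y = x + c in
     if sin (pi * y) = 0 then ereal (ln (real q))
     else if sin (pi * real q * y) = 0 then -\<infinity>
     else ereal (ln \<bar>sin (pi * real q * y) / sin (pi * y)\<bar>))"

text \<open>Integral of a function bounded above, valued in [-\<infinity>, \<infinity>): equal to the usual
  integral when the function is a.e. finite and integrable, and -\<infinity> otherwise.\<close>
definition ub_integral :: "real measure \<Rightarrow> (real \<Rightarrow> ereal) \<Rightarrow> ereal" where
  "ub_integral M f =
     (if (AE x in M. f x \<noteq> -\<infinity>) \<and> integrable M (\<lambda>x. real_of_ereal (f x))
      then ereal (\<integral>x. real_of_ereal (f x) \<partial>M) else -\<infinity>)"

definition beta :: "nat \<Rightarrow> real \<Rightarrow> ereal" where
  "beta q c = (SUP M\<in>invariant_measures q. ub_integral M (fc q c))"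

definition arc :: "real \<Rightarrow> real \<Rightarrow> real set" where
  "arc a l = {x \<in> {0..<1}. frac (x - a) \<le> l}"

definition sturmian :: "nat \<Rightarrow> real measure \<Rightarrow> bool" where
  "sturmian q M \<longleftrightarrow> M \<in> invariant_measures q \<and> (\<exists>a. measure M (arc a (1 / real q)) = 1)"

end

(*
  Write f for f_c and let tau be the branch of the inverse of T with values in an arc
  A = [gamma, gamma + 1/q) on which f is finite.  The function g with derivative
  Sum_n q^(-n) f'(tau^n x) satisfies f + g - g o T = const on A, and it is well defined on the
  circle as soon as this derivative has mean zero; such a gamma exists by the intermediate value
  theorem.  It then suffices to show f + g - g o T < const off A: any invariant measure has
  integral at most const, with equality iff it lives on A, and the oscillation of g bounds the
  Birkhoff sums.

  The key identity is that the series operator maps p to a function whose integral over the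
  complement of A equals the integral of p over A.  Applied to p = (f' - e)^+ it gives sharp
  bounds for the increments of g off A.  Since f is strictly concave on the bump (-1/q, 1/q) - c,
  these bounds settle the points of the bump; the other points are compared with
  their translate by a multiple of 1/q in A, where an elementary trigonometric inequality decides.

  An arc of length 1/q carries exactly one invariant measure: the law of the monotone function
  Q(t) = Sum_n (q - 1) q^(-n-1) floor(t + n rho) of a uniform t, for a suitable rho, is invariant
  on it, and two invariant measures on it have the same rotation number and hence give the same mass
  to a chain of sets that determines the point.
*)
theory Submission
  imports Defs
begin

section \<open>Trigonometric inequalities\<close>

text \<open>Differentiating the equation on A gives q g'(q u) = f'(u) + g'(u); read backwards along
  \<open>tau\<close> it contracts by 1/q, which is the origin of the series. As f falls to minus
  infinity at the ends of the bump, f' is unbounded there. The bound C can be uniform in c only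
  because the intermediate value theorem is applied to arcs that keep a fixed distance from these
  ends, chosen before c.

  Points that differ by 1/q have the same image under T, so g o T drops out when a point off A is
  compared with a translate in A, and only f + g at two points remains. At the two ends of A these
  values agree. Next to A the comparison is therefore one of increments from the two ends, and a
  bound for g by its extreme slope does not suffice: by concavity the increment of f at the
  translate is smaller than slope times length. This is why the increments of g off A are bounded by
  increments of f itself, which cancel against it. Far from A there is room, and slopes are
  enough.\<close>

lemma mult_cot_antimono:
  fixes x y :: real
  assumes "0 < x" "x \<le> y" "y < pi"
  shows "y * cot y \<le> x * cot x"
proof -
  have "((\<lambda>z. z * cot z) has_real_derivative (cot z - z / (sin z)^2)) (at z)"
    if "x \<le> z" "z \<le> y" for z
  proof -
    have s: "sin z \<noteq> 0" using sin_gt_zero[of z] that assms by auto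
    show ?thesis
      using s by (auto intro!: derivative_eq_intros DERIV_cot simp: divide_inverse)
  qed
  moreover have "cot z - z / (sin z)^2 \<le> 0" if "x \<le> z" "z \<le> y" for z
  proof -
    have s: "sin z > 0" using sin_gt_zero[of z] that assms by auto
    have "sin z * cos z \<le> z"
    proof -
      have "sin z * cos z \<le> sin z * 1" using s by (intro mult_left_mono) auto
      also have "\<dots> \<le> z" using sin_x_le_x[of z] that assms by auto
      finally show ?thesis .
    qed
    moreover have "cot z - z / (sin z)^2 = (sin z * cos z - z) / (sin z)^2"
      using s by (simp add: cot_def field_simps power2_eq_square)
    ultimately show ?thesis using s by (simp add: divide_nonpos_pos)
  qed
  ultimately show ?thesis
    using DERIV_nonpos_imp_nonincreasing[of x y "\<lambda>z. z * cot z"] assms by blast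
qed

text \<open>Equal to \<open>sin (q x) / sin x\<close>, but without the removable singularities.\<close>
definition dirichlet :: "nat \<Rightarrow> real \<Rightarrow> real" where
  "dirichlet q x = (\<Sum>k<q. cos ((2 * real k - real q + 1) * x))"

definition dirichlet' :: "nat \<Rightarrow> real \<Rightarrow> real" where
  "dirichlet' q x = (\<Sum>k<q. - (2 * real k - real q + 1) * sin ((2 * real k - real q + 1) * x))"

definition dirichlet_logderiv :: "nat \<Rightarrow> real \<Rightarrow> real" where
  "dirichlet_logderiv q x = dirichlet' q x / dirichlet q x"

lemma sin_mult_dirichlet: "sin x * dirichlet q x = sin (real q * x)"
proof -
  have "2 * (sin x * dirichlet q x) = (\<Sum>k<q. sin ((2 * real (Suc k) - real q) * x) - sin ((2 * real k - real q) * x))"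
    unfolding dirichlet_def sum_distrib_left
  proof (rule sum.cong[OF refl])
    fix k assume "k \<in> {..<q}"
    have "2 * (sin x * cos ((2 * real k - real q + 1) * x)) =
       sin (x + (2 * real k - real q + 1) * x) + sin (x - (2 * real k - real q + 1) * x)"
      by (simp add: sin_times_cos)
    also have "x + (2 * real k - real q + 1) * x = (2 * real (Suc k) - real q) * x"
      by (simp add: algebra_simps)
    also have "x - (2 * real k - real q + 1) * x = - ((2 * real k - real q) * x)"
      by (simp add: algebra_simps)
    finally show "2 * (sin x * cos ((2 * real k - real q + 1) * x)) =
       sin ((2 * real (Suc k) - real q) * x) - sin ((2 * real k - real q) * x)" by simp
  qed
  also have "\<dots> = sin (real q * x) - sin (- (real q * x))"
    by (subst sum_lessThan_telescope) (simp add: algebra_simps)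
  finally show ?thesis by simp
qed

lemma dirichlet_minus [simp]: "dirichlet q (- x) = dirichlet q x"
  by (simp add: dirichlet_def)

lemma dirichlet'_minus [simp]: "dirichlet' q (- x) = - dirichlet' q x"
  by (simp add: dirichlet'_def sum_negf)

lemma dirichlet_logderiv_minus [simp]: "dirichlet_logderiv q (- x) = - dirichlet_logderiv q x"
  by (simp add: dirichlet_logderiv_def)

lemma dirichlet_0 [simp]: "dirichlet q 0 = real q"
  by (simp add: dirichlet_def)

lemma dirichlet_le: "dirichlet q x \<le> real q"
proof -
  have "dirichlet q x \<le> (\<Sum>k<q. 1)" unfolding dirichlet_def by (rule sum_mono) auto
  then show ?thesis by simp
qed

lemma DERIV_dirichlet: "(dirichlet q has_real_derivative dirichlet' q x) (at x)"
  unfolding dirichlet_def[abs_def] dirichlet'_def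
proof -
  have "((\<lambda>x. cos ((2 * real k - real q + 1) * x)) has_real_derivative
      - (2 * real k - real q + 1) * sin ((2 * real k - real q + 1) * x)) (at x)" for k
    by (rule derivative_eq_intros refl)+ (simp add: algebra_simps)
  then show "((\<lambda>x. \<Sum>k<q. cos ((2 * real k - real q + 1) * x)) has_real_derivative
      (\<Sum>k<q. - (2 * real k - real q + 1) * sin ((2 * real k - real q + 1) * x))) (at x)"
    by (intro DERIV_sum)
qed

lemma dirichlet_pos:
  assumes "q \<ge> 2" "\<bar>x\<bar> < pi / real q"
  shows "dirichlet q x > 0"
proof -
  have pos: "dirichlet q y > 0" if "0 \<le> y" "y < pi / real q" for y
  proof (cases "y = 0")
    case False
    have "real q * y < pi" using that assms by (simp add: field_simps)
    moreover have "y \<le> real q * y" using that assms by (simp add: mult_le_cancel_right1)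
    ultimately have "y < pi" "real q * y < pi" by linarith+
    then have "sin y > 0" "sin (real q * y) > 0"
      using that(1) False assms(1) by (intro sin_gt_zero; simp)+
    then show ?thesis using sin_mult_dirichlet[of y q] by (metis zero_less_mult_pos)
  qed (use assms in auto)
  show ?thesis using pos[of "\<bar>x\<bar>"] assms by (cases "x \<ge> 0") auto
qed

lemma DERIV_ln_dirichlet:
  assumes "q \<ge> 2" "\<bar>x\<bar> < pi / real q"
  shows "((\<lambda>x. ln (dirichlet q x)) has_real_derivative dirichlet_logderiv q x) (at x)"
  unfolding dirichlet_logderiv_def using dirichlet_pos[OF assms]
  by (auto intro!: derivative_eq_intros DERIV_dirichlet)

lemma continuous_dirichlet_logderiv:
  assumes "q \<ge> 2"
  shows "continuous_on {- (pi / real q)<..<pi / real q} (dirichlet_logderiv q)"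
proof -
  have c1: "continuous_on A (dirichlet q)" for A
    using DERIV_dirichlet DERIV_isCont by (meson continuous_at_imp_continuous_on)
  have c2: "continuous_on A (dirichlet' q)" for A
    unfolding dirichlet'_def[abs_def] by (intro continuous_intros)
  have "dirichlet q x \<noteq> 0" if "x \<in> {- (pi / real q)<..<pi / real q}" for x
    using dirichlet_pos[of q x] assms that by (auto simp: abs_less_iff)
  then show ?thesis unfolding dirichlet_logderiv_def[abs_def]
    by (intro continuous_on_divide c1 c2) auto
qed

lemma sin_nz_small:
  assumes "q \<ge> 2" "0 < x" "x < pi / real q"
  shows "sin x > 0" "sin (real q * x) > 0" "x < pi / 2" "real q * x < pi"
proof -
  show a: "real q * x < pi" using assms by (simp add: field_simps)
  have "2 * x \<le> real q * x" using assms by (intro mult_right_mono) auto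
  then show b: "x < pi / 2" using a by auto
  show "sin x > 0" using b assms by (intro sin_gt_zero) auto
  show "sin (real q * x) > 0" using a assms by (intro sin_gt_zero) auto
qed

text \<open>Differentiating \<open>sin x * dirichlet q x = sin (real q * x)\<close> in two ways
  avoids the term-by-term derivative \<open>dirichlet'\<close>.\<close>

lemma dirichlet_logderiv_eq:
  assumes "q \<ge> 2" "0 < x" "x < pi / real q"
  shows "dirichlet_logderiv q x = real q * cot (real q * x) - cot x"
proof -
  note s = sin_nz_small[OF assms]
  have d: "dirichlet q x > 0" using dirichlet_pos assms by auto
  have "((\<lambda>x. sin x * dirichlet q x) has_real_derivative (cos x * dirichlet q x + sin x * dirichlet' q x)) (at x)"
    by (auto intro!: derivative_eq_intros DERIV_dirichlet)
  moreover have "((\<lambda>x. sin x * dirichlet q x) has_real_derivative (real q * cos (real q * x))) (at x)"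
    unfolding sin_mult_dirichlet by (auto intro!: derivative_eq_intros)
  ultimately have e: "cos x * dirichlet q x + sin x * dirichlet' q x = real q * cos (real q * x)"
    by (rule DERIV_unique)
  have "dirichlet_logderiv q x = (sin x * dirichlet' q x) / (sin x * dirichlet q x)" using s d by (simp add: dirichlet_logderiv_def)
  also have "sin x * dirichlet' q x = real q * cos (real q * x) - cos x * dirichlet q x" using e by simp
  also have "(real q * cos (real q * x) - cos x * dirichlet q x) / (sin x * dirichlet q x)
      = real q * cos (real q * x) / (sin x * dirichlet q x) - cot x"
    using s d by (simp add: diff_divide_distrib cot_def)
  finally show ?thesis by (simp add: cot_def sin_mult_dirichlet)
qed

lemma sin_mult_less:
  assumes "q \<ge> 2" "0 < x" "x < pi / real q"
  shows "sin (real q * x) < real q * sin x"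
proof -
  note s = sin_nz_small[OF assms]
  have "dirichlet q x < (\<Sum>k<q. 1)"
    unfolding dirichlet_def
  proof (rule sum_strict_mono_ex1)
    \<comment> \<open>One cosine below 1 suffices; the extreme frequency q - 1 is positive and still
      keeps the angle inside (0, pi).\<close>
    have "(real q - 1) * x < pi" using s assms by (auto simp: algebra_simps)
    moreover have "(real q - 1) * x > 0" using assms by (intro mult_pos_pos) auto
    ultimately have "cos ((real q - 1) * x) < cos 0" by (intro cos_monotone_0_pi) auto
    then show "\<exists>k\<in>{..<q}. cos ((2 * real k - real q + 1) * x) < 1"
      using assms by (intro bexI[of _ "q - 1"]) (auto simp: of_nat_diff algebra_simps)
  qed auto
  then have "dirichlet q x < real q" by simp
  then have "sin x * dirichlet q x < sin x * real q" using s by simp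
  then show ?thesis by (simp add: sin_mult_dirichlet mult.commute)
qed

text \<open>This is the strict concavity of f on the bump: the derivative is 1/sin(z)^2 - q^2/sin(q
  z)^2, negative by \<open>sin_mult_less\<close>. The cotangent formula breaks down at 0, so
  derivatives are taken in the open interval only and continuity supplies the endpoint.\<close>

lemma dirichlet_logderiv_strict_antimono_pos:
  assumes "q \<ge> 2" "0 \<le> x" "x < y" "y < pi / real q"
  shows "dirichlet_logderiv q y < dirichlet_logderiv q x"
proof (rule DERIV_neg_imp_decreasing_open[OF assms(3)])
  have sub: "{x..y} \<subseteq> {- (pi / real q)<..<pi / real q}" using assms by auto
  show "continuous_on {x..y} (dirichlet_logderiv q)"
    by (rule continuous_on_subset[OF continuous_dirichlet_logderiv[OF assms(1)] sub])
next
  fix z assume z: "x < z" "z < y"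
  then have z': "0 < z" "z < pi / real q" using assms by auto
  note s = sin_nz_small[OF assms(1) z']
  have "((\<lambda>x. real q * cot (real q * x) - cot x) has_real_derivative
     (- ((real q)^2) / (sin (real q * z))^2 + 1 / (sin z)^2)) (at z)"
    using s by (auto intro!: derivative_eq_intros DERIV_cot DERIV_chain2[OF DERIV_cot] simp: field_simps power2_eq_square)
  then have D: "(dirichlet_logderiv q has_real_derivative (- ((real q)^2) / (sin (real q * z))^2 + 1 / (sin z)^2)) (at z)"
    by (rule has_field_derivative_transform_within_open[where S = "{0<..<pi / real q}"])
       (use z' in \<open>auto simp: dirichlet_logderiv_eq[OF assms(1)]\<close>)
  have "(sin (real q * z))^2 < (real q * sin z)^2"
    using sin_mult_less[OF assms(1) z'] s by (intro power_strict_mono) auto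
  then have "- ((real q)^2) / (sin (real q * z))^2 + 1 / (sin z)^2 < 0"
    using s assms(1) by (simp add: field_simps)
  then show "\<exists>y. (dirichlet_logderiv q has_real_derivative y) (at z) \<and> y < 0" using D by blast
qed

lemma dirichlet_logderiv_strict_antimono:
  assumes "q \<ge> 2" "- (pi / real q) < x" "x < y" "y < pi / real q"
  shows "dirichlet_logderiv q y < dirichlet_logderiv q x"
proof -
  have 0: "dirichlet_logderiv q 0 = 0" by (simp add: dirichlet_logderiv_def dirichlet'_def)
  consider "0 \<le> x" | "y \<le> 0" | "x < 0" "0 < y" by linarith
  then show ?thesis
  proof cases
    case 1 then show ?thesis using dirichlet_logderiv_strict_antimono_pos assms by auto
  next
    case 2
    then show ?thesis using dirichlet_logderiv_strict_antimono_pos[of q "-y" "-x"] assms by auto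
  next
    case 3
    have "dirichlet_logderiv q y < 0" using dirichlet_logderiv_strict_antimono_pos[of q 0 y] 0 assms 3 by auto
    moreover have "dirichlet_logderiv q (-x) < 0" using dirichlet_logderiv_strict_antimono_pos[of q 0 "-x"] 0 assms 3 by auto
    ultimately show ?thesis by simp
  qed
qed

section \<open>Inequalities for points outside the bump\<close>

lemma sin_quotient_bound:
  assumes "q \<ge> 2" "0 \<le> u" "u \<le> pi / (2 * real q)"
  shows "sin (2 * u) \<le> sin (real q * u) * sin (pi / real q)"
proof (cases "u = 0")
  case False
  define v where "v = pi / (2 * real q)"
  have v: "0 < v" "real q * v = pi / 2" "2 * v = pi / real q" "2 * v \<le> pi / 2"
    using assms by (auto simp: v_def field_simps)
  have uv: "0 < u" "u \<le> v" using assms False by (auto simp: v_def)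
  have rng: "0 < sin (2 * z)" "0 < sin (real q * z)" if "u \<le> z" "z \<le> v" for z
  proof -
    have "real q * z \<le> real q * v" using that assms by (intro mult_left_mono) auto
    then have "real q * z < pi" using v pi_gt_zero by linarith
    then show "0 < sin (real q * z)" using that uv assms by (intro sin_gt_zero) auto
    have "2 * z < pi" using that v pi_gt_zero by linarith
    then show "0 < sin (2 * z)" using that uv by (intro sin_gt_zero) auto
  qed
  \<comment> \<open>The quotient decreases because t cot t does and 2 z <= q z; at the right end v
    it equals 1 / sin(pi/q), which is the claimed constant.\<close>
  have "sin (real q * v) / sin (2 * v) \<le> sin (real q * u) / sin (2 * u)"
  proof (rule DERIV_nonpos_imp_nonincreasing[OF uv(2)])
    fix z assume z: "u \<le> z" "z \<le> v"
    note r = rng[OF z]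
    have z0: "0 < z" using z uv by simp
    have "((\<lambda>z. sin (real q * z) / sin (2 * z)) has_real_derivative
       (real q * cos (real q * z) * sin (2 * z) - sin (real q * z) * (2 * cos (2 * z))) / (sin (2 * z) * sin (2 * z))) (at z)"
      using r by (auto intro!: derivative_eq_intros simp: field_simps)
    moreover have "real q * cos (real q * z) * sin (2 * z) - sin (real q * z) * (2 * cos (2 * z)) \<le> 0"
    proof -
      have "real q * z \<le> real q * v" using z assms by (intro mult_left_mono) auto
      then have "real q * z < pi" using v pi_gt_zero by linarith
      moreover have "2 * z \<le> real q * z" using z0 assms by simp
      ultimately have "(real q * z) * cot (real q * z) \<le> (2 * z) * cot (2 * z)"
        using z0 by (intro mult_cot_antimono) auto
      then have "real q * cot (real q * z) \<le> 2 * cot (2 * z)" using z0 by simp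
      then show ?thesis using r by (simp add: cot_def field_simps)
    qed
    ultimately show "\<exists>y. ((\<lambda>z. sin (real q * z) / sin (2 * z)) has_real_derivative y) (at z) \<and> y \<le> 0"
      using r by (intro exI conjI) (auto intro!: divide_nonpos_pos)
  qed
  moreover have "0 < sin (pi / real q)" using rng[of v] uv v by simp
  moreover have "sin (real q * v) = 1" "sin (2 * v) = sin (pi / real q)" using v(2,3) sin_pi_half by metis+
  ultimately have "1 / sin (pi / real q) \<le> sin (real q * u) / sin (2 * u)" "0 < sin (pi / real q)" by simp_all
  then show ?thesis using rng[of u] uv by (simp add: divide_le_eq le_divide_eq)
qed (use assms in auto)

text \<open>The difference \<open>P\<close> of the two sides vanishes at 0 and is symmetric about
  h/2, and on [0, h/2] its derivative at z is q times the gap in \<open>sin_quotient_bound\<close>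
  at u = h/2 - z.\<close>

lemma mult_sin_sin_le:
  assumes "q \<ge> 2" "0 \<le> x" "x \<le> pi / real q"
  shows "real q * sin x * sin (pi / real q - x) \<le> sin (real q * x) * sin (pi / real q)"
proof -
  define h where "h = pi / real q"
  define P where "P = (\<lambda>x. sin (real q * x) * sin h - real q * sin x * sin (h - x))"
  have qh: "real q * h = pi" using assms by (simp add: h_def)
  have low: "0 \<le> P x" if x: "0 \<le> x" "x \<le> h / 2" for x
  proof -
    have "P 0 \<le> P x"
    proof (rule DERIV_nonneg_imp_nondecreasing[OF x(1)])
      fix z assume z: "0 \<le> z" "z \<le> x"
      have "(P has_real_derivative (real q * cos (real q * z) * sin h
          - real q * (cos z * sin (h - z) - sin z * cos (h - z)))) (at z)"
        unfolding P_def by (auto intro!: derivative_eq_intros simp: algebra_simps)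
      moreover have "cos z * sin (h - z) - sin z * cos (h - z) = sin (2 * (h / 2 - z))"
      proof -
        have "sin (2 * (h / 2 - z)) = sin ((h - z) - z)" by (simp add: algebra_simps)
        also have "\<dots> = sin (h - z) * cos z - cos (h - z) * sin z" by (rule sin_diff)
        finally show ?thesis by (simp add: algebra_simps)
      qed
      moreover have "sin (2 * (h / 2 - z)) \<le> sin (real q * (h / 2 - z)) * sin h"
        unfolding h_def using assms x z by (intro sin_quotient_bound) (auto simp: h_def divide_divide_eq_left mult.commute)
      moreover have "sin (real q * (h / 2 - z)) = cos (real q * z)"
      proof -
        have "real q * (h / 2 - z) = pi / 2 - real q * z" using qh by (simp add: algebra_simps)
        then show ?thesis by (simp add: sin_cos_eq[symmetric] cos_sin_eq)
      qed
      ultimately have "(P has_real_derivative (real q * (cos (real q * z) * sin h - sin (2 * (h / 2 - z))))) (at z)"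
        "0 \<le> cos (real q * z) * sin h - sin (2 * (h / 2 - z))"
        by (simp_all add: right_diff_distrib mult.assoc)
      then show "\<exists>y. (P has_real_derivative y) (at z) \<and> 0 \<le> y"
        by (meson mult_nonneg_nonneg of_nat_0_le_iff)
    qed
    then show ?thesis by (simp add: P_def)
  qed
  have sym: "P (h - x) = P x"
  proof -
    have "real q * (h - x) = pi - real q * x" "h - (h - x) = x" using qh by (simp_all add: right_diff_distrib)
    then show ?thesis by (simp only: P_def) simp
  qed
  have "0 \<le> P x"
  proof (cases "x \<le> h / 2")
    case True then show ?thesis using low assms by auto
  next
    case False
    then have "0 \<le> P (h - x)" using assms by (intro low) (auto simp: h_def)
    then show ?thesis using sym by simp
  qed
  then show ?thesis by (simp add: P_def h_def)
qed

lemma cot_antimono_less: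
  fixes x y :: real
  assumes "0 < x" "x < y" "y < pi"
  shows "cot y < cot x"
proof -
  have s: "sin x > 0" "sin y > 0" "sin (y - x) > 0" using assms by (auto intro!: sin_gt_zero)
  have "cot x - cot y = sin (y - x) / (sin x * sin y)"
    using s by (simp add: cot_def sin_diff field_simps)
  moreover have "\<dots> > 0" using s by simp
  ultimately show ?thesis by simp
qed

text \<open>Up to the factor pi, the left side is the slope of f at the left end -x/pi of an arc.
  The bound by the cotangent of the complementary angle makes ln(sin \<eta>) grow faster than the
  linear term in \<open>far_branch_ineq\<close>.\<close>

lemma cot_sub_mult_cot_le:
  assumes q: "q \<ge> 3" and x: "0 < x" "x < pi / real q"
  shows "cot x - real q * cot (real q * x) \<le> (real q - 1) * cot (pi / real q - x)"
proof -
  define h where "h = pi / real q"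
  define x' where "x' = h - x"
  have qh: "real q * h = pi" using assms by (simp add: h_def)
  have q2: "q \<ge> 2" using q by simp
  have x': "0 < x'" "x' < pi / real q" using x by (auto simp: x'_def h_def)
  note s = sin_nz_small[OF q2 x] and s' = sin_nz_small[OF q2 x']
  have c': "cot x' > 0" using s' x' by (auto simp: cot_def intro!: divide_pos_pos cos_gt_zero)
  have "cot x - real q * cot (real q * x) \<le> (real q - 1) * cot x'"
  proof (cases "x' \<le> x")
    case True
    \<comment> \<open>Reflection in h/2 turns -cot(q x) into cot(q x'), so each of the two terms is
      at most cot x'; their sum 2 cot x' is where q >= 3 enters.\<close>
    have "cot x \<le> cot x'" using cot_antimono_less[of x' x] True s x' pi_gt_zero
      by (cases "x' = x") auto
    moreover have "- cot (real q * x) = cot (real q * x')"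
      using qh by (simp add: x'_def right_diff_distrib cot_def sin_diff cos_diff)
    moreover have "(real q * x') * cot (real q * x') \<le> x' * cot x'"
      using x' s' q2 by (intro mult_cot_antimono) auto
    then have "real q * cot (real q * x') \<le> cot x'" using x' by simp
    ultimately have "cot x - real q * cot (real q * x) \<le> 2 * cot x'" by (smt (verit) mult_minus_right)
    also have "\<dots> \<le> (real q - 1) * cot x'" using q c' by (intro mult_right_mono) auto
    finally show ?thesis .
  next
    case False
    show ?thesis
    proof (cases "q = 3")
      \<comment> \<open>The estimate for q >= 4 needs (q - 2) cos(pi/q) >= 1, which fails for q = 3.
        Here everything is rational in sin x and cos x, and cancelling
        \<open>sqrt 3 * c0 - s0\<close> leaves 8 c0 s0 <= 8 c0 s0 + 2 sqrt 3.\<close>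
      case True
      define s0 c0 where "s0 = sin x" and "c0 = cos x"
      have sc: "s0^2 + c0^2 = 1" by (simp add: s0_def c0_def)
      have s0: "s0 > 0" "c0 > 0" using s by (auto simp: s0_def c0_def intro!: cos_gt_zero)
           (use x in linarith)
      have h3: "h = pi / 3" using True by (simp add: h_def)
      have sx': "sin x' = (sqrt 3 * c0 - s0) / 2"
        by (simp add: x'_def h3 sin_diff sin_60 cos_60 s0_def c0_def algebra_simps diff_divide_distrib)
      have cx': "cos x' = (c0 + sqrt 3 * s0) / 2"
        by (simp add: x'_def h3 cos_diff sin_60 cos_60 s0_def c0_def algebra_simps add_divide_distrib)
      have s3: "sin (3 * x) = s0 * (4 * c0^2 - 1)"
      proof -
        have "sin (3 * x) = sin (2 * x + x)" by (simp add: algebra_simps)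
        also have "\<dots> = 2 * s0 * c0 * c0 + (c0^2 - s0^2) * s0"
          by (simp only: sin_add sin_double cos_double s0_def c0_def)
        also have "\<dots> = s0 * (3 * c0^2 - s0^2)" by (simp add: power2_eq_square algebra_simps)
        also have "s0^2 = 1 - c0^2" using sc by simp
        finally show ?thesis by (simp add: algebra_simps)
      qed
      have c3: "cos (3 * x) = c0 * (4 * c0^2 - 3)"
      proof -
        have "cos (3 * x) = cos (2 * x + x)" by (simp add: algebra_simps)
        also have "\<dots> = (c0^2 - s0^2) * c0 - 2 * s0 * c0 * s0"
          by (simp only: cos_add sin_double cos_double s0_def c0_def)
        also have "\<dots> = c0 * (c0^2 - 3 * s0^2)" by (simp add: power2_eq_square algebra_simps)
        also have "s0^2 = 1 - c0^2" using sc by simp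
        finally show ?thesis by (simp add: algebra_simps)
      qed
      have A: "4 * c0^2 - 1 > 0" using s s0 s3 True by (simp add: zero_less_mult_iff)
      have A2: "4 * c0^2 - 1 = (sqrt 3 * c0 - s0) * (sqrt 3 * c0 + s0)"
      proof -
        have "(sqrt 3 * c0 - s0) * (sqrt 3 * c0 + s0) = 3 * c0^2 - s0^2"
          by (simp add: algebra_simps power2_eq_square)
        then show ?thesis using sc by simp
      qed
      have B: "sqrt 3 * c0 - s0 > 0" using s' sx' by simp
      have C: "sqrt 3 * c0 + s0 > 0" using s0 by (intro add_pos_pos mult_pos_pos) auto
      have "cot x - 3 * cot (3 * x) = c0 * (4 * c0^2 - 1 - 3 * (4 * c0^2 - 3)) / (s0 * (4 * c0^2 - 1))"
        unfolding cot_def s3 c3 s0_def[symmetric] c0_def[symmetric]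
        using s0 A by (simp add: divide_simps) (simp add: algebra_simps)
      also have "c0 * (4 * c0^2 - 1 - 3 * (4 * c0^2 - 3)) = 8 * c0 * s0^2"
      proof -
          have "s0^2 = 1 - c0^2" using sc by simp
          then show ?thesis by (simp only: \<open>s0^2 = 1 - c0^2\<close>) (simp add: algebra_simps)
        qed
      also have "8 * c0 * s0^2 / (s0 * (4 * c0^2 - 1)) = 8 * c0 * s0 / (4 * c0^2 - 1)"
        using s0 by (simp add: power2_eq_square)
      also have "\<dots> \<le> 2 * (c0 + sqrt 3 * s0) / (sqrt 3 * c0 - s0)"
      proof -
        have "(c0 + sqrt 3 * s0) * (sqrt 3 * c0 + s0) = 4 * c0 * s0 + sqrt 3 * (c0^2 + s0^2)"
          by (simp add: algebra_simps power2_eq_square)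
        then have "8 * c0 * s0 \<le> 2 * (c0 + sqrt 3 * s0) * (sqrt 3 * c0 + s0)"
          by (simp only: mult.assoc) simp
        then have "8 * c0 * s0 / ((sqrt 3 * c0 - s0) * (sqrt 3 * c0 + s0))
          \<le> 2 * (c0 + sqrt 3 * s0) * (sqrt 3 * c0 + s0) / ((sqrt 3 * c0 - s0) * (sqrt 3 * c0 + s0))"
          using B C by (intro divide_right_mono) auto
        then show ?thesis using A2 C by simp
      qed
      also have "\<dots> = 2 * cot x'"
      proof -
        have "cot x' = (c0 + sqrt 3 * s0) / (sqrt 3 * c0 - s0)"
        proof -
          have "(a / 2) / (b / 2) = a / b" for a b :: real by simp
          then show ?thesis by (simp only: cot_def sx' cx')
        qed
        then show ?thesis by simp
      qed
      finally show ?thesis using True by simp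
    next
      case q4: False
      \<comment> \<open>The left side increases with x, and x < h/2. At h/2 the term with cot(q x)
        vanishes, leaving cot(h/2).\<close>
      have "- dirichlet_logderiv q x \<le> - dirichlet_logderiv q (h / 2)"
        using dirichlet_logderiv_strict_antimono[of q x "h/2"] False q x pi_gt_zero
        by (auto simp: x'_def h_def)
      moreover have "dirichlet_logderiv q (h / 2) = real q * cot (pi / 2) - cot (h / 2)"
      proof -
        have "0 < h" using q by (simp add: h_def)
        then have "0 < h / 2" "h / 2 < pi / real q" by (simp_all add: h_def[symmetric])
        moreover have "real q * (h / 2) = pi / 2" using qh by simp
        ultimately show ?thesis using dirichlet_logderiv_eq[of q "h/2"] q2 by (simp only:)
      qed
      ultimately have 1: "cot x - real q * cot (real q * x) \<le> cot (h / 2)"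
        using dirichlet_logderiv_eq[OF q2 x] by (simp add: cot_def)
      have "4 \<le> real q" using q q4 by simp
      then have h4: "0 < h" "h \<le> pi / 4" unfolding h_def by (simp, intro divide_left_mono) auto
      have sh: "sin h > 0" using h4 pi_gt_zero by (intro sin_gt_zero) linarith+
      have sh2: "sin (h / 2) > 0" "cos (h/2) > 0" using h4 pi_gt_zero
        by (intro sin_gt_zero cos_gt_zero; linarith)+
      have "cot (h / 2) = (1 + cos h) / sin h"
        using sin_double[of "h/2"] cos_double_cos[of "h/2"] sh2
        by (simp add: cot_def power2_eq_square)
      also have "\<dots> \<le> (real q - 1) * cos h / sin h"
      proof (rule divide_right_mono)
        have "cos (pi / 4) \<le> cos h" using h4 pi_gt_zero by (intro cos_monotone_0_pi_le) auto
        moreover have "1 \<le> sqrt 2" by simp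
        ultimately have "1 / 2 \<le> cos h" unfolding cos_45 by linarith
        then have "2 * (1/2) \<le> (real q - 2) * cos h" using q q4 by (intro mult_mono) auto
        then show "1 + cos h \<le> (real q - 1) * cos h" by (simp add: algebra_simps)
      qed (use sh in auto)
      also have "\<dots> = (real q - 1) * cot h" by (simp add: cot_def)
      also have "\<dots> \<le> (real q - 1) * cot x'"
      proof (rule mult_left_mono)
        have "h < pi" using h4 pi_gt_zero by linarith
        moreover have "x' < h" using x by (simp add: x'_def)
        ultimately show "cot h \<le> cot x'" using cot_antimono_less[of x' h] x' by simp
      qed (use q in simp)
      finally show ?thesis using 1 by simp
    qed
  qed
  then show ?thesis by (simp add: x'_def h_def)
qed

text \<open>The left side depends on \<eta> through ln(sin \<eta>) - K \<eta>, which is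
  nondecreasing since cot \<eta> >= cot x' >= K. The worst case is thus \<eta> = x' = pi/q - x,
  where the linear term vanishes and \<open>mult_sin_sin_le\<close> applies; strictness comes from
  \<zeta>.\<close>

lemma far_branch_ineq:
  assumes q: "q \<ge> 3" and x: "0 < x" "x < pi / real q"
    and \<eta>: "0 < \<eta>" "\<eta> \<le> pi / real q - x" and \<zeta>: "sin (pi / real q) < \<zeta>"
  shows "ln (sin \<eta> / \<zeta>) + ln (real q) - ln (dirichlet q x)
     + (cot x - real q * cot (real q * x)) * (pi / real q - x - \<eta>) / (real q - 1) < 0"
proof -
  define K where "K = (cot x - real q * cot (real q * x)) / (real q - 1)"
  define x' where "x' = pi / real q - x"
  have q2: "q \<ge> 2" using q by simp
  have x': "0 < x'" "x' < pi / real q" using x by (auto simp: x'_def)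
  note s = sin_nz_small[OF q2 x] and s' = sin_nz_small[OF q2 x']
  have K: "K \<le> cot x'" unfolding K_def x'_def using cot_sub_mult_cot_le[OF q x] q
    by (simp add: divide_le_eq mult.commute)
  have sh: "sin (pi / real q) > 0" using q pi_gt_zero
    by (intro sin_gt_zero) (auto simp: divide_less_eq)
  have "ln (sin \<eta>) - K * \<eta> \<le> ln (sin x') - K * x'"
  proof (rule DERIV_nonneg_imp_nondecreasing[of \<eta> x' "\<lambda>z. ln (sin z) - K * z"])
    show "\<eta> \<le> x'" using \<eta> by (simp add: x'_def)
  next
    fix z assume z: "\<eta> \<le> z" "z \<le> x'"
    have sz: "sin z > 0" using z \<eta> s' pi_gt_zero by (intro sin_gt_zero) linarith+
    have "((\<lambda>z. ln (sin z) - K * z) has_real_derivative (cot z - K)) (at z)"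
      using sz by (auto intro!: derivative_eq_intros simp: cot_def)
    moreover have "cot x' \<le> cot z" using z \<eta> cot_antimono_less[of z x'] s' pi_gt_zero
      by (cases "z = x'") auto
    ultimately show "\<exists>y. ((\<lambda>z. ln (sin z) - K * z) has_real_derivative y) (at z) \<and> 0 \<le> y"
      using K by (intro exI[of _ "cot z - K"]) auto
  qed
  moreover have "\<eta> \<le> x'" using \<eta> by (simp add: x'_def)
  then have "sin \<eta> > 0" using \<eta>(1) s' pi_gt_zero by (intro sin_gt_zero) linarith+
  moreover have "ln (real q * sin x * sin x') \<le> ln (sin (real q * x) * sin (pi / real q))"
    using mult_sin_sin_le[OF q2, of x] x s s' q sh by (subst ln_le_cancel_iff) (auto simp: x'_def)
  then have "ln (real q) + ln (sin x) + ln (sin x') \<le> ln (sin (real q * x)) + ln (sin (pi / real q))"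
    using s s' q sh by (simp add: ln_mult)
  moreover have "ln (sin (pi / real q)) < ln \<zeta>" using \<zeta> sh by (subst ln_less_cancel_iff) auto
  moreover have "dirichlet q x = sin (real q * x) / sin x" using sin_mult_dirichlet[of x q] s
    by (simp add: field_simps)
  then have "ln (dirichlet q x) = ln (sin (real q * x)) - ln (sin x)" using s by (simp add: ln_div)
  moreover have "(cot x - real q * cot (real q * x)) * (pi / real q - x - \<eta>) / (real q - 1) = K * x' - K * \<eta>"
    unfolding right_diff_distrib[symmetric] by (simp add: K_def x'_def)
  moreover have "ln (sin \<eta> / \<zeta>) = ln (sin \<eta>) - ln \<zeta>"
    using \<open>sin \<eta> > 0\<close> \<zeta> sh by (simp add: ln_div)
  ultimately show ?thesis by linarith
qed

section \<open>Periodic functions\<close>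

lemma periodic_add_of_int:
  fixes f :: "real \<Rightarrow> 'a"
  assumes "\<And>x. f (x + 1) = f x"
  shows "f (x + of_int n) = f x"
proof -
  have *: "f (x + real m) = f x" for x m
  proof (induction m)
    case (Suc m)
    have "f (x + real (Suc m)) = f ((x + real m) + 1)" by (simp add: add_ac)
    then show ?case using assms Suc by simp
  qed simp
  show ?thesis
  proof (cases "n \<ge> 0")
    case True then show ?thesis using *[of x "nat n"] by simp
  next
    case False then show ?thesis using *[of "x + of_int n" "nat (- n)"] by simp
  qed
qed

lemma periodic_frac:
  fixes f :: "real \<Rightarrow> 'a"
  assumes "\<And>x. f (x + 1) = f x"
  shows "f (frac x) = f x"
  using periodic_add_of_int[of f "frac x" "\<lfloor>x\<rfloor>", OF assms] by (simp add: frac_def)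

lemma frac_frac_diff: "frac (frac x - y) = frac (x - (y :: real))"
proof -
  have "frac x - y = (x - y) + of_int (- \<lfloor>x\<rfloor>)" by (simp add: frac_def)
  then show ?thesis by (simp only: frac_add_of_int_right)
qed

lemma integrable_on_bounded_borel:
  fixes f :: "real \<Rightarrow> real"
  assumes "f \<in> borel_measurable borel" "\<And>x. x \<in> {a..b} \<Longrightarrow> \<bar>f x\<bar> \<le> B"
  shows "f integrable_on {a..b}"
proof -
  have "set_integrable lborel {a..b} f" unfolding set_integrable_def
    by (rule integrableI_bounded_set_indicator[where B = B])
       (use assms in \<open>auto simp: emeasure_lborel_Icc_eq\<close>)
  then show ?thesis by (rule set_borel_integral_eq_integral(1))
qed

lemma integral_shift_periodic:
  fixes f :: "real \<Rightarrow> real"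
  assumes "\<And>x. f (x + 1) = f x"
  shows "integral {a + of_int k..b + of_int k} f = integral {a..b} f"
proof -
  have "f \<circ> (+) (of_int k) = f" using periodic_add_of_int[of f, OF assms] by (auto simp: o_def add.commute)
  then show ?thesis using integral_shift_Icc_real[of a b f "of_int k"] by simp
qed

lemma integral_period:
  fixes f :: "real \<Rightarrow> real"
  assumes per: "\<And>x. f (x + 1) = f x" and int: "\<And>a b. f integrable_on {a..b}"
  shows "integral {a..a + 1} f = integral {0..1} f"
proof -
  define r where "r = frac a"
  have r: "0 \<le> r" "r < 1" "a = r + of_int \<lfloor>a\<rfloor>" by (simp_all add: r_def frac_lt_1) (simp add: frac_def)
  have "integral {a..a + 1} f = integral {r..r + 1} f"
    using integral_shift_periodic[where f = f and a = r and b = "r + 1" and k = "\<lfloor>a\<rfloor>", OF per] r(3) by (simp add: algebra_simps)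
  also have "\<dots> = integral {r..1} f + integral {0 + 1..r + 1} f"
    using Henstock_Kurzweil_Integration.integral_combine[of r 1 "r + 1" f] r int by simp
  also have "integral {0 + 1..r + 1} f = integral {0..r} f"
    using integral_shift_periodic[where f = f and a = 0 and b = r and k = 1, OF per] by simp
  also have "integral {r..1} f + integral {0..r} f = integral {0..1} f"
    using Henstock_Kurzweil_Integration.integral_combine[of 0 r 1 f] r int by simp
  finally show ?thesis .
qed

text \<open>Taking \<open>frac\<close> makes periodicity automatic; it is a primitive of f across
  the integers only when f has mean zero over a period.\<close>

definition periodic_primitive :: "(real \<Rightarrow> real) \<Rightarrow> real \<Rightarrow> real" where
  "periodic_primitive f x = integral {0..frac x} f"

lemma periodic_primitive_add_1: "periodic_primitive f (x + 1) = periodic_primitive f x"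
  by (simp add: periodic_primitive_def frac_1_eq)

lemma periodic_primitive_diff:
  fixes f :: "real \<Rightarrow> real"
  assumes per: "\<And>x. f (x + 1) = f x" and int: "\<And>a b. f integrable_on {a..b}"
    and zero: "integral {0..1} f = 0" and ab: "a \<le> b"
  shows "periodic_primitive f b - periodic_primitive f a = integral {a..b} f"
proof -
  define N :: int where "N = \<lfloor>a\<rfloor>"
  have z: "integral {of_int N..of_int N + real n} f = 0" for n
  proof (induction n)
    case (Suc n)
    have "integral {of_int N..of_int N + real (Suc n)} f =
       integral {of_int N..of_int N + real n} f + integral {of_int N + real n..of_int N + real n + 1} f"
      using Henstock_Kurzweil_Integration.integral_combine[of "of_int N" "of_int N + real n" "of_int N + real (Suc n)" f] int
      by (simp add: add_ac)
    then show ?case using Suc integral_period[where f = f and a = "of_int N + real n", OF per int] zero by simp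
  qed simp
  have P: "integral {of_int N..x} f = periodic_primitive f x" if "of_int N \<le> x" for x
  proof -
    define n where "n = nat (\<lfloor>x\<rfloor> - N)"
    have "N \<le> \<lfloor>x\<rfloor>" using that by (simp add: le_floor_iff)
    then have n: "of_int N + real n = of_int \<lfloor>x\<rfloor>" by (simp add: n_def)
    have "integral {of_int N..x} f = integral {of_int N..of_int \<lfloor>x\<rfloor>} f + integral {of_int \<lfloor>x\<rfloor>..x} f"
      using Henstock_Kurzweil_Integration.integral_combine[of "of_int N" "of_int \<lfloor>x\<rfloor>" x f] int \<open>N \<le> \<lfloor>x\<rfloor>\<close> by simp
    also have "integral {of_int N..of_int \<lfloor>x\<rfloor>} f = 0" using z[of n] n by simp
    also have "integral {of_int \<lfloor>x\<rfloor>..x} f = integral {0..frac x} f"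
      using integral_shift_periodic[where f = f and a = 0 and b = "frac x" and k = "\<lfloor>x\<rfloor>", OF per] by (simp add: frac_def)
    finally show ?thesis by (simp add: periodic_primitive_def)
  qed
  have "of_int N \<le> a" by (simp add: N_def)
  moreover have "integral {of_int N..a} f + integral {a..b} f = integral {of_int N..b} f"
    using Henstock_Kurzweil_Integration.integral_combine[of "of_int N" a b f] int ab calculation by simp
  ultimately show ?thesis using P[of a] P[of b] ab by simp
qed

section \<open>The inverse branch and its series operator\<close>

text \<open>The preimage of x mod 1 under T whose lift lies in [\<gamma>, \<gamma> + 1/q); as a
  function of real x it has period 1 and jumps where x - q \<gamma> is an integer.\<close>

definition tau :: "nat \<Rightarrow> real \<Rightarrow> real \<Rightarrow> real" where
  "tau q \<gamma> x = \<gamma> + frac (x - real q * \<gamma>) / real q"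

definition branch_series :: "nat \<Rightarrow> real \<Rightarrow> (real \<Rightarrow> real) \<Rightarrow> real \<Rightarrow> real" where
  "branch_series q \<gamma> p x = (\<Sum>n. p ((tau q \<gamma> ^^ Suc n) x) / real q ^ Suc n)"

locale inverse_branch =
  fixes q :: nat and \<gamma> :: real
  assumes q2: "q \<ge> 2"
begin

abbreviation (input) "\<delta> \<equiv> \<gamma> + 1 / real q"

lemma tau_in: "\<gamma> \<le> tau q \<gamma> x" "tau q \<gamma> x < \<delta>"
  using q2 frac_lt_1[of "x - real q * \<gamma>"] by (auto simp: tau_def divide_strict_right_mono)

lemma tau_add_1: "tau q \<gamma> (x + 1) = tau q \<gamma> x"
proof -
  have "x + 1 - real q * \<gamma> = (x - real q * \<gamma>) + 1" by simp
  then show ?thesis unfolding tau_def by (metis frac_1_eq)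
qed

lemma tau_mult: assumes "\<gamma> \<le> u" "u < \<delta>" shows "tau q \<gamma> (real q * u) = u"
proof -
  have "0 \<le> real q * (u - \<gamma>)" using assms by simp
  moreover have "real q * (u - \<gamma>) < 1" using assms q2 by (simp add: field_simps)
  ultimately have "frac (real q * (u - \<gamma>)) = real q * (u - \<gamma>)" by (simp add: frac_eq)
  then show ?thesis using q2 by (simp add: tau_def right_diff_distrib[symmetric])
qed

lemma tau_funpow_in: "\<gamma> \<le> (tau q \<gamma> ^^ Suc n) x" "(tau q \<gamma> ^^ Suc n) x < \<delta>"
  using tau_in by simp_all

lemma tau_funpow_mem: "(tau q \<gamma> ^^ Suc n) x \<in> {\<gamma>..\<delta>}"
  using tau_funpow_in[of n x] by (metis atLeastAtMost_iff less_imp_le)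

lemma tau_measurable [measurable]: "tau q \<gamma> \<in> borel_measurable borel"
  unfolding tau_def[abs_def] frac_def by measurable

lemma tau_funpow_measurable: "(tau q \<gamma> ^^ n) \<in> borel_measurable borel"
proof (induction n)
  case (Suc n)
  show ?case using measurable_comp[OF Suc tau_measurable] by simp
qed (simp add: id_def)

lemma geometric: "(\<lambda>n. e / real q ^ Suc n) sums (e / (real q - 1))"
proof -
  have "(\<lambda>n. (e / real q) * (1 / real q) ^ n) sums ((e / real q) * (1 / (1 - 1 / real q)))"
    using q2 by (intro sums_mult geometric_sums) auto
  moreover have "(e / real q) * (1 / (1 - 1 / real q)) = e / (real q - 1)"
    using q2 by (simp add: divide_simps)
  moreover have "(\<lambda>n. (e / real q) * (1 / real q) ^ n) = (\<lambda>n. e / real q ^ Suc n)"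
    by (simp add: power_divide)
  ultimately show ?thesis by (simp only:)
qed

context
  fixes p :: "real \<Rightarrow> real" and B :: real
  assumes p_bound: "\<And>u. u \<in> {\<gamma>..\<delta>} \<Longrightarrow> \<bar>p u\<bar> \<le> B"
begin

text \<open>A bound for p on the closed arc is enough, and for f' no global bound exists: the series
  starts with the first iterate of \<open>tau\<close>, so p is never evaluated at x itself.\<close>

lemma branch_series_summable: "summable (\<lambda>n. p ((tau q \<gamma> ^^ Suc n) x) / real q ^ Suc n)"
proof (rule summable_comparison_test')
  show "summable (\<lambda>n. B / real q ^ Suc n)" using geometric sums_summable by blast
  show "norm (p ((tau q \<gamma> ^^ Suc n) x) / real q ^ Suc n) \<le> B / real q ^ Suc n" for n
    using p_bound[OF tau_funpow_mem[of n x]] q2 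
    by (simp add: abs_divide divide_right_mono del: funpow.simps)
qed

lemma branch_series_upper: assumes "\<And>u. u \<in> {\<gamma>..\<delta>} \<Longrightarrow> p u \<le> e" shows "branch_series q \<gamma> p x \<le> e / (real q - 1)"
proof -
  have "branch_series q \<gamma> p x \<le> (\<Sum>n. e / real q ^ Suc n)"
    unfolding branch_series_def using geometric sums_summable q2 assms[OF tau_funpow_mem]
    by (intro suminf_le branch_series_summable) (auto simp: divide_right_mono simp del: funpow.simps power_Suc)
  then show ?thesis using geometric[of e] by (simp add: sums_iff)
qed

lemma branch_series_lower: assumes "\<And>u. u \<in> {\<gamma>..\<delta>} \<Longrightarrow> e \<le> p u" shows "e / (real q - 1) \<le> branch_series q \<gamma> p x"
proof -
  have "(\<Sum>n. e / real q ^ Suc n) \<le> branch_series q \<gamma> p x"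
    unfolding branch_series_def using geometric sums_summable q2 assms[OF tau_funpow_mem]
    by (intro suminf_le branch_series_summable) (auto simp: divide_right_mono simp del: funpow.simps power_Suc)
  then show ?thesis using geometric[of e] by (simp add: sums_iff)
qed

lemma branch_series_bound: "\<bar>branch_series q \<gamma> p x\<bar> \<le> B / (real q - 1)"
proof -
  have "p u \<le> B" "- B \<le> p u" if "u \<in> {\<gamma>..\<delta>}" for u using p_bound[OF that] by auto
  then have "branch_series q \<gamma> p x \<le> B / (real q - 1)" "(- B) / (real q - 1) \<le> branch_series q \<gamma> p x"
    using branch_series_upper[of B x] branch_series_lower[of "-B" x] by auto
  then show ?thesis by auto
qed

lemma branch_series_add_1: "branch_series q \<gamma> p (x + 1) = branch_series q \<gamma> p x"
  unfolding branch_series_def by (simp add: funpow_Suc_right tau_add_1 del: funpow.simps)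

lemma branch_series_rec: "branch_series q \<gamma> p x = (p (tau q \<gamma> x) + branch_series q \<gamma> p (tau q \<gamma> x)) / real q"
proof -
  have "branch_series q \<gamma> p x = p (tau q \<gamma> x) / real q + (\<Sum>n. p ((tau q \<gamma> ^^ Suc (Suc n)) x) / real q ^ Suc (Suc n))"
    unfolding branch_series_def using suminf_split_head[OF branch_series_summable[of x]] by simp
  also have "(\<Sum>n. p ((tau q \<gamma> ^^ Suc (Suc n)) x) / real q ^ Suc (Suc n)) =
     (\<Sum>n. (p ((tau q \<gamma> ^^ Suc n) (tau q \<gamma> x)) / real q ^ Suc n) / real q)"
    by (rule arg_cong[of _ _ suminf]) (auto simp: funpow_Suc_right simp del: funpow.simps)
  also have "\<dots> = branch_series q \<gamma> p (tau q \<gamma> x) / real q"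
    unfolding branch_series_def by (rule suminf_divide[OF branch_series_summable])
  finally show ?thesis by (simp add: add_divide_distrib)
qed

context
  assumes p_meas: "p \<in> borel_measurable borel"
begin

lemma branch_series_measurable: "branch_series q \<gamma> p \<in> borel_measurable borel"
  unfolding branch_series_def[abs_def]
  by (intro borel_measurable_suminf borel_measurable_divide borel_measurable_const
      measurable_compose[OF tau_funpow_measurable p_meas])

lemma branch_series_integrable: "branch_series q \<gamma> p integrable_on {a..b}"
  by (rule integrable_on_bounded_borel[OF branch_series_measurable branch_series_bound])

lemma p_integrable: "\<gamma> \<le> a \<Longrightarrow> b \<le> \<delta> \<Longrightarrow> p integrable_on {a..b}"
  by (rule integrable_on_bounded_borel[OF p_meas p_bound]) auto

text \<open>Integrated form of q s(q u) = p(u) + s(u), after the substitution x = q u.\<close>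

lemma integral_branch_series_image:
  assumes "\<gamma> \<le> y" "y \<le> \<delta>"
  shows "integral {real q * \<gamma>..real q * y} (branch_series q \<gamma> p) = integral {\<gamma>..y} p + integral {\<gamma>..y} (branch_series q \<gamma> p)"
proof -
  define I where "I = integral {real q * \<gamma>..real q * y} (branch_series q \<gamma> p)"
  have im: "(\<lambda>x. x / real q) ` {real q * \<gamma>..real q * y} = {\<gamma>..y}"
    using q2 assms(1) image_divide_atLeastAtMost[of "real q" "real q * \<gamma>" "real q * y"] by simp
  have "((\<lambda>u. branch_series q \<gamma> p (real q * u)) has_integral (1 / real q) * I) {\<gamma>..y}"
    using has_integral_stretch_real[of "branch_series q \<gamma> p" I "real q * \<gamma>" "real q * y" "real q"] q2 branch_series_integrable
    by (simp add: I_def integrable_integral im)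
  then have "((\<lambda>u. (p u + branch_series q \<gamma> p u) / real q) has_integral (1 / real q) * I) {\<gamma>..y}"
  \<comment> \<open>At the right end of the arc \<open>tau\<close> jumps back to \<gamma>, so the
    recursion is lost at this one point.\<close>
  proof (rule has_integral_spike_finite[rotated 2])
    show "finite {\<delta>}" by simp
    fix u assume u: "u \<in> {\<gamma>..y} - {\<delta>}"
    then have "\<gamma> \<le> u" "u < \<delta>" using assms by auto
    then show "(p u + branch_series q \<gamma> p u) / real q = branch_series q \<gamma> p (real q * u)"
      using branch_series_rec[of "real q * u"] tau_mult by simp
  qed
  then have "((\<lambda>u. real q * ((p u + branch_series q \<gamma> p u) / real q)) has_integral real q * ((1 / real q) * I)) {\<gamma>..y}"
    by (rule has_integral_mult_right)
  then have "((\<lambda>u. p u + branch_series q \<gamma> p u) has_integral I) {\<gamma>..y}" using q2 by simp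
  then have "I = integral {\<gamma>..y} (\<lambda>u. p u + branch_series q \<gamma> p u)" by (simp add: integral_unique)
  also have "\<dots> = integral {\<gamma>..y} p + integral {\<gamma>..y} (branch_series q \<gamma> p)"
    using p_integrable branch_series_integrable assms by (intro Henstock_Kurzweil_Integration.integral_add) auto
  finally show ?thesis by (simp add: I_def)
qed

text \<open>Multiplication by q stretches the arc to a full period. The integral of the series over
  the arc then appears both in the image formula and in the period, and cancels.\<close>

lemma integral_branch_series_complement: "integral {\<delta>..\<gamma> + 1} (branch_series q \<gamma> p) = integral {\<gamma>..\<delta>} p"
proof -
  have q1: "1 / real q \<le> 1" using q2 by simp
  have "real q * \<delta> = real q * \<gamma> + 1" using q2 by (simp add: field_simps)
  then have "integral {\<gamma>..\<delta>} p + integral {\<gamma>..\<delta>} (branch_series q \<gamma> p) = integral {real q * \<gamma>..real q * \<gamma> + 1} (branch_series q \<gamma> p)"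
    using integral_branch_series_image[of \<delta>] q2 by simp
  also have "\<dots> = integral {\<gamma>..\<gamma> + 1} (branch_series q \<gamma> p)"
    using integral_period[of "branch_series q \<gamma> p"] branch_series_add_1 branch_series_integrable by metis
  also have "\<dots> = integral {\<gamma>..\<delta>} (branch_series q \<gamma> p) + integral {\<delta>..\<gamma> + 1} (branch_series q \<gamma> p)"
    using Henstock_Kurzweil_Integration.integral_combine[of \<gamma> \<delta> "\<gamma> + 1" "branch_series q \<gamma> p"] q1 branch_series_integrable by simp
  finally show ?thesis by simp
qed

lemma integral_branch_series_complement_le:
  assumes nn: "\<And>u. u \<in> {\<gamma>..\<delta>} \<Longrightarrow> 0 \<le> p u" and "\<delta> \<le> a" "b \<le> \<gamma> + 1"
  shows "integral {a..b} (branch_series q \<gamma> p) \<le> integral {\<gamma>..\<delta>} p"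
proof -
  have "0 \<le> branch_series q \<gamma> p x" for x using branch_series_lower[of 0 x] nn by simp
  then have "integral {a..b} (branch_series q \<gamma> p) \<le> integral {\<delta>..\<gamma> + 1} (branch_series q \<gamma> p)"
    using assms by (intro integral_subset_le branch_series_integrable) auto
  then show ?thesis using integral_branch_series_complement by simp
qed

end
end

lemma branch_series_mono:
  assumes "\<And>u. u \<in> {\<gamma>..\<delta>} \<Longrightarrow> \<bar>p u\<bar> \<le> B" "\<And>u. u \<in> {\<gamma>..\<delta>} \<Longrightarrow> \<bar>r u\<bar> \<le> B'"
    "\<And>u. u \<in> {\<gamma>..\<delta>} \<Longrightarrow> p u \<le> r u"
  shows "branch_series q \<gamma> p x \<le> branch_series q \<gamma> r x"
  unfolding branch_series_def using assms(3)[OF tau_funpow_mem]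
  by (intro suminf_le branch_series_summable[of p, OF assms(1)] branch_series_summable[of r, OF assms(2)])
     (auto intro!: divide_right_mono simp del: funpow.simps power_Suc)

lemma branch_series_add_const:
  assumes "\<And>u. u \<in> {\<gamma>..\<delta>} \<Longrightarrow> \<bar>p u\<bar> \<le> B"
  shows "branch_series q \<gamma> (\<lambda>u. p u + e) x = branch_series q \<gamma> p x + e / (real q - 1)"
proof -
  have "summable (\<lambda>n. e / real q ^ Suc n)" using geometric sums_summable by blast
  have "branch_series q \<gamma> (\<lambda>u. p u + e) x = (\<Sum>n. p ((tau q \<gamma> ^^ Suc n) x) / real q ^ Suc n + e / real q ^ Suc n)"
    by (simp add: branch_series_def add_divide_distrib)
  also have "\<dots> = branch_series q \<gamma> p x + (\<Sum>n. e / real q ^ Suc n)"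
    unfolding branch_series_def by (rule suminf_add[symmetric]) (rule branch_series_summable[OF assms], assumption, fact)
  finally show ?thesis using geometric[of e] by (simp add: sums_iff)
qed

lemma branch_series_minus:
  assumes "\<And>u. u \<in> {\<gamma>..\<delta>} \<Longrightarrow> \<bar>p u\<bar> \<le> B"
  shows "branch_series q \<gamma> (\<lambda>u. - p u) x = - branch_series q \<gamma> p x"
  unfolding branch_series_def using suminf_minus[OF branch_series_summable[OF assms]] by simp

end

section \<open>Increment bounds when p is decreasing\<close>

locale decreasing_branch = inverse_branch +
  fixes p :: "real \<Rightarrow> real"
  assumes p_meas: "p \<in> borel_measurable borel"
    and p_antimono: "\<And>u v. \<gamma> \<le> u \<Longrightarrow> u \<le> v \<Longrightarrow> v \<le> \<gamma> + 1 / real q \<Longrightarrow> p v \<le> p u"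
begin

definition "pB = max \<bar>p \<gamma>\<bar> \<bar>p \<delta>\<bar>"

lemma p_bound: "u \<in> {\<gamma>..\<delta>} \<Longrightarrow> \<bar>p u\<bar> \<le> pB"
  using p_antimono[of \<gamma> u] p_antimono[of u \<delta>] by (auto simp: pB_def)

lemma int_p: "\<gamma> \<le> a \<Longrightarrow> b \<le> \<delta> \<Longrightarrow> p integrable_on {a..b}"
  by (rule p_integrable[OF p_bound p_meas])

lemma int_branch_series: "branch_series q \<gamma> p integrable_on {a..b}"
  by (rule branch_series_integrable[OF p_bound p_meas])

lemma integral_branch_series_lipschitz:
  assumes "a \<le> b"
  shows "integral {a..b} (branch_series q \<gamma> p) \<le> p \<gamma> * (b - a) / (real q - 1)"
    "p \<delta> * (b - a) / (real q - 1) \<le> integral {a..b} (branch_series q \<gamma> p)"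
proof -
  have d: "\<gamma> \<le> \<delta>" by simp
  have 1: "branch_series q \<gamma> p x \<le> p \<gamma> / (real q - 1)" for x
    by (rule branch_series_upper[OF p_bound]) (use p_antimono[of \<gamma>] in auto)
  have 2: "p \<delta> / (real q - 1) \<le> branch_series q \<gamma> p x" for x
    by (rule branch_series_lower[OF p_bound]) (use p_antimono[of _ \<delta>] in auto)
  have "integral {a..b} (branch_series q \<gamma> p) \<le> integral {a..b} (\<lambda>x. p \<gamma> / (real q - 1))"
    using 1 by (intro integral_le int_branch_series) auto
  then show "integral {a..b} (branch_series q \<gamma> p) \<le> p \<gamma> * (b - a) / (real q - 1)" using assms by (simp add: mult.commute)
  have "integral {a..b} (\<lambda>x. p \<delta> / (real q - 1)) \<le> integral {a..b} (branch_series q \<gamma> p)"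
    using 2 by (intro integral_le int_branch_series) auto
  then show "p \<delta> * (b - a) / (real q - 1) \<le> integral {a..b} (branch_series q \<gamma> p)" using assms by (simp add: mult.commute)
qed

text \<open>A bathtub argument: p is at most its excess (p - e)^+ plus e. The excess contributes at
  most its integral over the arc, the constant contributes e (b - a)/(q - 1) = e l. With e =
  p(\<gamma> + l) the excess lives on [\<gamma>, \<gamma> + l], and the two terms e l cancel. The
  complement of the arc has length (q - 1)/q, so l <= 1/q.\<close>

lemma integral_branch_series_outside_le:
  assumes "\<delta> \<le> a" "a \<le> b" "b \<le> \<gamma> + 1"
  shows "integral {a..b} (branch_series q \<gamma> p) \<le> integral {\<gamma>..\<gamma> + (b - a) / (real q - 1)} p"
proof -
  define l where "l = (b - a) / (real q - 1)"
  have "b - a \<le> 1 - 1 / real q" using assms by simp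
  also have "\<dots> = (real q - 1) / real q" using q2 by (simp add: field_simps)
  finally have l: "0 \<le> l" "l \<le> 1 / real q" using assms q2 by (auto simp: l_def field_simps)
  define e where "e = p (\<gamma> + l)"
  define r where "r = (\<lambda>u. max 0 (p u - e))"
  have rB: "\<bar>r u\<bar> \<le> pB + \<bar>e\<bar>" if "u \<in> {\<gamma>..\<delta>}" for u using p_bound[OF that] by (auto simp: r_def)
  have rm: "r \<in> borel_measurable borel" using p_meas by (simp add: r_def)
  have "branch_series q \<gamma> p x \<le> branch_series q \<gamma> r x + e / (real q - 1)" for x
  proof -
    have "branch_series q \<gamma> p x \<le> branch_series q \<gamma> (\<lambda>u. r u + e) x"
      by (rule branch_series_mono[OF p_bound, where B' = "pB + \<bar>e\<bar> + \<bar>e\<bar>"]) (use rB in \<open>force simp: r_def\<close>)+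
    then show ?thesis using branch_series_add_const[of r "pB + \<bar>e\<bar>" e x] rB by simp
  qed
  then have "integral {a..b} (branch_series q \<gamma> p) \<le> integral {a..b} (\<lambda>x. branch_series q \<gamma> r x + e / (real q - 1))"
    by (intro integral_le int_branch_series Henstock_Kurzweil_Integration.integrable_add branch_series_integrable[OF rB rm]) auto
  also have "\<dots> = integral {a..b} (branch_series q \<gamma> r) + e * l"
    using assms by (subst Henstock_Kurzweil_Integration.integral_add[OF branch_series_integrable[OF rB rm]]) (auto simp: l_def)
  also have "integral {a..b} (branch_series q \<gamma> r) \<le> integral {\<gamma>..\<delta>} r"
    by (rule integral_branch_series_complement_le[OF rB rm]) (use assms in \<open>auto simp: r_def\<close>)
  also have "integral {\<gamma>..\<delta>} r = integral {\<gamma>..\<gamma> + l} r + integral {\<gamma> + l..\<delta>} r"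
    using l p_integrable[OF rB rm] by (intro Henstock_Kurzweil_Integration.integral_combine[symmetric]) auto
  also have "integral {\<gamma>..\<gamma> + l} r = integral {\<gamma>..\<gamma> + l} (\<lambda>u. p u - e)"
    using l p_antimono[of _ "\<gamma> + l"] by (intro Henstock_Kurzweil_Integration.integral_cong) (auto simp: r_def e_def)
  also have "\<dots> = integral {\<gamma>..\<gamma> + l} p - e * l"
    using l int_p by (subst Henstock_Kurzweil_Integration.integral_diff) auto
  also have "integral {\<gamma> + l..\<delta>} r = integral {\<gamma> + l..\<delta>} (\<lambda>_. 0)"
    using l p_antimono[of "\<gamma> + l"] by (intro Henstock_Kurzweil_Integration.integral_cong) (auto simp: r_def e_def)
  finally show ?thesis by (simp add: l_def)
qed

text \<open>The same argument from below, with the deficit (e - p)^+ at the right end of the arc and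
  e = p(\<delta> - l).\<close>

lemma integral_branch_series_outside_ge:
  assumes "\<delta> \<le> a" "a \<le> b" "b \<le> \<gamma> + 1"
  shows "integral {\<delta> - (b - a) / (real q - 1)..\<delta>} p \<le> integral {a..b} (branch_series q \<gamma> p)"
proof -
  define l where "l = (b - a) / (real q - 1)"
  have "b - a \<le> 1 - 1 / real q" using assms by simp
  also have "\<dots> = (real q - 1) / real q" using q2 by (simp add: field_simps)
  finally have l: "0 \<le> l" "l \<le> 1 / real q" using assms q2 by (auto simp: l_def field_simps)
  define e where "e = p (\<delta> - l)"
  define r where "r = (\<lambda>u. max 0 (e - p u))"
  have rB: "\<bar>r u\<bar> \<le> pB + \<bar>e\<bar>" if "u \<in> {\<gamma>..\<delta>}" for u using p_bound[OF that] by (auto simp: r_def)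
  have rm: "r \<in> borel_measurable borel" using p_meas by (simp add: r_def)
  have "e / (real q - 1) - branch_series q \<gamma> r x \<le> branch_series q \<gamma> p x" for x
  proof -
    have "branch_series q \<gamma> (\<lambda>u. - r u + e) x \<le> branch_series q \<gamma> p x"
      by (rule branch_series_mono[where B = "pB + \<bar>e\<bar> + \<bar>e\<bar>", OF _ p_bound]) (use rB in \<open>force simp: r_def\<close>)+
    then show ?thesis using branch_series_add_const[of "\<lambda>u. - r u" "pB + \<bar>e\<bar>" e x] branch_series_minus[of r "pB + \<bar>e\<bar>" x] rB by simp
  qed
  then have "integral {a..b} (\<lambda>x. e / (real q - 1) - branch_series q \<gamma> r x) \<le> integral {a..b} (branch_series q \<gamma> p)"
    by (intro integral_le int_branch_series Henstock_Kurzweil_Integration.integrable_diff branch_series_integrable[OF rB rm]) auto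
  moreover have "integral {a..b} (\<lambda>x. e / (real q - 1) - branch_series q \<gamma> r x) = e * l - integral {a..b} (branch_series q \<gamma> r)"
    using assms by (subst Henstock_Kurzweil_Integration.integral_diff[OF _ branch_series_integrable[OF rB rm]]) (auto simp: l_def)
  moreover have "integral {a..b} (branch_series q \<gamma> r) \<le> integral {\<gamma>..\<delta>} r"
    by (rule integral_branch_series_complement_le[OF rB rm]) (use assms in \<open>auto simp: r_def\<close>)
  moreover have "integral {\<gamma>..\<delta>} r = integral {\<gamma>..\<delta> - l} r + integral {\<delta> - l..\<delta>} r"
    using l p_integrable[OF rB rm] by (intro Henstock_Kurzweil_Integration.integral_combine[symmetric]) auto
  moreover have "integral {\<gamma>..\<delta> - l} r = integral {\<gamma>..\<delta> - l} (\<lambda>_. 0)"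
    using l p_antimono[of _ "\<delta> - l"] by (intro Henstock_Kurzweil_Integration.integral_cong) (auto simp: r_def e_def)
  moreover have "integral {\<delta> - l..\<delta>} r = integral {\<delta> - l..\<delta>} (\<lambda>u. e - p u)"
    using l p_antimono[of "\<delta> - l"] by (intro Henstock_Kurzweil_Integration.integral_cong) (auto simp: r_def e_def)
  moreover have "\<dots> = e * l - integral {\<delta> - l..\<delta>} p"
    using l int_p by (subst Henstock_Kurzweil_Integration.integral_diff) auto
  ultimately show ?thesis by (simp add: l_def)
qed

end

section \<open>Calibration off the arc\<close>

text \<open>f in the coordinate y = x + c, with the singularity at 0 removed; used for |y| < 1/q
  only, where the kernel is positive.\<close>

definition bump :: "nat \<Rightarrow> real \<Rightarrow> real" where
  "bump q y = ln (dirichlet q (pi * y))"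

definition bump' :: "nat \<Rightarrow> real \<Rightarrow> real" where
  "bump' q y = pi * dirichlet_logderiv q (pi * y)"

lemma bump_minus [simp]: "bump q (- y) = bump q y"
  by (simp add: bump_def)

lemma bump'_minus [simp]: "bump' q (- y) = - bump' q y"
  by (simp add: bump'_def)

lemma abs_pi_mult_less: "\<bar>y\<bar> < 1 / real q \<Longrightarrow> \<bar>pi * y\<bar> < pi / real q"
  using mult_strict_left_mono[of "\<bar>y\<bar>" "1 / real q" pi] by (simp add: abs_mult)

lemma DERIV_bump:
  assumes "q \<ge> 2" "\<bar>y\<bar> < 1 / real q"
  shows "(bump q has_real_derivative bump' q y) (at y)"
proof -
  have "((\<lambda>y. ln (dirichlet q (pi * y))) has_real_derivative (dirichlet_logderiv q (pi * y) * pi)) (at y)"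
    by (rule DERIV_chain2[where f = "\<lambda>x. ln (dirichlet q x)" and g = "\<lambda>y. pi * y",
          OF DERIV_ln_dirichlet[OF assms(1) abs_pi_mult_less[OF assms(2)]]])
       (auto intro!: derivative_eq_intros)
  then show ?thesis unfolding bump_def[abs_def] bump'_def by (simp add: mult.commute)
qed

lemma bump'_strict_antimono:
  assumes "q \<ge> 2" "- (1 / real q) < x" "x < y" "y < 1 / real q"
  shows "bump' q y < bump' q x"
  unfolding bump'_def
proof (rule mult_strict_left_mono[OF dirichlet_logderiv_strict_antimono])
  show "- (pi / real q) < pi * x" using mult_strict_left_mono[OF assms(2), of pi] by simp
  show "pi * y < pi / real q" using mult_strict_left_mono[OF assms(4), of pi] by simp
qed (use assms in auto)

lemma bump'_antimono:
  assumes "q \<ge> 2" "- (1 / real q) < x" "x \<le> y" "y < 1 / real q"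
  shows "bump' q y \<le> bump' q x"
  using bump'_strict_antimono[of q x y] assms by (cases "x = y") auto

lemma bump_le:
  assumes "q \<ge> 2" "\<bar>y\<bar> < 1 / real q"
  shows "bump q y \<le> ln (real q)"
  unfolding bump_def using dirichlet_pos[OF assms(1) abs_pi_mult_less[OF assms(2)]] dirichlet_le[of q "pi * y"] assms
  by (subst ln_le_cancel_iff) auto

lemma bump'_neg_eq:
  assumes "q \<ge> 2" "- (1 / real q) < y" "y < 0"
  shows "bump' q y = pi * (cot (pi * - y) - real q * cot (real q * (pi * - y)))"
proof -
  have "pi * - y < pi / real q" using mult_strict_left_mono[OF assms(2), of pi] by simp
  then have "dirichlet_logderiv q (pi * - y) = real q * cot (real q * (pi * - y)) - cot (pi * - y)"
    using assms by (intro dirichlet_logderiv_eq) (auto simp: mult_pos_neg)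
  then show ?thesis using dirichlet_logderiv_minus[of q "pi * - y"] by (simp add: bump'_def)
qed

lemma bump_diff_ge:
  assumes q: "q \<ge> 2" and "- (1 / real q) < x" "x \<le> y" "y \<le> z" "z < 1 / real q"
  shows "bump' q z * (y - x) \<le> bump q y - bump q x"
proof (cases "x = y")
  case False
  then have xy: "x < y" using assms by simp
  have "\<exists>u. x < u \<and> u < y \<and> bump q y - bump q x = (y - x) * bump' q u"
    by (rule MVT2[OF xy]) (use assms in \<open>auto intro!: DERIV_bump simp: abs_less_iff\<close>)
  then obtain u where u: "x < u" "u < y" "bump q y - bump q x = (y - x) * bump' q u" by blast
  have "bump' q z \<le> bump' q u" using u assms by (intro bump'_antimono) auto
  then have "(y - x) * bump' q z \<le> (y - x) * bump' q u" using xy by (intro mult_left_mono) auto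
  then show ?thesis using u(3) by (simp add: mult.commute)
qed simp

lemma bump_diff_less:
  assumes q: "q \<ge> 2" and "- (1 / real q) < x" "x < y" "y < 1 / real q"
  shows "bump q y - bump q x < bump' q x * (y - x)"
proof -
  have "\<exists>u. x < u \<and> u < y \<and> bump q y - bump q x = (y - x) * bump' q u"
    by (rule MVT2) (use assms in \<open>auto intro!: DERIV_bump simp: abs_less_iff\<close>)
  then obtain u where u: "x < u" "u < y" "bump q y - bump q x = (y - x) * bump' q u" by blast
  have "bump' q u < bump' q x" using u assms by (intro bump'_strict_antimono) auto
  then have "(y - x) * bump' q u < (y - x) * bump' q x" using assms by (intro mult_strict_left_mono) auto
  then show ?thesis using u(3) by (simp add: mult.commute)
qed

section \<open>Values of f on the whole circle\<close>

lemma fc_shift_1: "fc q 0 (y + 1) = fc q 0 y"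
proof -
  have "pi * real q * (y + 1) = pi * real q * y + real q * pi" by (simp add: algebra_simps)
  then have 1: "sin (pi * real q * (y + 1)) = (- 1) ^ q * sin (pi * real q * y)"
    by (simp add: sin_add)
  have 2: "sin (pi * (y + 1)) = - sin (pi * y)" by (simp add: distrib_left)
  show ?thesis by (simp add: fc_def 1 2 abs_mult power_abs)
qed

lemma sin_bump_nonzero:
  assumes "q \<ge> 2" "\<bar>y\<bar> < 1 / real q" "y \<noteq> 0"
  shows "sin (pi * y) \<noteq> 0" "sin (pi * real q * y) \<noteq> 0"
proof -
  note s = sin_nz_small[OF assms(1), of "pi * \<bar>y\<bar>"]
  have "pi * \<bar>y\<bar> < pi / real q" using abs_pi_mult_less[OF assms(2)] by (simp add: abs_mult)
  then have "sin (pi * \<bar>y\<bar>) > 0" "sin (real q * (pi * \<bar>y\<bar>)) > 0" using s assms by auto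
  then show "sin (pi * y) \<noteq> 0" "sin (pi * real q * y) \<noteq> 0"
    by (cases "y > 0"; auto simp: mult_ac)+
qed

lemma abs_ratio_eq_exp_bump:
  assumes "q \<ge> 2" "\<bar>y\<bar> < 1 / real q" "y \<noteq> 0"
  shows "ln \<bar>sin (pi * real q * y) / sin (pi * y)\<bar> = bump q y"
proof -
  have "sin (pi * real q * y) / sin (pi * y) = dirichlet q (pi * y)"
    using sin_mult_dirichlet[of "pi * y" q] sin_bump_nonzero[OF assms] by (simp add: field_simps)
  then show ?thesis using dirichlet_pos[OF assms(1) abs_pi_mult_less[OF assms(2)]] by (simp add: bump_def)
qed

lemma fc_bump:
  assumes "q \<ge> 2" "\<bar>y\<bar> < 1 / real q"
  shows "fc q 0 y = ereal (bump q y)"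
proof (cases "y = 0")
  case True then show ?thesis by (simp add: fc_def bump_def)
next
  case False
  then show ?thesis using sin_bump_nonzero[OF assms False] abs_ratio_eq_exp_bump[OF assms False]
    by (simp add: fc_def)
qed

text \<open>A translation by j/q changes the numerator sin(pi q y) by a sign only, so the values at
  w and z differ by the logarithm of the quotient of the denominators.\<close>

lemma fc_far:
  assumes "q \<ge> 2" "\<bar>w\<bar> < 1 / real q" "w \<noteq> 0" "z = w + real j / real q" "sin (pi * z) \<noteq> 0"
  shows "fc q 0 z = ereal (bump q w + ln \<bar>sin (pi * w) / sin (pi * z)\<bar>)"
proof -
  note s = sin_bump_nonzero[OF assms(1-3)]
  have "pi * real q * z = pi * real q * w + real j * pi" using assms by (simp add: distrib_left)
  then have 1: "sin (pi * real q * z) = (- 1) ^ j * sin (pi * real q * w)"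
    by (simp add: sin_add)
  have "\<bar>sin (pi * real q * z) / sin (pi * z)\<bar> = \<bar>sin (pi * real q * w) / sin (pi * w)\<bar> * \<bar>sin (pi * w) / sin (pi * z)\<bar>"
    using s by (simp add: 1 abs_mult power_abs abs_divide)
  then have "ln \<bar>sin (pi * real q * z) / sin (pi * z)\<bar> = bump q w + ln \<bar>sin (pi * w) / sin (pi * z)\<bar>"
    using s assms(5) abs_ratio_eq_exp_bump[OF assms(1-3)] by (simp only:) (subst ln_mult, auto)
  then show ?thesis using assms(5) s 1 by (simp add: fc_def)
qed

text \<open>In the coordinate \<open>y = x + c\<close>, \<open>a\<close> is the left endpoint of the arc, \<open>h\<close> the sub-action and
  \<open>k\<close> its composition with \<open>T\<close>. The axioms are invariant under \<open>y \<mapsto> - y\<close>, which exchanges the two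
  endpoints of the arc; every estimate to the left of the arc is obtained this way.\<close>
locale calibrated =
  fixes q :: nat and a :: real and h k :: "real \<Rightarrow> real" and \<beta> :: real
  assumes q2: "q \<ge> 2" and a: "- (1 / real q) < a" "a < 0"
    and h_per: "\<And>y. h (y + 1) = h y"
    and k_per: "\<And>y. k (y + 1 / real q) = k y"
    and cohom: "\<And>y. a \<le> y \<Longrightarrow> y \<le> a + 1 / real q \<Longrightarrow> k y = bump q y + h y - \<beta>"
    and out_le: "\<And>u v. a + 1 / real q \<le> u \<Longrightarrow> u \<le> v \<Longrightarrow> v \<le> a + 1 \<Longrightarrow>
      h v - h u \<le> bump q (a + (v - u) / (real q - 1)) - bump q a"
    and out_ge: "\<And>u v. a + 1 / real q \<le> u \<Longrightarrow> u \<le> v \<Longrightarrow> v \<le> a + 1 \<Longrightarrow>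
      bump q (a + 1 / real q) - bump q (a + 1 / real q - (v - u) / (real q - 1)) \<le> h v - h u"
    and lip_le: "\<And>u v. u \<le> v \<Longrightarrow> h v - h u \<le> bump' q a * (v - u) / (real q - 1)"
    and lip_ge: "\<And>u v. u \<le> v \<Longrightarrow> bump' q (a + 1 / real q) * (v - u) / (real q - 1) \<le> h v - h u"
begin

abbreviation (input) "b \<equiv> a + 1 / real q"

lemma k_shift: "k (y + real n / real q) = k y"
proof (induction n)
  case (Suc n)
  have "y + real (Suc n) / real q = (y + real n / real q) + 1 / real q" by (simp add: add_divide_distrib)
  then show ?case using k_per Suc by metis
qed simp

text \<open>Since k y = k w for w = y - 1/q in the arc, the claim is bump y + h y < bump w + h w.
  Subtracting the equality at b and a leaves increments over length d. The increment of h beyond b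
  is at most that of the bump over [a, a + l], a part of [a, w]. The rest of the right side, d - l
  of the bump and l of h, is at least \<open>bump' q b * d\<close>, and by strict concavity the bump
  beyond b gains less.\<close>

lemma near_right:
  assumes y: "b < y" "y < 1 / real q"
  shows "bump q y + h y - k y < \<beta>"
proof -
  define w where "w = y - 1 / real q"
  define d where "d = y - b"
  define l where "l = d / (real q - 1)"
  have d: "0 < d" "w = a + d" "y = b + d" "d < - a" using y by (auto simp: d_def w_def)
  have l: "0 \<le> l" "l \<le> d" using d q2 by (auto simp: l_def divide_le_eq)
  have "k (w + 1 / real q) = k w" by (rule k_per)
  then have ky: "k y = k w" by (simp add: w_def)
  have kw: "k w = bump q w + h w - \<beta>" using d a y by (intro cohom) (auto simp: w_def)
  \<comment> \<open>k agrees at a and b, which differ by 1/q, and both ends belong to the range of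
    \<open>cohom\<close>.\<close>
  have kab: "bump q b + h b = bump q a + h a" using k_per[of a] cohom[of a] cohom[of b] by simp
  have 1: "h y - h b \<le> bump q (a + l) - bump q a"
  proof -
    have "1 / real q \<le> 1 / 2" using q2 by (intro divide_left_mono) auto
    then have "y \<le> a + 1" using y a by linarith
    then show ?thesis using out_le[of b y] y by (simp add: l_def d_def)
  qed
  have 2: "bump' q b * l \<le> h w - h a" using lip_ge[of a w] d by (simp add: l_def)
  have 3: "bump q y - bump q b < bump' q b * d" using bump_diff_less[of q b y] q2 a y by (simp add: d_def)
  have 4: "bump' q b * (d - l) \<le> bump q w - bump q (a + l)"
    using bump_diff_ge[of q "a + l" w b] q2 a y l d by (simp add: w_def)
  have "bump' q b * l + bump' q b * (d - l) = bump' q b * d" by (simp add: algebra_simps)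
  then show ?thesis using 1 2 3 4 ky kw kab by linarith
qed

text \<open>Here k z = k y, so only ln(sin(pi y)/sin(pi z)) + h z < h y is left. From b to z the
  increment of h is bounded by \<open>out_le\<close> and the maximum ln q of the bump, from y to b
  by the extreme slope; the result is \<open>far_branch_ineq\<close> at x = -pi a.\<close>

lemma far_right:
  assumes y: "0 < y" "y \<le> b" and z: "z = y + real j / real q" "1 / real q < z" "z < 1 - 1 / real q"
  shows "bump q y + ln (sin (pi * y) / sin (pi * z)) + h z - k z < \<beta>"
proof -
  have q3: "q \<ge> 3"
  proof (rule ccontr)
    \<comment> \<open>For q = 2 the bump covers the circle up to one point, and the interval for z
      is empty.\<close>
    assume "\<not> q \<ge> 3"
    then have "q = 2" using q2 by simp
    then show False using z by simp
  qed
  have kz: "k z = bump q y + h y - \<beta>" using k_shift[of y j] cohom[of y] y a z by simp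
  have 1: "h z - h b \<le> ln (real q) - bump q a"
  proof -
    have zb: "b \<le> z" "z \<le> a + 1" using a z by linarith+
    define l where "l = (z - b) / (real q - 1)"
    have "z - b \<le> 1 - 1 / real q" using zb by simp
    also have "\<dots> = (real q - 1) / real q" using q2 by (simp add: field_simps)
    finally have l: "0 \<le> l" "l \<le> 1 / real q" using zb q2 by (auto simp: l_def field_simps)
    have "bump q (a + l) \<le> ln (real q)" using a l q2 by (intro bump_le) (auto simp: abs_less_iff)
    then show ?thesis using out_le[of b z] zb by (simp add: l_def)
  qed
  have 2: "h b - h y \<le> bump' q a * (b - y) / (real q - 1)" using lip_le y by simp
  define x where "x = pi * - a"
  have x: "0 < x" "x < pi / real q" using mult_strict_left_mono[OF a(1), of pi] a(2)
    by (auto simp: x_def mult_pos_neg)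
  have xb: "pi * b = pi / real q - x" by (simp add: x_def algebra_simps)
  have 3: "ln (sin (pi * y) / sin (pi * z)) + ln (real q) - ln (dirichlet q x)
     + (cot x - real q * cot (real q * x)) * (pi / real q - x - pi * y) / (real q - 1) < 0"
  proof (rule far_branch_ineq[OF q3 x])
    show "0 < pi * y" using y by simp
    have "pi * y \<le> pi * b" using y by (intro mult_left_mono) auto
    then show "pi * y \<le> pi / real q - x" using xb by simp
    show "sin (pi / real q) < sin (pi * z)"
    proof (cases "z \<le> 1 / 2")
      case True
      have "pi / real q < pi * z" using mult_strict_left_mono[OF z(2), of pi] by simp
      moreover have "pi * z \<le> pi / 2" using mult_left_mono[OF True, of pi] by simp
      moreover have "0 \<le> pi / real q" by simp
      ultimately show ?thesis by (subst sin_mono_less_eq) (use pi_gt_zero in linarith)+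
    next
      case False
      have "pi / real q < pi * (1 - z)" using mult_strict_left_mono[of "1 / real q" "1 - z" pi] z by simp
      moreover have "pi * (1 - z) \<le> pi / 2" using mult_left_mono[of "1 - z" "1 / 2" pi] False by simp
      moreover have "0 \<le> pi / real q" by simp
      ultimately have "sin (pi / real q) < sin (pi * (1 - z))" by (subst sin_mono_less_eq) (use pi_gt_zero in linarith)+
      also have "sin (pi * (1 - z)) = sin (pi * z)" by (simp add: right_diff_distrib)
      finally show ?thesis .
    qed
  qed
  have "bump q a = ln (dirichlet q x)" by (simp add: bump_def x_def)
  moreover have e: "bump' q a * (b - y) = (cot x - real q * cot (real q * x)) * (pi / real q - x - pi * y)"
    unfolding bump'_neg_eq[OF q2 a] x_def by (simp add: algebra_simps)
  moreover note 2[unfolded e]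
  ultimately show ?thesis using 1 3 kz by linarith
qed

lemma reflect: "calibrated q (- b) (\<lambda>y. h (- y)) (\<lambda>y. k (- y)) \<beta>"
proof (unfold_locales, goal_cases)
  case 1 show ?case by (rule q2)
next
  case 2 show ?case using a by simp
next
  case 3 show ?case using a by simp
next
  case (4 y) show ?case using h_per[of "- y - 1"] by simp
next
  case (5 y) show ?case using k_per[of "- y - 1 / real q"] by simp
next
  case (6 y) show ?case using cohom[of "- y"] 6 by simp
next
  case (7 u v)
  \<comment> \<open>The points -u and -v lie on the other side of the arc; adding 1 brings them into
    [b, a + 1], in reversed order, so upper and lower bounds change roles.\<close>
  have "h (- u) = h (1 - u)" "h (- v) = h (1 - v)" using h_per[of "- u"] h_per[of "- v"] by (simp_all add: add.commute)
  moreover have "bump q b - bump q (b - (v - u) / (real q - 1)) \<le> h (1 - u) - h (1 - v)"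
    using out_ge[of "1 - v" "1 - u"] 7 by simp
  moreover have "bump q (- b + (v - u) / (real q - 1)) = bump q (b - (v - u) / (real q - 1))"
  proof -
    have "- b + (v - u) / (real q - 1) = - (b - (v - u) / (real q - 1))" by simp
    then show ?thesis by (simp only: bump_minus)
  qed
  moreover have "bump q (- b) = bump q b" by (rule bump_minus)
  ultimately show ?case by linarith
next
  case (8 u v)
  have "h (- u) = h (1 - u)" "h (- v) = h (1 - v)" using h_per[of "- u"] h_per[of "- v"] by (simp_all add: add.commute)
  moreover have "h (1 - u) - h (1 - v) \<le> bump q (a + (v - u) / (real q - 1)) - bump q a"
    using out_le[of "1 - v" "1 - u"] 8 by simp
  moreover have "bump q (- b + 1 / real q - (v - u) / (real q - 1)) = bump q (a + (v - u) / (real q - 1))"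
  proof -
    have "- b + 1 / real q - (v - u) / (real q - 1) = - (a + (v - u) / (real q - 1))" by simp
    then show ?thesis by (simp only: bump_minus)
  qed
  moreover have "bump q (- b + 1 / real q) = bump q a" by simp
  ultimately show ?case by linarith
next
  case (9 u v)
  have "bump' q b * (v - u) / (real q - 1) \<le> h (- u) - h (- v)" using lip_ge[of "- v" "- u"] 9 by simp
  then show ?case unfolding bump'_minus by (simp add: minus_mult_left[symmetric] del: minus_add_distrib)
next
  case (10 u v)
  have "h (- u) - h (- v) \<le> bump' q a * (v - u) / (real q - 1)" using lip_le[of "- v" "- u"] 10 by simp
  then show ?case by simp
qed

lemma near_left:
  assumes y: "- (1 / real q) < y" "y < a"
  shows "bump q y + h y - k y < \<beta>"
  using calibrated.near_right[OF reflect, of "- y"] y by simp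

lemma far_left:
  assumes y: "a \<le> y" "y < 0" and z: "z = y - real j / real q" "- (1 - 1 / real q) < z" "z < - (1 / real q)"
  shows "bump q y + ln (sin (pi * y) / sin (pi * z)) + h z - k z < \<beta>"
proof -
  have "sin (pi * - y) / sin (pi * - z) = sin (pi * y) / sin (pi * z)" by simp
  moreover have "bump q (- y) + ln (sin (pi * - y) / sin (pi * - z)) + h (- (- z)) - k (- (- z)) < \<beta>"
    by (rule calibrated.far_right[OF reflect, where j = j]) (use y z in simp_all)
  ultimately show ?thesis by simp
qed

lemma h_shift_int: "h (y + of_int n) = h y"
  by (rule periodic_add_of_int) (rule h_per)

lemma k_shift_int: "k (y + of_int n) = k y"
  by (rule periodic_add_of_int) (use k_shift[of _ q] q2 in simp)

lemma fc_on_arc: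
  assumes "frac (y - a) \<le> 1 / real q"
  shows "fc q 0 y = ereal (\<beta> + k y - h y)"
proof -
  define w where "w = a + frac (y - a)"
  have y: "y = w + of_int \<lfloor>y - a\<rfloor>" by (simp add: w_def frac_def)
  have w: "a \<le> w" "w \<le> b" using assms by (auto simp: w_def)
  have "fc q 0 w = ereal (bump q w)" using w a q2 by (intro fc_bump) (auto simp: abs_less_iff)
  moreover have "k w = bump q w + h w - \<beta>" using cohom w by simp
  ultimately have "fc q 0 w = ereal (\<beta> + k w - h w)" by simp
  then show ?thesis using y periodic_add_of_int[of "fc q 0", OF fc_shift_1] h_shift_int k_shift_int by metis
qed

text \<open>A representative z in (b, a + 1) is a zero of the numerator, or lies on the bump around
  0 beyond the arc, or on the bump around 1 before its copy of the arc, or between the bumps. The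
  ends 1/q and 1 - 1/q of the bumps are among the zeros, so strict inequalities separate the
  cases.\<close>

lemma fc_off_arc:
  assumes "\<not> frac (y - a) \<le> 1 / real q"
  shows "fc q 0 y < ereal (\<beta> + k y - h y)"
proof -
  define z where "z = a + frac (y - a)"
  have y: "y = z + of_int \<lfloor>y - a\<rfloor>" by (simp add: z_def frac_def)
  have z: "b < z" "z < a + 1" using assms by (auto simp: z_def frac_lt_1)
  have z_shift: "fc q 0 z = fc q 0 (z - 1)" "h z = h (z - 1)" "k z = k (z - 1)"
    using fc_shift_1[of q "z - 1"] h_shift_int[of "z - 1" 1] k_shift_int[of "z - 1" 1] by simp_all
  have z0: "0 < z" "z < 1" using z a by auto
  then have sz: "sin (pi * z) > 0" by (intro sin_gt_zero) auto
  have qh: "1 / real q \<le> 1 / 2" using q2 by (intro divide_left_mono) auto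
  have "fc q 0 z < ereal (\<beta> + k z - h z)"
  proof (cases "sin (pi * real q * z) = 0")
    case True
    then have "fc q 0 z = - \<infinity>" using sz by (simp add: fc_def)
    then show ?thesis by simp
  next
    case nz: False
    have ne: "z \<noteq> real i / real q" for i
    proof
      assume "z = real i / real q"
      then have "pi * real q * z = real i * pi" using q2 by simp
      then have "sin (pi * real q * z) = 0" by (simp only: sin_npi)
      then show False using nz by simp
    qed
    consider "z < 1 / real q" | "1 / real q < z" "z < 1 - 1 / real q" | "1 - 1 / real q < z"
      using ne[of 1] ne[of "q - 1"] q2 by (force simp: of_nat_diff field_simps)
    then show ?thesis
    proof cases
      case 1
      then have "fc q 0 z = ereal (bump q z)" using z0 q2 by (intro fc_bump) auto
      then show ?thesis using near_right[OF z(1) 1] by simp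
    next
      case 3
      then have m: "- (1 / real q) < z - 1" "z - 1 < a" using z by auto
      then have "fc q 0 (z - 1) = ereal (bump q (z - 1))" using z0 q2 by (intro fc_bump) auto
      then show ?thesis using near_left[OF m] z_shift by simp
    next
      case 2
      \<comment> \<open>The number of steps 1/q that bring z back into the arc. The sign of the
        resulting w decides from which side z is estimated.\<close>
      define j where "j = nat \<lfloor>real q * (z - a)\<rfloor>"
      define w where "w = z - real j / real q"
      have "0 \<le> real q * (z - a)" using z a by (intro mult_nonneg_nonneg) (auto intro: less_imp_le less_trans)
      then have j: "real j \<le> real q * (z - a)" "real q * (z - a) < real j + 1" by (auto simp: j_def)
      then have "real j / real q \<le> z - a" "z - a < real j / real q + 1 / real q"
        using q2 by (simp_all add: field_simps)
      then have w: "a \<le> w" "w \<le> b" by (auto simp: w_def)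
      have w0: "w \<noteq> 0" using ne[of j] by (simp add: w_def)
      have zw: "z = w + real j / real q" by (simp add: w_def)
      have wb: "\<bar>w\<bar> < 1 / real q" using w a by auto
      have F: "fc q 0 z = ereal (bump q w + ln \<bar>sin (pi * w) / sin (pi * z)\<bar>)"
        using fc_far[OF q2 wb w0 zw] sz by simp
      show ?thesis
      proof (cases "w > 0")
        case True
        have "w < 1" using wb qh by auto
        then have "sin (pi * w) > 0" using True by (intro sin_gt_zero) auto
        then have "fc q 0 z = ereal (bump q w + ln (sin (pi * w) / sin (pi * z)))" using F sz by simp
        then show ?thesis using far_right[OF True w(2) zw 2] by simp
      next
        case False
        then have wn: "w < 0" using w0 by simp
        have "- w < 1" using wb qh by auto
        then have "pi * - w < pi" using mult_strict_left_mono[of "- w" 1 pi] by simp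
        moreover have "0 < pi * - w" using wn by (intro mult_pos_pos) auto
        ultimately have "sin (pi * - w) > 0" by (intro sin_gt_zero)
        then have sw: "sin (pi * w) < 0" by simp
        have sz1: "sin (pi * (z - 1)) = - sin (pi * z)" by (simp add: right_diff_distrib)
        \<comment> \<open>For w < 0 the point z is viewed from the left: z - 1 is w moved down by q
          - j steps, and the sign change of sin(pi (z - 1)) makes the quotient of sines
          positive.\<close>
        have "real j < real q"
        proof -
          have "real j / real q < 1" using zw wn z0 j w z by (simp add: field_simps) 
          then show ?thesis using q2 by simp
        qed
        then have "z - 1 = w - real (q - j) / real q" using q2 by (simp add: zw of_nat_diff diff_divide_distrib)
        then have "bump q w + ln (sin (pi * w) / sin (pi * (z - 1))) + h (z - 1) - k (z - 1) < \<beta>"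
          by (rule far_left[OF w(1) wn]) (use 2 in auto)
        moreover have "sin (pi * w) / sin (pi * (z - 1)) = \<bar>sin (pi * w) / sin (pi * z)\<bar>"
          using sw sz sz1 by (simp add: abs_divide)
        ultimately show ?thesis using F z_shift by simp
      qed
    qed
  qed
  then show ?thesis using y periodic_add_of_int[of "fc q 0", OF fc_shift_1] h_shift_int k_shift_int by metis
qed

end

section \<open>Choice of the arc\<close>

lemma tau_tendsto:
  assumes "X \<longlonglongrightarrow> \<gamma>" "Y \<longlonglongrightarrow> y" "y - real q * \<gamma> \<notin> \<int>"
  shows "(\<lambda>n. tau q (X n) (Y n)) \<longlonglongrightarrow> tau q \<gamma> y"
proof -
  have "(\<lambda>n. Y n - real q * X n) \<longlonglongrightarrow> y - real q * \<gamma>"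
    by (intro tendsto_intros assms)
  then have "(\<lambda>n. frac (Y n - real q * X n)) \<longlonglongrightarrow> frac (y - real q * \<gamma>)"
    using continuous_frac[OF assms(3)] isCont_tendsto_compose by blast
  then show ?thesis unfolding tau_def divide_inverse by (intro tendsto_intros assms)
qed

lemma tau_funpow_tendsto:
  assumes "X \<longlonglongrightarrow> \<gamma>" "\<And>k. (tau q \<gamma> ^^ k) x - real q * \<gamma> \<notin> \<int>"
  shows "(\<lambda>n. (tau q (X n) ^^ k) x) \<longlonglongrightarrow> (tau q \<gamma> ^^ k) x"
proof (induction k)
  case (Suc k)
  then show ?case using tau_tendsto[OF assms(1) Suc assms(2)] by simp
qed simp

lemma mult_tau_funpow:
  assumes "q > 0"
  shows "\<exists>m::int. real q ^ k * (tau q \<gamma> ^^ k) x = x + of_int m"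
proof (induction k)
  case 0 show ?case by (intro exI[of _ 0]) simp
next
  case (Suc k)
  then obtain m where m: "real q ^ k * (tau q \<gamma> ^^ k) x = x + of_int m" by blast
  define y where "y = (tau q \<gamma> ^^ k) x"
  have "real q * tau q \<gamma> y = y - of_int \<lfloor>y - real q * \<gamma>\<rfloor>"
    using assms by (simp add: tau_def frac_def field_simps)
  then have "real q ^ k * (real q * tau q \<gamma> y) = x + of_int m - real q ^ k * of_int \<lfloor>y - real q * \<gamma>\<rfloor>"
    using m by (simp add: y_def right_diff_distrib)
  then have "real q ^ Suc k * (tau q \<gamma> ^^ Suc k) x = x + of_int (m - int q ^ k * \<lfloor>y - real q * \<gamma>\<rfloor>)"
    by (simp add: y_def mult_ac)
  then show ?case by blast
qed

text \<open>An orbit meets the jump of \<open>tau\<close> only for countably many x, because q^k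
  times the k-th iterate equals x up to an integer.\<close>

lemma AE_tau_orbit_regular:
  assumes "q > 0"
  shows "AE x in lborel. \<forall>k. (tau q \<gamma> ^^ k) x - real q * \<gamma> \<notin> \<int>"
proof -
  define N where "N = (\<Union>k. range (\<lambda>m::int. real q ^ k * real q * \<gamma> + of_int m))"
  have "countable N" unfolding N_def by auto
  then have "N \<in> null_sets lborel" by (simp add: countable_imp_null_set_lborel)
  then show ?thesis
  proof (rule AE_I')
    show "{x \<in> space lborel. \<not> (\<forall>k. (tau q \<gamma> ^^ k) x - real q * \<gamma> \<notin> \<int>)} \<subseteq> N"
    proof
      fix x assume "x \<in> {x \<in> space lborel. \<not> (\<forall>k. (tau q \<gamma> ^^ k) x - real q * \<gamma> \<notin> \<int>)}"
      then obtain k j where k: "(tau q \<gamma> ^^ k) x = real q * \<gamma> + of_int j"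
        by (auto elim!: Ints_cases simp: algebra_simps)
      obtain m where "real q ^ k * (tau q \<gamma> ^^ k) x = x + of_int m"
        using mult_tau_funpow[OF assms] by blast
      then have "x = real q ^ k * real q * \<gamma> + of_int (int q ^ k * j - m)"
        by (simp add: k algebra_simps)
      then show "x \<in> N" unfolding N_def by blast
    qed
  qed
qed

section \<open>The mean of g' as a function of the arc\<close>

lemma bump'_measurable: "bump' q \<in> borel_measurable borel"
proof -
  have "continuous_on UNIV (dirichlet q)"
    using DERIV_dirichlet DERIV_isCont by (meson continuous_at_imp_continuous_on)
  then have 1: "dirichlet q \<in> borel_measurable borel" by (rule borel_measurable_continuous_onI)
  have "continuous_on UNIV (dirichlet' q)"
    unfolding dirichlet'_def[abs_def] by (intro continuous_intros)
  then have 2: "dirichlet' q \<in> borel_measurable borel" by (rule borel_measurable_continuous_onI)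
  show ?thesis unfolding bump'_def[abs_def] dirichlet_logderiv_def[abs_def]
    using 1 2 by measurable
qed

lemma isCont_bump':
  assumes "q \<ge> 2" "\<bar>y\<bar> < 1 / real q"
  shows "isCont (bump' q) y"
proof -
  have "isCont (dirichlet_logderiv q) (pi * y)"
    using continuous_on_interior[OF continuous_dirichlet_logderiv[OF assms(1)], of "pi * y"] abs_pi_mult_less[OF assms(2)]
    by (simp add: interior_open abs_less_iff)
  then have "isCont (\<lambda>y. dirichlet_logderiv q (pi * y)) y"
    by (intro continuous_at_compose[unfolded o_def, of y "\<lambda>y. pi * y" "dirichlet_logderiv q"] continuous_intros) 
  then show ?thesis unfolding bump'_def[abs_def] by (intro continuous_intros)
qed

lemma bump_branch:
  assumes "q \<ge> 2" "- (1 / real q) < \<gamma> + c" "\<gamma> + c < 0"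
  shows "decreasing_branch q \<gamma> (\<lambda>x. bump' q (x + c))"
proof (unfold_locales, goal_cases)
  case 1 show ?case by (rule assms)
next
  case 2 show ?case using bump'_measurable by measurable
next
  case (3 u v) then show ?case using assms by (intro bump'_antimono) auto
qed

text \<open>The increment over one period of a primitive of the series; g is well defined on the
  circle when it vanishes.\<close>

definition drift :: "nat \<Rightarrow> real \<Rightarrow> real \<Rightarrow> real" where
  "drift q c \<gamma> = integral {0..1} (branch_series q \<gamma> (\<lambda>x. bump' q (x + c)))"

lemma abs_bump'_le:
  assumes "q \<ge> 2" "0 < \<eta>" "\<eta> - 1 / real q \<le> \<gamma> + c" "\<gamma> + c \<le> - \<eta>" "u \<in> {\<gamma>..\<gamma> + 1 / real q}"
  shows "\<bar>bump' q (u + c)\<bar> \<le> bump' q (\<eta> - 1 / real q)"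
proof -
  have "bump' q (u + c) \<le> bump' q (\<eta> - 1 / real q)" using assms by (intro bump'_antimono) auto
  moreover have "bump' q (1 / real q - \<eta>) \<le> bump' q (u + c)" using assms by (intro bump'_antimono) auto
  moreover have "bump' q (1 / real q - \<eta>) = - bump' q (\<eta> - 1 / real q)"
    using bump'_minus[of q "\<eta> - 1 / real q"] by simp
  ultimately show ?thesis by auto
qed

lemma drift_eq_Lebesgue:
  assumes "q \<ge> 2" "- (1 / real q) < \<gamma> + c" "\<gamma> + c < 0"
  shows "drift q c \<gamma> = (LINT x|lborel. indicator {0..1} x * branch_series q \<gamma> (\<lambda>x. bump' q (x + c)) x)"
proof -
  interpret decreasing_branch q \<gamma> "\<lambda>x. bump' q (x + c)" by (rule bump_branch[OF assms])
  have "set_integrable lborel {0..1} (branch_series q \<gamma> (\<lambda>x. bump' q (x + c)))" unfolding set_integrable_def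
    by (rule integrableI_bounded_set_indicator[where B = "pB / (real q - 1)"])
       (use branch_series_measurable[OF p_bound p_meas] branch_series_bound[OF p_bound] in auto)
  from set_borel_integral_eq_integral(2)[OF this] show ?thesis
    by (simp add: drift_def set_lebesgue_integral_def)
qed

text \<open>Terms converge off the countable set of irregular x; Tannery's theorem passes to the
  series and dominated convergence to the integral. One bound serves both, as all arcs stay \<eta>
  away from the ends of the bump.\<close>

lemma continuous_drift:
  assumes q: "q \<ge> 2" and \<eta>: "0 < \<eta>"
  shows "continuous_on {\<eta> - 1 / real q - c..- \<eta> - c} (drift q c)"
  unfolding continuous_on_sequentially
proof (intro allI ballI impI, elim conjE)
  define p where "p = (\<lambda>x. bump' q (x + c))"
  define B where "B = bump' q (\<eta> - 1 / real q)"
  fix X \<gamma> assume \<gamma>: "\<gamma> \<in> {\<eta> - 1 / real q - c..- \<eta> - c}"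
    and X: "\<forall>n::nat. X n \<in> {\<eta> - 1 / real q - c..- \<eta> - c}" "X \<longlonglongrightarrow> \<gamma>"
  have bnd: "\<bar>p u\<bar> \<le> B" if "\<gamma>' \<in> {\<eta> - 1 / real q - c..- \<eta> - c}" "u \<in> {\<gamma>'..\<gamma>' + 1 / real q}" for \<gamma>' u
    unfolding p_def B_def using that by (intro abs_bump'_le[OF q \<eta>, of \<gamma>']) auto
  interpret inverse_branch q \<gamma>' for \<gamma>' by unfold_locales (rule q)
  have q0: "q > 0" using q by simp
  have pm: "p \<in> borel_measurable borel" unfolding p_def using bump'_measurable by measurable
  have "(\<lambda>n. LINT x|lborel. indicator {0..1} x * branch_series q (X n) p x) \<longlonglongrightarrow>
      (LINT x|lborel. indicator {0..1} x * branch_series q \<gamma> p x)"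
  proof (rule integral_dominated_convergence[where w = "\<lambda>x. indicator {0..1} x * (B / (real q - 1))"])
    show "(\<lambda>x. indicator {0..1} x * branch_series q \<gamma> p x) \<in> borel_measurable lborel"
    proof -
      have "branch_series q \<gamma> p \<in> borel_measurable borel"
        by (rule branch_series_measurable[OF bnd[OF \<gamma>] pm])
      then show ?thesis by measurable
    qed
    show "(\<lambda>x. indicator {0..1} x * branch_series q (X n) p x) \<in> borel_measurable lborel" for n
    proof -
      have "branch_series q (X n) p \<in> borel_measurable borel"
        by (rule branch_series_measurable[OF bnd[OF X(1)[rule_format]] pm])
      then show ?thesis by measurable
    qed
    show "integrable lborel (\<lambda>x::real. indicator {0..1} x * (B / (real q - 1)))"
      by (intro integrable_mult_left integrable_real_indicator) auto
    show "AE x in lborel. norm (indicator {0..1} x * branch_series q (X n) p x) \<le> indicator {0..1} x * (B / (real q - 1))" for n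
      using branch_series_bound[of "X n" p B, OF bnd[OF X(1)[rule_format]]] by (auto simp: indicator_def)
    show "AE x in lborel. (\<lambda>n. indicator {0..1} x * branch_series q (X n) p x) \<longlonglongrightarrow> indicator {0..1} x * branch_series q \<gamma> p x"
      using AE_tau_orbit_regular[OF q0, of \<gamma>]
    proof eventually_elim
      case (elim x)
      have "(\<lambda>n. branch_series q (X n) p x) \<longlonglongrightarrow> branch_series q \<gamma> p x"
        unfolding branch_series_def
      proof (rule tannerys_theorem[THEN conjunct2, THEN conjunct2])
        fix k
        have "(\<lambda>n. (tau q (X n) ^^ Suc k) x) \<longlonglongrightarrow> (tau q \<gamma> ^^ Suc k) x"
          by (rule tau_funpow_tendsto[OF X(2) elim[rule_format]])
        moreover have "isCont p ((tau q \<gamma> ^^ Suc k) x)"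
        proof -
          have "\<bar>(tau q \<gamma> ^^ Suc k) x + c\<bar> < 1 / real q"
            using tau_funpow_in[where n = k and x = x and \<gamma>' = \<gamma>] \<gamma> \<eta> by (auto simp: abs_less_iff simp del: funpow.simps)
          then have "isCont (bump' q) ((tau q \<gamma> ^^ Suc k) x + c)" by (rule isCont_bump'[OF q])
          then show ?thesis unfolding p_def
            by (intro continuous_at_compose[unfolded o_def, of _ "\<lambda>x. x + c" "bump' q"] continuous_intros)
        qed
        ultimately have "(\<lambda>n. p ((tau q (X n) ^^ Suc k) x)) \<longlonglongrightarrow> p ((tau q \<gamma> ^^ Suc k) x)"
          by (rule isCont_tendsto_compose[rotated])
        then show "(\<lambda>n. p ((tau q (X n) ^^ Suc k) x) / real q ^ Suc k) \<longlonglongrightarrow> p ((tau q \<gamma> ^^ Suc k) x) / real q ^ Suc k"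
          using q by (intro tendsto_intros) auto
      next
        show "summable (\<lambda>k. B / real q ^ Suc k)" using geometric sums_summable by blast
        have "norm (p ((tau q (X n) ^^ Suc k) x) / real q ^ Suc k) \<le> B / real q ^ Suc k" for n k
          using bnd[OF X(1)[rule_format] tau_funpow_mem] by (simp add: abs_divide divide_right_mono del: funpow.simps)
        then show "\<forall>\<^sub>F (k, n) in sequentially \<times>\<^sub>F sequentially.
          norm (p ((tau q (X n) ^^ Suc k) x) / real q ^ Suc k) \<le> B / real q ^ Suc k"
          by (intro always_eventually) auto
      qed simp
      then show ?case by (intro tendsto_intros)
    qed
  qed
  moreover have "drift q c \<gamma>' = (LINT x|lborel. indicator {0..1} x * branch_series q \<gamma>' p x)"
    if "\<gamma>' \<in> {\<eta> - 1 / real q - c..- \<eta> - c}" for \<gamma>'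
    unfolding p_def using that \<eta> by (intro drift_eq_Lebesgue[OF q]) auto
  ultimately show "(drift q c \<circ> X) \<longlonglongrightarrow> drift q c \<gamma>" using X(1) \<gamma> by (simp add: o_def)
qed

lemma integral_bump':
  assumes "q \<ge> 2" "- (1 / real q) < u + c" "u \<le> v" "v + c < 1 / real q"
  shows "integral {u..v} (\<lambda>x. bump' q (x + c)) = bump q (v + c) - bump q (u + c)"
proof (rule integral_unique, rule fundamental_theorem_of_calculus)
  fix x assume "x \<in> {u..v}"
  then have "\<bar>x + c\<bar> < 1 / real q" using assms by auto
  then have "((\<lambda>x. bump q (x + c)) has_real_derivative bump' q (x + c) * 1) (at x)"
    by (intro DERIV_chain2[OF DERIV_bump[OF assms(1)]]) (auto intro!: derivative_eq_intros)
  then show "((\<lambda>x. bump q (x + c)) has_vector_derivative bump' q (x + c)) (at x within {u..v})"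
    by (simp add: has_real_derivative_iff_has_vector_derivative has_vector_derivative_at_within)
qed (use assms in auto)

text \<open>A period is the image of the arc, so the drift is the exact increment of the bump over
  the arc plus the integral of the series over it; the latter lies between the extreme slopes times
  1/(q (q - 1)).\<close>

lemma drift_bounds:
  assumes "q \<ge> 2" "- (1 / real q) < \<gamma> + c" "\<gamma> + c < 0"
  shows "bump q (\<gamma> + c + 1 / real q) - bump q (\<gamma> + c) + bump' q (\<gamma> + c + 1 / real q) / (real q * (real q - 1)) \<le> drift q c \<gamma>"
    "drift q c \<gamma> \<le> bump q (\<gamma> + c + 1 / real q) - bump q (\<gamma> + c) + bump' q (\<gamma> + c) / (real q * (real q - 1))"
proof -
  interpret decreasing_branch q \<gamma> "\<lambda>x. bump' q (x + c)" by (rule bump_branch[OF assms])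
  let ?s = "branch_series q \<gamma> (\<lambda>x. bump' q (x + c))"
  have d: "real q * (\<gamma> + 1 / real q) = real q * \<gamma> + 1" using assms by (simp add: field_simps)
  have "drift q c \<gamma> = integral {real q * \<gamma>..real q * \<gamma> + 1} ?s"
    unfolding drift_def using integral_period[of ?s, OF branch_series_add_1[OF p_bound] int_branch_series] by simp
  also have "\<dots> = integral {\<gamma>..\<gamma> + 1 / real q} (\<lambda>x. bump' q (x + c)) + integral {\<gamma>..\<gamma> + 1 / real q} ?s"
    using integral_branch_series_image[OF p_bound p_meas, of "\<gamma> + 1 / real q"] d by simp
  also have "integral {\<gamma>..\<gamma> + 1 / real q} (\<lambda>x. bump' q (x + c)) = bump q (\<gamma> + c + 1 / real q) - bump q (\<gamma> + c)"
    using integral_bump'[of q \<gamma> c "\<gamma> + 1 / real q"] assms by (simp add: add_ac)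
  finally have e: "drift q c \<gamma> = bump q (\<gamma> + c + 1 / real q) - bump q (\<gamma> + c) + integral {\<gamma>..\<gamma> + 1 / real q} ?s" .
  have *: "\<gamma> + c + 1 / real q = \<gamma> + 1 / real q + c" by simp
  show "bump q (\<gamma> + c + 1 / real q) - bump q (\<gamma> + c) + bump' q (\<gamma> + c + 1 / real q) / (real q * (real q - 1)) \<le> drift q c \<gamma>"
    using integral_branch_series_lipschitz(2)[of \<gamma> "\<gamma> + 1 / real q"] unfolding e by (simp add: * mult.commute)
  show "drift q c \<gamma> \<le> bump q (\<gamma> + c + 1 / real q) - bump q (\<gamma> + c) + bump' q (\<gamma> + c) / (real q * (real q - 1))"
    using integral_branch_series_lipschitz(1)[of \<gamma> "\<gamma> + 1 / real q"] unfolding e by (simp add: mult.commute)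
qed

text \<open>The kernel vanishes at pi/q, so f is arbitrarily negative near the end of the bump,
  whereas it is nonnegative near the centre.\<close>

lemma exists_steep_margin:
  assumes q: "q \<ge> 2"
  shows "\<exists>\<eta>>0. \<eta> < 1 / (2 * real q) \<and> K \<le> bump q \<eta> - bump q (1 / real q - \<eta>)"
proof -
  have c: "isCont (dirichlet q) x" for x using DERIV_dirichlet DERIV_isCont by blast
  have d0: "dirichlet q (pi / real q) = 0"
  proof -
    have "sin (pi / real q) * dirichlet q (pi / real q) = 0" using sin_mult_dirichlet[of "pi / real q" q] q by simp
    moreover have "sin (pi / real q) > 0" using q by (intro sin_gt_zero) (auto simp: field_simps)
    ultimately show ?thesis by simp
  qed
  have "((\<lambda>\<eta>. dirichlet q (pi * \<eta>)) \<longlongrightarrow> dirichlet q (pi * 0)) (at_right 0)"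
    by (intro isCont_tendsto_compose[OF c] tendsto_intros)
  then have 1: "\<forall>\<^sub>F \<eta> in at_right 0. 1 < dirichlet q (pi * \<eta>)"
    by (rule order_tendstoD(1)) (use q in simp)
  have "((\<lambda>\<eta>. dirichlet q (pi * (1 / real q - \<eta>))) \<longlongrightarrow> dirichlet q (pi * (1 / real q - 0))) (at_right 0)"
    by (intro isCont_tendsto_compose[OF c] tendsto_intros)
  then have 2: "\<forall>\<^sub>F \<eta> in at_right 0. dirichlet q (pi * (1 / real q - \<eta>)) < exp (- K)"
    by (rule order_tendstoD(2)) (use d0 in simp)
  have 3: "\<forall>\<^sub>F \<eta> in at_right 0. \<eta> \<in> {0<..<1 / (2 * real q)}"
    using q by (intro eventually_at_right_real) simp
  have "\<forall>\<^sub>F \<eta>::real in at_right 0. \<eta> > 0 \<and> \<eta> < 1 / (2 * real q) \<and> K \<le> bump q \<eta> - bump q (1 / real q - \<eta>)"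
    using 1 2 3
  proof eventually_elim
    case (elim \<eta>)
    have "1 / (2 * real q) \<le> 1 / real q" using q by (simp add: field_simps)
    then have "\<bar>1 / real q - \<eta>\<bar> < 1 / real q" using elim(3) by (auto simp: abs_less_iff)
    then have "dirichlet q (pi * (1 / real q - \<eta>)) > 0" using dirichlet_pos[OF q abs_pi_mult_less] by blast
    then have "bump q (1 / real q - \<eta>) \<le> ln (exp (- K))" unfolding bump_def using elim(2) by (subst ln_le_cancel_iff) auto
    moreover have "0 \<le> bump q \<eta>" using elim(1) by (simp add: bump_def)
    ultimately show ?case using elim(3) by auto
  qed
  then show ?thesis by (rule eventually_happens'[rotated, THEN exE]) auto
qed

lemma exists_zero_drift:
  assumes q: "q \<ge> 2"
  shows "\<exists>\<eta>>0. \<forall>c. \<exists>\<gamma>. \<eta> - 1 / real q \<le> \<gamma> + c \<and> \<gamma> + c \<le> - \<eta> \<and> drift q c \<gamma> = 0"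
proof -
  \<comment> \<open>The slope terms in \<open>drift_bounds\<close> involve \<eta>; m bounds them for
    all \<eta> < 1/(2 q), so \<eta> can be chosen afterwards, and independently of c.\<close>
  define m where "m = bump' q (- 1 / (2 * real q))"
  obtain \<eta> where \<eta>: "\<eta> > 0" "\<eta> < 1 / (2 * real q)" "m / (real q * (real q - 1)) \<le> bump q \<eta> - bump q (1 / real q - \<eta>)"
    using exists_steep_margin[OF q] by blast
  have h: "2 * (1 / (2 * real q)) = 1 / real q" by simp
  have m1: "bump' q (- \<eta>) \<le> m" unfolding m_def by (rule bump'_antimono[OF q]) (use \<eta> h in linarith)+
  have qq: "real q * (real q - 1) > 0" using q by simp
  have "\<exists>\<gamma>. \<eta> - 1 / real q \<le> \<gamma> + c \<and> \<gamma> + c \<le> - \<eta> \<and> drift q c \<gamma> = 0" for c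
  proof -
    have le: "\<eta> - 1 / real q - c \<le> - \<eta> - c" using \<eta> h by linarith
    have "0 \<le> drift q c (\<eta> - 1 / real q - c)"
    proof -
      have "bump q \<eta> - bump q (\<eta> - 1 / real q) + bump' q \<eta> / (real q * (real q - 1)) \<le> drift q c (\<eta> - 1 / real q - c)"
        using drift_bounds(1)[OF q, of "\<eta> - 1 / real q - c" c] \<eta> h by simp
      moreover have "- (m / (real q * (real q - 1))) \<le> bump' q \<eta> / (real q * (real q - 1))"
        using m1 qq by (simp add: divide_right_mono minus_divide_left del: divide_minus_left)
      moreover have "bump q (\<eta> - 1 / real q) = bump q (1 / real q - \<eta>)"
        using bump_minus[of q "\<eta> - 1 / real q"] by simp
      ultimately show ?thesis using \<eta>(3) by linarith
    qed
    moreover have "drift q c (- \<eta> - c) \<le> 0"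
    proof -
      have "drift q c (- \<eta> - c) \<le> bump q (- \<eta> + 1 / real q) - bump q (- \<eta>) + bump' q (- \<eta>) / (real q * (real q - 1))"
        using drift_bounds(2)[OF q, of "- \<eta> - c" c] \<eta> h by simp
      moreover have "bump' q (- \<eta>) / (real q * (real q - 1)) \<le> m / (real q * (real q - 1))"
        using m1 qq by (intro divide_right_mono) auto
      moreover have "bump q (- \<eta>) = bump q \<eta>" by simp
      moreover have "- \<eta> + 1 / real q = 1 / real q - \<eta>" by simp
      ultimately show ?thesis using \<eta>(3) by (simp only:)
    qed
    ultimately obtain \<gamma> where "\<gamma> \<ge> \<eta> - 1 / real q - c" "\<gamma> \<le> - \<eta> - c" "drift q c \<gamma> = 0"
      using IVT2'[of "drift q c" "- \<eta> - c" 0 "\<eta> - 1 / real q - c", OF _ _ le continuous_drift[OF q \<eta>(1)]] by blast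
    then show ?thesis by (intro exI[of _ \<gamma>]) auto
  qed
  then show ?thesis using \<eta>(1) by blast
qed

text \<open>\<open>cohom\<close> is the integrated recursion started at the left end of the arc;
  hence the constant is f + g - g o T at that point.\<close>

lemma calibrated_of_zero_drift:
  assumes q: "q \<ge> 2" and \<gamma>: "- (1 / real q) < \<gamma> + c" "\<gamma> + c < 0" and zero: "drift q c \<gamma> = 0"
  defines "g \<equiv> periodic_primitive (branch_series q \<gamma> (\<lambda>x. bump' q (x + c)))"
  shows "calibrated q (\<gamma> + c) (\<lambda>y. g (y - c)) (\<lambda>y. g (real q * (y - c)))
     (bump q (\<gamma> + c) + g \<gamma> - g (real q * \<gamma>))"
proof -
  interpret decreasing_branch q \<gamma> "\<lambda>x. bump' q (x + c)" by (rule bump_branch[OF q \<gamma>])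
  let ?s = "branch_series q \<gamma> (\<lambda>x. bump' q (x + c))"
  have per: "g (x + 1) = g x" for x unfolding g_def by (rule periodic_primitive_add_1)
  have diff: "g v - g u = integral {u..v} ?s" if "u \<le> v" for u v
    unfolding g_def using zero that by (intro periodic_primitive_diff branch_series_add_1[OF p_bound] int_branch_series) (auto simp: drift_def)
  have frac_le: "(v - u) / (real q - 1) \<le> 1 / real q" "0 \<le> (v - u) / (real q - 1)"
    if "\<gamma> + c + 1 / real q \<le> u" "u \<le> v" "v \<le> \<gamma> + c + 1" for u v
  proof -
    have "v - u \<le> 1 - 1 / real q" using that by simp
    also have "\<dots> = (real q - 1) / real q" using q2 by (simp add: field_simps)
    finally show "(v - u) / (real q - 1) \<le> 1 / real q" using q2 by (simp add: field_simps)
    show "0 \<le> (v - u) / (real q - 1)" using that q2 by simp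
  qed
  show ?thesis
  proof (unfold_locales, goal_cases)
    case 1 show ?case by (rule q)
  next
    case 2 show ?case by (rule \<gamma>)
  next
    case 3 show ?case by (rule \<gamma>)
  next
    case (4 y) show ?case using per[of "y - c"] by (simp add: algebra_simps)
  next
    case (5 y)
    have "real q * (y + 1 / real q - c) = real q * (y - c) + 1" using q2 by (simp add: field_simps)
    then show ?case using per by simp
  next
    case (6 y)
    then have y: "\<gamma> \<le> y - c" "y - c \<le> \<gamma> + 1 / real q" by auto
    have "g (real q * (y - c)) - g (real q * \<gamma>) = integral {real q * \<gamma>..real q * (y - c)} ?s"
      using y by (intro diff mult_left_mono) auto
    also have "\<dots> = integral {\<gamma>..y - c} (\<lambda>x. bump' q (x + c)) + integral {\<gamma>..y - c} ?s"
      by (rule integral_branch_series_image[OF p_bound p_meas y])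
    also have "integral {\<gamma>..y - c} (\<lambda>x. bump' q (x + c)) = bump q y - bump q (\<gamma> + c)"
      using integral_bump'[of q \<gamma> c "y - c"] q \<gamma> y by simp
    also have "integral {\<gamma>..y - c} ?s = g (y - c) - g \<gamma>" using diff y by simp
    finally show ?case by simp
  next
    case (7 u v)
    have "integral {u - c..v - c} ?s \<le> integral {\<gamma>..\<gamma> + (v - u) / (real q - 1)} (\<lambda>x. bump' q (x + c))"
      using integral_branch_series_outside_le[of "u - c" "v - c"] 7 by simp
    also have "\<dots> = bump q (\<gamma> + c + (v - u) / (real q - 1)) - bump q (\<gamma> + c)"
      using integral_bump'[of q \<gamma> c "\<gamma> + (v - u) / (real q - 1)"] q \<gamma> frac_le[OF 7] by (simp add: add_ac)
    finally show ?case using diff[of "u - c" "v - c"] 7 by simp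
  next
    case (8 u v)
    have e: "\<gamma> + 1 / real q - (v - u) / (real q - 1) + c = \<gamma> + c + 1 / real q - (v - u) / (real q - 1)"
      "\<gamma> + 1 / real q + c = \<gamma> + c + 1 / real q" by simp_all
    have "bump q (\<gamma> + c + 1 / real q) - bump q (\<gamma> + c + 1 / real q - (v - u) / (real q - 1))
      = integral {\<gamma> + 1 / real q - (v - u) / (real q - 1)..\<gamma> + 1 / real q} (\<lambda>x. bump' q (x + c))"
      using integral_bump'[of q "\<gamma> + 1 / real q - (v - u) / (real q - 1)" c "\<gamma> + 1 / real q"] q \<gamma> frac_le[OF 8]
      unfolding e by simp
    also have "\<dots> \<le> integral {u - c..v - c} ?s"
      using integral_branch_series_outside_ge[of "u - c" "v - c"] 8 by simp
    finally show ?case using diff[of "u - c" "v - c"] 8 by simp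
  next
    case (9 u v)
    then show ?case using integral_branch_series_lipschitz(1)[of "u - c" "v - c"] diff[of "u - c" "v - c"] by simp
  next
    case (10 u v)
    have "\<gamma> + 1 / real q + c = \<gamma> + c + 1 / real q" by simp
    show ?case using integral_branch_series_lipschitz(2)[of "u - c" "v - c", unfolded \<open>\<gamma> + 1 / real q + c = \<gamma> + c + 1 / real q\<close>] diff[of "u - c" "v - c"] 10 by simp
  qed
qed

text \<open>K can precede c because the margin \<eta> does: it bounds the series by L, so g has
  Lipschitz constant L, and L bounds g as well since g 0 = 0 and a period has length 1.\<close>

lemma exists_subaction:
  assumes q: "q \<ge> 2"
  shows "\<exists>K. \<forall>c. \<exists>\<gamma> g \<beta>. continuous_on UNIV g \<and> (\<forall>x. \<bar>g x\<bar> \<le> K) \<and> (\<forall>x. g (x + 1) = g x) \<and>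
    (\<forall>x. frac (x - \<gamma>) \<le> 1 / real q \<longrightarrow> fc q c x = ereal (\<beta> + g (real q * x) - g x)) \<and>
    (\<forall>x. \<not> frac (x - \<gamma>) \<le> 1 / real q \<longrightarrow> fc q c x < ereal (\<beta> + g (real q * x) - g x))"
proof -
  obtain \<eta> where \<eta>: "\<eta> > 0" and ex: "\<And>c. \<exists>\<gamma>. \<eta> - 1 / real q \<le> \<gamma> + c \<and> \<gamma> + c \<le> - \<eta> \<and> drift q c \<gamma> = 0"
    using exists_zero_drift[OF q] by blast
  define L where "L = bump' q (\<eta> - 1 / real q) / (real q - 1)"
  have "\<exists>\<gamma> g \<beta>. continuous_on UNIV g \<and> (\<forall>x. \<bar>g x\<bar> \<le> L) \<and> (\<forall>x. g (x + 1) = g x) \<and>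
    (\<forall>x. frac (x - \<gamma>) \<le> 1 / real q \<longrightarrow> fc q c x = ereal (\<beta> + g (real q * x) - g x)) \<and>
    (\<forall>x. \<not> frac (x - \<gamma>) \<le> 1 / real q \<longrightarrow> fc q c x < ereal (\<beta> + g (real q * x) - g x))" for c
  proof -
    obtain \<gamma> where \<gamma>: "\<eta> - 1 / real q \<le> \<gamma> + c" "\<gamma> + c \<le> - \<eta>" "drift q c \<gamma> = 0" using ex by blast
    have \<gamma>': "- (1 / real q) < \<gamma> + c" "\<gamma> + c < 0" using \<gamma> \<eta> by auto
    interpret decreasing_branch q \<gamma> "\<lambda>x. bump' q (x + c)" by (rule bump_branch[OF q \<gamma>'])
    define s where "s = branch_series q \<gamma> (\<lambda>x. bump' q (x + c))"
    define g where "g = periodic_primitive s"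
    define \<beta> where "\<beta> = bump q (\<gamma> + c) + g \<gamma> - g (real q * \<gamma>)"
    have sB: "\<bar>s x\<bar> \<le> L" for x unfolding s_def L_def
      by (rule branch_series_bound[OF abs_bump'_le[OF q \<eta> \<gamma>(1,2)]])
    have L0: "0 \<le> L" using sB[of 0] by auto
    have si: "s integrable_on {a..b}" for a b unfolding s_def by (rule int_branch_series)
    have diff: "g v - g u = integral {u..v} s" if "u \<le> v" for u v
      unfolding g_def s_def using \<gamma>(3) that by (intro periodic_primitive_diff branch_series_add_1[OF p_bound] int_branch_series) (auto simp: drift_def)
    have lip: "\<bar>g v - g u\<bar> \<le> L * \<bar>v - u\<bar>" for u v
    proof -
      have *: "\<bar>g v - g u\<bar> \<le> L * (v - u)" if "u \<le> v" for u v
      proof -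
        have "s x \<le> L" "- L \<le> s x" for x using sB[of x] by auto
        then have "integral {u..v} s \<le> integral {u..v} (\<lambda>_. L)" "integral {u..v} (\<lambda>_. - L) \<le> integral {u..v} s"
          by (intro integral_le si integrable_const_ivl; simp)+
        then show ?thesis using diff[OF that] that by (simp add: mult.commute abs_le_iff)
      qed
      show ?thesis using *[of u v] *[of v u] by (cases "u \<le> v") auto
    qed
    have "continuous_on UNIV g"
      by (rule lipschitz_on_continuous_on[of L]) (use lip L0 in \<open>auto simp: lipschitz_on_def dist_real_def\<close>)
    moreover have "\<bar>g x\<bar> \<le> L" for x
    proof -
      have "g 0 = 0" by (simp add: g_def periodic_primitive_def)
      moreover have "g x = g (frac x)" by (simp add: g_def periodic_primitive_def)
      ultimately have "\<bar>g x\<bar> \<le> L * frac x" using lip[of "frac x" 0] by simp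
      also have "\<dots> \<le> L * 1" using L0 by (intro mult_left_mono) (auto simp: frac_lt_1 less_imp_le)
      finally show ?thesis by simp
    qed
    moreover have "g (x + 1) = g x" for x unfolding g_def by (rule periodic_primitive_add_1)
    moreover have "fc q c x = fc q 0 (x + c)" for x by (simp add: fc_def)
    moreover interpret C: calibrated q "\<gamma> + c" "\<lambda>y. g (y - c)" "\<lambda>y. g (real q * (y - c))" \<beta>
      unfolding \<beta>_def g_def s_def by (rule calibrated_of_zero_drift[OF q \<gamma>' \<gamma>(3)])
    have "fc q 0 (x + c) = ereal (\<beta> + g (real q * x) - g x)" if "frac (x - \<gamma>) \<le> 1 / real q" for x
      using C.fc_on_arc[of "x + c"] that by simp
    moreover have "fc q 0 (x + c) < ereal (\<beta> + g (real q * x) - g x)" if "\<not> frac (x - \<gamma>) \<le> 1 / real q" for x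
      using C.fc_off_arc[of "x + c"] that by simp
    ultimately show ?thesis by (intro exI[of _ \<gamma>] exI[of _ g] exI[of _ \<beta>]) simp
  qed
  then show ?thesis by blast
qed

section \<open>Invariant measures on an arc\<close>

definition rotation_quantile :: "nat \<Rightarrow> real \<Rightarrow> real \<Rightarrow> real" where
  "rotation_quantile q \<rho> t = (\<Sum>n. (real q - 1) / real q ^ Suc n * of_int \<lfloor>t + real n * \<rho>\<rfloor>)"

lemma abs_floor_affine_le: "\<bar>real_of_int \<lfloor>t + real n * \<rho>\<rfloor>\<bar> \<le> (\<bar>t\<bar> + \<bar>\<rho>\<bar> + 1) * real (Suc n)"
proof -
  have "\<bar>real_of_int \<lfloor>t + real n * \<rho>\<rfloor>\<bar> \<le> \<bar>t + real n * \<rho>\<bar> + 1" by linarith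
  also have "\<bar>t + real n * \<rho>\<bar> \<le> \<bar>t\<bar> + real n * \<bar>\<rho>\<bar>" by (metis abs_triangle_ineq abs_mult abs_of_nat)
  also have "\<bar>t\<bar> + real n * \<bar>\<rho>\<bar> + 1 \<le> (\<bar>t\<bar> + \<bar>\<rho>\<bar> + 1) * real (Suc n)" by (simp add: algebra_simps)
  finally show ?thesis by simp
qed

lemma summable_linear_geometric:
  assumes "q \<ge> 2"
  shows "summable (\<lambda>n. (real q - 1) / real q ^ Suc n * (K * real (Suc n)))"
proof -
  have "(\<lambda>n. of_nat (Suc n) * (1 / real q) ^ n) sums (1 / (1 - 1 / real q)\<^sup>2)"
    using assms by (intro geometric_deriv_sums) auto
  then have "summable (\<lambda>n. ((real q - 1) / real q * K) * (of_nat (Suc n) * (1 / real q) ^ n))"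
    by (intro summable_mult) (simp add: sums_iff)
  then show ?thesis by (simp add: power_divide mult_ac)
qed

lemma norm_rotation_quantile_term_le:
  assumes "q \<ge> 2" "\<bar>b\<bar> \<le> K * real (Suc n)"
  shows "norm ((real q - 1) / real q ^ Suc n * b) \<le> (real q - 1) / real q ^ Suc n * (K * real (Suc n))"
proof -
  have "norm ((real q - 1) / real q ^ Suc n * b) = (real q - 1) / real q ^ Suc n * \<bar>b\<bar>"
    using assms(1) by (simp add: abs_mult)
  also have "\<dots> \<le> (real q - 1) / real q ^ Suc n * (K * real (Suc n))"
    using assms by (intro mult_left_mono) auto
  finally show ?thesis .
qed

lemma summable_rotation_quantile_terms:
  assumes "q \<ge> 2" "\<And>n. \<bar>b n\<bar> \<le> K * real (Suc n)"
  shows "summable (\<lambda>n. (real q - 1) / real q ^ Suc n * b n)"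
  by (rule summable_comparison_test'[OF summable_linear_geometric[OF assms(1), of K] norm_rotation_quantile_term_le[OF assms(1,2)]])

lemmas rotation_quantile_summable = summable_rotation_quantile_terms[OF _ abs_floor_affine_le]

lemma weights_sum: assumes "q \<ge> 2" shows "(\<lambda>n. (real q - 1) / real q ^ Suc n) sums 1"
proof -
  have "(\<lambda>n. ((real q - 1) / real q) * (1 / real q) ^ n) sums (((real q - 1) / real q) * (1 / (1 - 1 / real q)))"
    using assms by (intro sums_mult geometric_sums) auto
  moreover have "((real q - 1) / real q) * (1 / (1 - 1 / real q)) = 1" using assms by (simp add: divide_simps)
  moreover have "(\<lambda>n. ((real q - 1) / real q) * (1 / real q) ^ n) = (\<lambda>n. (real q - 1) / real q ^ Suc n)"
    by (simp add: power_divide)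
  ultimately show ?thesis by (simp only:)
qed

text \<open>This relation is the origin of the formula: solved for Q(t) and iterated, it gives the
  series. Modulo 1 the floor term disappears, so Q carries the rotation by \<rho> to multiplication
  by q.\<close>

lemma rotation_quantile_add_rho:
  assumes "q \<ge> 2"
  shows "rotation_quantile q \<rho> (t + \<rho>) = real q * rotation_quantile q \<rho> t - (real q - 1) * of_int \<lfloor>t\<rfloor>"
proof -
  have "rotation_quantile q \<rho> t = (real q - 1) / real q * of_int \<lfloor>t\<rfloor>
     + (\<Sum>n. (real q - 1) / real q ^ Suc (Suc n) * of_int \<lfloor>t + real (Suc n) * \<rho>\<rfloor>)"
    unfolding rotation_quantile_def using suminf_split_head[OF rotation_quantile_summable[OF assms, of t \<rho>]] by simp
  also have "(\<Sum>n. (real q - 1) / real q ^ Suc (Suc n) * of_int \<lfloor>t + real (Suc n) * \<rho>\<rfloor>)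
     = (\<Sum>n. (real q - 1) / real q ^ Suc n * of_int \<lfloor>t + \<rho> + real n * \<rho>\<rfloor> / real q)"
    by (rule arg_cong[of _ _ suminf]) (auto simp: algebra_simps)
  also have "\<dots> = rotation_quantile q \<rho> (t + \<rho>) / real q"
    unfolding rotation_quantile_def by (rule suminf_divide[OF rotation_quantile_summable[OF assms]])
  finally show ?thesis using assms by (simp add: field_simps)
qed

lemma rotation_quantile_add_1:
  assumes "q \<ge> 2"
  shows "rotation_quantile q \<rho> (t + 1) = rotation_quantile q \<rho> t + 1"
proof -
  have "rotation_quantile q \<rho> (t + 1) = (\<Sum>n. (real q - 1) / real q ^ Suc n * of_int \<lfloor>t + real n * \<rho>\<rfloor> + (real q - 1) / real q ^ Suc n)"
    unfolding rotation_quantile_def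
  proof (rule arg_cong[of _ _ suminf], rule ext)
    fix n
    have "t + 1 + real n * \<rho> = (t + real n * \<rho>) + 1" by simp
    then have "\<lfloor>t + 1 + real n * \<rho>\<rfloor> = \<lfloor>t + real n * \<rho>\<rfloor> + 1" by (metis floor_add_int of_int_1)
    then show "(real q - 1) / real q ^ Suc n * of_int \<lfloor>t + 1 + real n * \<rho>\<rfloor>
       = (real q - 1) / real q ^ Suc n * of_int \<lfloor>t + real n * \<rho>\<rfloor> + (real q - 1) / real q ^ Suc n"
      by (simp only: of_int_add of_int_1 distrib_left mult_1_right)
  qed
  also have "\<dots> = rotation_quantile q \<rho> t + 1"
    unfolding rotation_quantile_def using suminf_add[OF rotation_quantile_summable[OF assms, of t \<rho>] sums_summable[OF weights_sum[OF assms]]] weights_sum[OF assms]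
    by (simp add: sums_iff)
  finally show ?thesis .
qed

lemma rotation_quantile_le:
  assumes "q \<ge> 2" "\<And>n. real_of_int \<lfloor>t + real n * \<rho>\<rfloor> \<le> b n" "\<And>n. \<bar>b n\<bar> \<le> K * real (Suc n)"
  shows "rotation_quantile q \<rho> t \<le> (\<Sum>n. (real q - 1) / real q ^ Suc n * b n)"
  unfolding rotation_quantile_def using assms(1,2)
  by (intro suminf_le rotation_quantile_summable summable_rotation_quantile_terms[OF assms(1,3)] mult_left_mono) auto

lemma rotation_quantile_mono:
  assumes "q \<ge> 2" "t \<le> t'" "\<rho> \<le> \<rho>'"
  shows "rotation_quantile q \<rho> t \<le> rotation_quantile q \<rho>' t'"
proof -
  have "t + real n * \<rho> \<le> t' + real n * \<rho>'" for n using assms by (intro add_mono mult_left_mono) auto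
  then show ?thesis
    using rotation_quantile_le[OF assms(1) _ abs_floor_affine_le, of t \<rho> t' \<rho>'] unfolding rotation_quantile_def[of q \<rho>' t']
    by (simp add: floor_mono)
qed

lemma rotation_quantile_measurable:
  assumes "q \<ge> 2" shows "rotation_quantile q \<rho> \<in> borel_measurable borel"
  using assms by (intro borel_measurable_mono monoI rotation_quantile_mono) auto

lemma frac_rotation_quantile_shift:
  assumes "q \<ge> 2" shows "frac (rotation_quantile q \<rho> (frac t)) = frac (rotation_quantile q \<rho> t)"
  by (rule periodic_frac) (simp add: rotation_quantile_add_1[OF assms] frac_1_eq)

lemma rotation_quantile_tendsto:
  assumes q: "q \<ge> 2" and X: "\<And>j. \<bar>X j\<bar> \<le> K"
    and lim: "\<And>n. (\<lambda>j. real_of_int \<lfloor>real n * X j\<rfloor>) \<longlonglongrightarrow> b n"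
  shows "(\<lambda>j. rotation_quantile q (X j) 0) \<longlonglongrightarrow> (\<Sum>n. (real q - 1) / real q ^ Suc n * b n)"
  unfolding rotation_quantile_def
proof (rule tannerys_theorem[THEN conjunct2, THEN conjunct2])
  show "(\<lambda>j. (real q - 1) / real q ^ Suc n * real_of_int \<lfloor>0 + real n * X j\<rfloor>) \<longlonglongrightarrow> (real q - 1) / real q ^ Suc n * b n" for n
    by (simp only: add_0) (rule tendsto_mult_left[OF lim])
  show "summable (\<lambda>n. (real q - 1) / real q ^ Suc n * ((K + 1) * real (Suc n)))"
    by (rule summable_linear_geometric[OF q])
  have "norm ((real q - 1) / real q ^ Suc n * real_of_int \<lfloor>0 + real n * X j\<rfloor>) \<le> (real q - 1) / real q ^ Suc n * ((K + 1) * real (Suc n))" for n j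
  proof (rule norm_rotation_quantile_term_le[OF q])
    show "\<bar>real_of_int \<lfloor>0 + real n * X j\<rfloor>\<bar> \<le> (K + 1) * real (Suc n)"
    proof -
      have "(\<bar>0\<bar> + \<bar>X j\<bar> + 1) * real (Suc n) \<le> (K + 1) * real (Suc n)"
        using X[of j] by (intro mult_right_mono) auto
      then show ?thesis using abs_floor_affine_le[of 0 n "X j"] by linarith
    qed
  qed
  then show "\<forall>\<^sub>F (n, j) in sequentially \<times>\<^sub>F sequentially.
      norm ((real q - 1) / real q ^ Suc n * real_of_int \<lfloor>0 + real n * X j\<rfloor>) \<le> (real q - 1) / real q ^ Suc n * ((K + 1) * real (Suc n))"
    by (intro always_eventually) auto
qed simp

lemma floor_tendsto_right:
  assumes "X \<longlonglongrightarrow> (x::real)" "\<And>j. x \<le> X j"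
  shows "(\<lambda>j. real_of_int \<lfloor>X j\<rfloor>) \<longlonglongrightarrow> of_int \<lfloor>x\<rfloor>"
proof (rule tendsto_eventually)
  have "\<forall>\<^sub>F j in sequentially. X j < of_int \<lfloor>x\<rfloor> + 1"
    by (rule order_tendstoD(2)[OF assms(1)]) linarith
  then show "\<forall>\<^sub>F j in sequentially. real_of_int \<lfloor>X j\<rfloor> = of_int \<lfloor>x\<rfloor>"
  proof eventually_elim
    case (elim j)
    have "of_int \<lfloor>x\<rfloor> \<le> X j" using assms(2)[of j] by linarith
    then have "\<lfloor>X j\<rfloor> = \<lfloor>x\<rfloor>" using elim by linarith
    then show ?case by simp
  qed
qed

lemma floor_tendsto_left:
  assumes "X \<longlonglongrightarrow> (x::real)" "\<And>j. X j < x"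
  shows "(\<lambda>j. real_of_int \<lfloor>X j\<rfloor>) \<longlonglongrightarrow> of_int (\<lceil>x\<rceil> - 1)"
proof (rule tendsto_eventually)
  have "\<forall>\<^sub>F j in sequentially. of_int \<lceil>x\<rceil> - 1 < X j"
    by (rule order_tendstoD(1)[OF assms(1)]) linarith
  then show "\<forall>\<^sub>F j in sequentially. real_of_int \<lfloor>X j\<rfloor> = of_int (\<lceil>x\<rceil> - 1)"
  proof eventually_elim
    case (elim j)
    have "X j < of_int \<lceil>x\<rceil>" using assms(2)[of j] by linarith
    then have "\<lfloor>X j\<rfloor> = \<lceil>x\<rceil> - 1" using elim by linarith
    then show ?case by simp
  qed
qed

text \<open>Take for \<open>\<rho>\<close> the infimum of the parameters with \<open>Q(0) \<ge> \<gamma>\<close>: the right limit at \<open>\<rho>\<close> gives the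
  lower bound, the left limit the upper bound.\<close>
lemma exists_rotation_number:
  assumes q: "q \<ge> 2"
  shows "\<exists>\<rho>. \<forall>t\<in>{0..<1}. \<gamma> \<le> rotation_quantile q \<rho> t \<and> rotation_quantile q \<rho> t \<le> \<gamma> + 1 / real q"
proof -
  define R where "R = {\<rho>. \<gamma> \<le> rotation_quantile q \<rho> 0}"
  \<comment> \<open>The weight of the term n = 1. At t = 0 and parameter N or -N the term n = 0
    vanishes and all others have one sign, so this term alone drives Q(0) to plus or minus
    infinity.\<close>
  define w where "w = (real q - 1) / real q ^ 2"
  have w: "w > 0" using q by (simp add: w_def)
  have big: "w * real N \<le> rotation_quantile q (real N) 0" for N
  proof -
    have "sum (\<lambda>n. (real q - 1) / real q ^ Suc n * real_of_int \<lfloor>0 + real n * real N\<rfloor>) {1} \<le> rotation_quantile q (real N) 0"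
      unfolding rotation_quantile_def using q by (intro sum_le_suminf rotation_quantile_summable) auto
    then show ?thesis by (simp add: w_def power2_eq_square)
  qed
  have small: "rotation_quantile q (- real N) 0 \<le> - (w * real N)" for N
  proof -
    have f: "real_of_int \<lfloor>0 + real n * - real N\<rfloor> = - real n * real N" for n
      by (metis add_0 floor_of_int minus_mult_left mult_minus_right of_int_minus of_int_of_nat_eq of_nat_mult)
    have "sum (\<lambda>n. - ((real q - 1) / real q ^ Suc n * real_of_int \<lfloor>0 + real n * - real N\<rfloor>)) {1} \<le> (\<Sum>n. - ((real q - 1) / real q ^ Suc n * real_of_int \<lfloor>0 + real n * - real N\<rfloor>))"
      using q by (intro sum_le_suminf summable_minus rotation_quantile_summable) (auto simp: f)
    then show ?thesis unfolding rotation_quantile_def using suminf_minus[OF rotation_quantile_summable[OF q, of 0 "- real N"]]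
      by (simp only: f) (simp add: w_def power2_eq_square)
  qed
  obtain N1 where "\<gamma> / w < real N1" using reals_Archimedean2 by blast
  then have "\<gamma> \<le> w * real N1" using w by (simp add: field_simps)
  then have "real N1 \<in> R" using big[of N1] unfolding R_def by simp
  then have ne: "R \<noteq> {}" by blast
  obtain N2 where "- \<gamma> / w < real N2" using reals_Archimedean2 by blast
  then have N2: "- (w * real N2) < \<gamma>" using w by (simp add: field_simps)
  have bdd: "bdd_below R"
  proof (rule bdd_belowI)
    fix r assume "r \<in> R"
    then show "- real N2 \<le> r" using rotation_quantile_mono[OF q order_refl, of r "- real N2" 0] small[of N2] N2
      by (cases "r \<le> - real N2") (auto simp: R_def)
  qed
  define \<rho> where "\<rho> = Inf R"
  have t0: "(\<lambda>j. 1 / real (Suc j)) \<longlonglongrightarrow> 0" by (rule LIMSEQ_Suc[OF lim_const_over_n])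
  have le1: "1 / real (Suc j) \<le> 1" "0 < 1 / real (Suc j)" for j by auto
  have 1: "\<gamma> \<le> rotation_quantile q \<rho> 0"
  proof -
    have "(\<lambda>j. rotation_quantile q (\<rho> + 1 / real (Suc j)) 0) \<longlonglongrightarrow> (\<Sum>n. (real q - 1) / real q ^ Suc n * of_int \<lfloor>real n * \<rho>\<rfloor>)"
    proof (rule rotation_quantile_tendsto[OF q])
      show "\<bar>\<rho> + 1 / real (Suc j)\<bar> \<le> \<bar>\<rho>\<bar> + 1" for j using le1[of j] by linarith
      have "(\<lambda>j. real n * (\<rho> + 1 / real (Suc j))) \<longlonglongrightarrow> real n * (\<rho> + 0)" for n by (intro tendsto_intros t0)
      then show "(\<lambda>j. real_of_int \<lfloor>real n * (\<rho> + 1 / real (Suc j))\<rfloor>) \<longlonglongrightarrow> of_int \<lfloor>real n * \<rho>\<rfloor>" for n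
        by (intro floor_tendsto_right mult_left_mono) auto
    qed
    moreover have "\<gamma> \<le> rotation_quantile q (\<rho> + 1 / real (Suc j)) 0" for j
    proof -
      have "Inf R < \<rho> + 1 / real (Suc j)" using le1[of j] by (simp add: \<rho>_def)
      then obtain r where "r \<in> R" "r < \<rho> + 1 / real (Suc j)" using cInf_lessD[OF ne] by blast
      then show ?thesis using rotation_quantile_mono[OF q order_refl, of r "\<rho> + 1 / real (Suc j)" 0] by (simp add: R_def)
    qed
    ultimately have "\<gamma> \<le> (\<Sum>n. (real q - 1) / real q ^ Suc n * of_int \<lfloor>real n * \<rho>\<rfloor>)"
      by (intro LIMSEQ_le_const) auto
    then show ?thesis by (simp add: rotation_quantile_def)
  qed
  \<comment> \<open>The left limits of floor(n r) as r increases to \<rho>. For n = 0 the argument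
    is constantly 0, so nothing is subtracted there.\<close>
  define b :: "nat \<Rightarrow> int" where "b = (\<lambda>n. if n = 0 then 0 else \<lceil>real n * \<rho>\<rceil> - 1)"
  have bb: "\<bar>real_of_int (b n)\<bar> \<le> (\<bar>\<rho>\<bar> + 2) * real (Suc n)" for n
  proof -
    have "\<bar>real_of_int (b n)\<bar> \<le> \<bar>real n * \<rho>\<bar> + 1" unfolding b_def by (cases "n = 0") (simp, simp, linarith)
    also have "\<dots> \<le> (\<bar>\<rho>\<bar> + 2) * real (Suc n)" by (simp add: abs_mult algebra_simps)
    finally show ?thesis .
  qed
  have 2: "(\<Sum>n. (real q - 1) / real q ^ Suc n * of_int (b n)) \<le> \<gamma>"
  proof -
    have "(\<lambda>j. rotation_quantile q (\<rho> - 1 / real (Suc j)) 0) \<longlonglongrightarrow> (\<Sum>n. (real q - 1) / real q ^ Suc n * of_int (b n))"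
    proof (rule rotation_quantile_tendsto[OF q])
      show "\<bar>\<rho> - 1 / real (Suc j)\<bar> \<le> \<bar>\<rho>\<bar> + 1" for j using le1[of j] by linarith
      have "(\<lambda>j. real n * (\<rho> - 1 / real (Suc j))) \<longlonglongrightarrow> real n * (\<rho> - 0)" for n by (intro tendsto_intros t0)
      then have "(\<lambda>j. real_of_int \<lfloor>real n * (\<rho> - 1 / real (Suc j))\<rfloor>) \<longlonglongrightarrow> of_int (\<lceil>real n * \<rho>\<rceil> - 1)" if "n > 0" for n
        using that by (intro floor_tendsto_left mult_strict_left_mono) auto
      then show "(\<lambda>j. real_of_int \<lfloor>real n * (\<rho> - 1 / real (Suc j))\<rfloor>) \<longlonglongrightarrow> of_int (b n)" for n
        by (cases "n = 0") (auto simp: b_def)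
    qed
    moreover have "rotation_quantile q (\<rho> - 1 / real (Suc j)) 0 \<le> \<gamma>" for j
    proof (rule ccontr)
      assume "\<not> ?thesis"
      then have "\<rho> \<le> \<rho> - 1 / real (Suc j)" unfolding \<rho>_def by (intro cInf_lower bdd) (auto simp: R_def)
      then show False using le1[of j] by linarith
    qed
    ultimately show ?thesis by (intro LIMSEQ_le_const2) auto
  qed
  \<comment> \<open>For t < 1 the floor exceeds \<open>b n\<close> by at most 1, and by 0 at n = 0.
    All weights except the first, (q - 1)/q, sum to 1/q: this is the length of the arc.\<close>
  have 3: "rotation_quantile q \<rho> t \<le> \<gamma> + 1 / real q" if t: "t \<in> {0..<1}" for t
  proof -
    have "rotation_quantile q \<rho> t \<le> (\<Sum>n. (real q - 1) / real q ^ Suc n * (of_int (b n) + (if n = 0 then 0 else 1)))"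
    proof (rule rotation_quantile_le[OF q])
      fix n
      have "\<lfloor>t + real n * \<rho>\<rfloor> \<le> b n + (if n = 0 then 0 else 1)"
      proof (cases "n = 0")
        case False
        have "t + real n * \<rho> < of_int \<lceil>real n * \<rho>\<rceil> + 1" using t by simp linarith
        then have "\<lfloor>t + real n * \<rho>\<rfloor> \<le> \<lceil>real n * \<rho>\<rceil>" by linarith
        then show ?thesis using False by (simp add: b_def)
      qed (use t in \<open>auto simp: b_def\<close>)
      then show "real_of_int \<lfloor>t + real n * \<rho>\<rfloor> \<le> of_int (b n) + (if n = 0 then 0 else 1)" by (cases "n = 0") auto
      show "\<bar>real_of_int (b n) + (if n = 0 then 0 else 1)\<bar> \<le> (\<bar>\<rho>\<bar> + 3) * real (Suc n)"
        using bb[of n] by (auto simp: algebra_simps)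
    qed
    also have "\<dots> = (\<Sum>n. (real q - 1) / real q ^ Suc n * of_int (b n) + (real q - 1) / real q ^ Suc n * (if n = 0 then 0 else 1))"
      by (simp add: distrib_left)
    also have "\<dots> = (\<Sum>n. (real q - 1) / real q ^ Suc n * of_int (b n)) + (\<Sum>n. (real q - 1) / real q ^ Suc n * (if n = 0 then 0 else 1))"
      by (rule suminf_add[symmetric] summable_rotation_quantile_terms[OF q, of _ 1] summable_rotation_quantile_terms[OF q bb])+ auto
    also have "(\<Sum>n. (real q - 1) / real q ^ Suc n * (if n = 0 then 0 else 1)) = 1 / real q"
    proof -
      have "(\<lambda>n. (real q - 1) / real q ^ Suc n - (if n = 0 then (real q - 1) / real q else 0)) sums (1 - (real q - 1) / real q)"
        by (intro sums_diff weights_sum[OF q] sums_single)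
      moreover have "(\<lambda>n. (real q - 1) / real q ^ Suc n - (if n = 0 then (real q - 1) / real q else 0))
         = (\<lambda>n. (real q - 1) / real q ^ Suc n * (if n = 0 then 0 else 1))" by auto
      moreover have "1 - (real q - 1) / real q = 1 / real q" using q by (simp add: field_simps)
      ultimately show ?thesis by (simp add: sums_iff)
    qed
    finally show ?thesis using 2 by simp
  qed
  have "\<gamma> \<le> rotation_quantile q \<rho> t" if "t \<in> {0..<1}" for t using 1 rotation_quantile_mono[OF q, of 0 t \<rho> \<rho>] that by simp
  then show ?thesis using 3 by blast
qed

section \<open>Lebesgue measure on [0,1) and its push-forward\<close>

definition unif :: "real measure" where "unif = restrict_space lborel {0..<1}"

lemma space_unif: "space unif = {0..<1}" by (simp add: unif_def space_restrict_space)
lemma sets_unif: "sets unif = sets torus" by (simp add: unif_def torus_def sets_restrict_space)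
lemma space_torus: "space torus = {0..<1}" by (simp add: torus_def space_restrict_space)

lemma sets_torus: "A \<in> sets torus \<longleftrightarrow> A \<subseteq> {0..<1} \<and> A \<in> sets borel"
  unfolding torus_def by (subst sets_restrict_space_iff) auto

lemma emeasure_unif: "A \<in> sets torus \<Longrightarrow> emeasure unif A = emeasure lborel A"
  unfolding unif_def by (rule emeasure_restrict_space) (auto simp: sets_torus)

lemma prob_space_unif: "prob_space unif"
proof
  have "{0..<1::real} \<in> sets torus" by (simp add: sets_torus)
  then show "emeasure unif (space unif) = 1" by (simp add: space_unif emeasure_unif)
qed

lemma frac_measurable [measurable]: "(frac :: real \<Rightarrow> real) \<in> borel_measurable borel"
  unfolding frac_def[abs_def] by measurable

lemma frac_in_torus_measurable:
  assumes "f \<in> borel_measurable borel"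
  shows "(\<lambda>x. frac (f x)) \<in> measurable torus torus" "(\<lambda>x. frac (f x)) \<in> measurable unif torus"
proof -
  have m: "(\<lambda>x. frac (f x)) \<in> borel_measurable borel" using assms by measurable
  show "(\<lambda>x. frac (f x)) \<in> measurable torus torus" unfolding torus_def
    by (intro measurable_restrict_space2 measurable_restrict_space1 m) (auto simp: frac_lt_1)
  then show "(\<lambda>x. frac (f x)) \<in> measurable unif torus"
    using measurable_cong_sets[OF sets_unif refl, of torus] by blast
qed

lemma emeasure_lborel_shift:
  assumes "A \<in> sets borel"
  shows "emeasure lborel {x. x + c \<in> A} = emeasure lborel (A::real set)"
proof -
  have "emeasure lborel A = emeasure (distr lborel borel ((+) c)) A" by (simp add: lborel_distr_plus)
  also have "\<dots> = emeasure lborel {x. x + c \<in> A}"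
    using assms by (subst emeasure_distr) (auto simp: vimage_def add.commute)
  finally show ?thesis by simp
qed

lemma unif_rotation: "distr unif torus (\<lambda>t. frac (t + \<rho>)) = unif"
proof (rule measure_eqI)
  show "sets (distr unif torus (\<lambda>t. frac (t + \<rho>))) = sets unif" by (simp add: sets_unif)
  fix A assume "A \<in> sets (distr unif torus (\<lambda>t. frac (t + \<rho>)))"
  then have A: "A \<in> sets torus" by simp
  then have Ab: "A \<in> sets borel" "A \<subseteq> {0..<1}" by (auto simp: sets_torus)
  define r where "r = frac \<rho>"
  have r: "0 \<le> r" "r < 1" by (auto simp: r_def frac_lt_1)
  have mm: "(\<lambda>t. frac (t + \<rho>)) \<in> measurable unif torus" by (rule frac_in_torus_measurable) simp
  have fr: "frac (t + \<rho>) = (if t + r < 1 then t + r else t + (r - 1))" if "t \<in> {0..<1}" for t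
    using that by (auto simp: frac_add r_def)
  have pre: "(\<lambda>t. frac (t + \<rho>)) -` A \<inter> space unif = {t. t + r \<in> A \<inter> {r..<1}} \<union> {t. t + (r - 1) \<in> A \<inter> {0..<r}}"
    (is "_ = ?B \<union> ?C")
    using Ab r by (auto simp: space_unif fr split: if_splits) 
  have S: "(\<lambda>t. frac (t + \<rho>)) -` A \<inter> space unif \<in> sets torus" using measurable_sets[OF mm A] sets_unif by simp
  have Bm: "?B \<in> sets borel"
    using measurable_sets_borel[of "\<lambda>t. t + r" borel "A \<inter> {r..<1}"] Ab by (auto simp: vimage_def)
  have Cm: "?C \<in> sets borel"
    using measurable_sets_borel[of "\<lambda>t. t + (r - 1)" borel "A \<inter> {0..<r}"] Ab by (auto simp: vimage_def)
  have "emeasure (distr unif torus (\<lambda>t. frac (t + \<rho>))) A = emeasure unif ((\<lambda>t. frac (t + \<rho>)) -` A \<inter> space unif)"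
    by (rule emeasure_distr[OF mm A])
  also have "\<dots> = emeasure lborel (?B \<union> ?C)" using emeasure_unif[OF S] pre by simp
  also have "\<dots> = emeasure lborel ?B + emeasure lborel ?C"
    using Bm Cm by (intro plus_emeasure[symmetric]) auto
  also have "\<dots> = emeasure lborel (A \<inter> {r..<1}) + emeasure lborel (A \<inter> {0..<r})"
    using Ab by (subst (1 2) emeasure_lborel_shift) auto
  also have "\<dots> = emeasure lborel ((A \<inter> {r..<1}) \<union> (A \<inter> {0..<r}))"
    using Ab by (intro plus_emeasure) auto
  also have "(A \<inter> {r..<1}) \<union> (A \<inter> {0..<r}) = A" using Ab r by auto
  finally show "emeasure (distr unif torus (\<lambda>t. frac (t + \<rho>))) A = emeasure unif A" using emeasure_unif[OF A] by simp
qed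

lemma arc_sets: "arc \<gamma> l \<in> sets torus"
proof -
  have "{x. frac (x - \<gamma>) \<le> l} \<in> sets borel" by measurable
  moreover have "arc \<gamma> l = {0..<1} \<inter> {x. frac (x - \<gamma>) \<le> l}" by (auto simp: arc_def)
  ultimately show ?thesis by (simp add: sets_torus)
qed

lemma Tmap_measurable: "Tmap q \<in> measurable torus torus"
  unfolding Tmap_def[abs_def] by (rule frac_in_torus_measurable) simp

lemma exists_invariant_measure_on_arc:
  assumes q: "q \<ge> 2"
  shows "\<exists>\<nu>. \<nu> \<in> invariant_measures q \<and> measure \<nu> (arc \<gamma> (1 / real q)) = 1"
proof -
  obtain \<rho> where \<rho>: "\<And>t. t \<in> {0..<1} \<Longrightarrow> \<gamma> \<le> rotation_quantile q \<rho> t \<and> rotation_quantile q \<rho> t \<le> \<gamma> + 1 / real q"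
    using exists_rotation_number[OF q] by blast
  define Y where "Y = (\<lambda>t. frac (rotation_quantile q \<rho> t))"
  define \<nu> where "\<nu> = distr unif torus Y"
  have Ym: "Y \<in> measurable unif torus" "Y \<in> measurable torus torus"
    unfolding Y_def by (rule frac_in_torus_measurable[OF rotation_quantile_measurable[OF q]])+
  interpret U: prob_space unif by (rule prob_space_unif)
  interpret V: prob_space \<nu> unfolding \<nu>_def by (rule U.prob_space_distr[OF Ym(1)])
  have sets: "sets \<nu> = sets torus" by (simp add: \<nu>_def)
  have rm: "(\<lambda>t. frac (t + \<rho>)) \<in> measurable unif torus" by (rule frac_in_torus_measurable) simp
  \<comment> \<open>The floor of t and the floor taken by \<open>frac\<close> enter with integer
    factors, so both vanish modulo 1.\<close>
  have TY: "Tmap q (Y t) = Y (frac (t + \<rho>))" for t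
  proof -
    have "real q * rotation_quantile q \<rho> t = rotation_quantile q \<rho> (t + \<rho>) + of_int ((int q - 1) * \<lfloor>t\<rfloor>)"
      using rotation_quantile_add_rho[OF q, of \<rho> t] by simp
    moreover have "real q * Y t = real q * rotation_quantile q \<rho> t - of_int (int q * \<lfloor>rotation_quantile q \<rho> t\<rfloor>)"
      by (simp add: Y_def frac_def right_diff_distrib)
    ultimately have "real q * Y t = rotation_quantile q \<rho> (t + \<rho>) + of_int ((int q - 1) * \<lfloor>t\<rfloor> - int q * \<lfloor>rotation_quantile q \<rho> t\<rfloor>)" by simp
    then have "Tmap q (Y t) = frac (rotation_quantile q \<rho> (t + \<rho>))" unfolding Tmap_def by (simp only: frac_add_of_int_right)
    then show ?thesis by (simp add: Y_def frac_rotation_quantile_shift[OF q])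
  qed
  have "distr \<nu> torus (Tmap q) = distr unif torus (Tmap q \<circ> Y)"
    unfolding \<nu>_def by (rule distr_distr[OF Tmap_measurable Ym(1)])
  also have "Tmap q \<circ> Y = Y \<circ> (\<lambda>t. frac (t + \<rho>))" using TY by (simp add: o_def)
  also have "distr unif torus (Y \<circ> (\<lambda>t. frac (t + \<rho>))) = distr (distr unif torus (\<lambda>t. frac (t + \<rho>))) torus Y"
    by (rule distr_distr[symmetric, OF Ym(2) rm])
  also have "\<dots> = \<nu>" by (simp add: unif_rotation \<nu>_def)
  finally have inv: "distr \<nu> \<nu> (Tmap q) = \<nu>" using distr_cong[OF refl sets refl] by metis
  have Tm: "Tmap q \<in> measurable \<nu> \<nu>" using Tmap_measurable measurable_cong_sets[OF sets sets] by blast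
  have "Y -` arc \<gamma> (1 / real q) \<inter> space unif = space unif"
  proof -
    have "Y t \<in> arc \<gamma> (1 / real q)" if "t \<in> {0..<1}" for t
    proof -
      have b: "0 \<le> rotation_quantile q \<rho> t - \<gamma>" "rotation_quantile q \<rho> t - \<gamma> \<le> 1 / real q" using \<rho>[OF that] by auto
      moreover have "1 / real q < 1" using q by simp
      ultimately have "frac (rotation_quantile q \<rho> t - \<gamma>) = rotation_quantile q \<rho> t - \<gamma>" by (subst frac_eq) auto
      moreover have "Y t - \<gamma> = (rotation_quantile q \<rho> t - \<gamma>) + of_int (- \<lfloor>rotation_quantile q \<rho> t\<rfloor>)" by (simp add: Y_def frac_def)
      then have "frac (Y t - \<gamma>) = frac (rotation_quantile q \<rho> t - \<gamma>)" by (simp only: frac_add_of_int_right)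
      ultimately show ?thesis using b by (auto simp: arc_def Y_def frac_lt_1)
    qed
    then show ?thesis by (auto simp: space_unif)
  qed
  then have "measure \<nu> (arc \<gamma> (1 / real q)) = 1"
    unfolding \<nu>_def by (subst measure_distr[OF Ym(1) arc_sets]) (simp add: U.prob_space)
  then show ?thesis using V.prob_space_axioms sets Tm inv by (auto simp: invariant_measures_def)
qed

section \<open>Digits and digit sums relative to the arc\<close>

definition arc_rep :: "real \<Rightarrow> real \<Rightarrow> real" where
  "arc_rep \<gamma> x = \<gamma> + frac (x - \<gamma>)"

text \<open>Base q digits relative to the window [\<gamma>, \<gamma> + 1) in place of [0, 1); they
  need not lie between 0 and q - 1.\<close>

definition arc_digit :: "nat \<Rightarrow> real \<Rightarrow> real \<Rightarrow> int" where
  "arc_digit q \<gamma> x = \<lfloor>real q * arc_rep \<gamma> x - \<gamma>\<rfloor>"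

text \<open>The degree-one lift of \<open>T\<close> on the arc moves \<open>arc_rep \<gamma> x\<close> in \<open>n\<close> steps to
  \<open>arc_rep \<gamma> (q^n x) + digit_sum q \<gamma> n x\<close>; it is monotone, and so is the digit sum.\<close>
definition digit_sum :: "nat \<Rightarrow> real \<Rightarrow> nat \<Rightarrow> real \<Rightarrow> int" where
  "digit_sum q \<gamma> n x = (\<Sum>i<n. arc_digit q \<gamma> (real q ^ i * x))"

definition arc_core :: "nat \<Rightarrow> real \<Rightarrow> real set" where
  "arc_core q \<gamma> = {x \<in> {0..<1}. \<forall>n. frac (real q ^ n * x - \<gamma>) \<le> 1 / real q}"

lemma arc_rep_frac: "arc_rep \<gamma> (frac x) = arc_rep \<gamma> x"
  by (simp add: arc_rep_def frac_frac_diff)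

lemma arc_digit_frac: "arc_digit q \<gamma> (frac x) = arc_digit q \<gamma> x"
  by (simp add: arc_digit_def arc_rep_frac)

lemma arc_rep_bounds: "\<gamma> \<le> arc_rep \<gamma> x" "arc_rep \<gamma> x < \<gamma> + 1"
  by (simp_all add: arc_rep_def frac_lt_1)

lemma frac_arc_rep: "frac (arc_rep \<gamma> x) = frac x"
proof -
  have "arc_rep \<gamma> x = x + of_int (- \<lfloor>x - \<gamma>\<rfloor>)" by (simp add: arc_rep_def frac_def)
  then show ?thesis by (simp only: frac_add_of_int_right)
qed

lemma arc_rep_mult: "arc_rep \<gamma> (real q * x) = real q * arc_rep \<gamma> x - of_int (arc_digit q \<gamma> x)"
proof -
  have "real q * x - \<gamma> = (real q * arc_rep \<gamma> x - \<gamma>) + of_int (int q * \<lfloor>x - \<gamma>\<rfloor>)"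
    by (simp add: arc_rep_def frac_def algebra_simps)
  then have "frac (real q * x - \<gamma>) = frac (real q * arc_rep \<gamma> x - \<gamma>)" by (simp only: frac_add_of_int_right)
  then show ?thesis by (simp add: arc_rep_def[of \<gamma> "real q * x"] frac_def arc_digit_def)
qed

lemma abs_arc_digit_le: "\<bar>real_of_int (arc_digit q \<gamma> x)\<bar> \<le> real q * (\<bar>\<gamma>\<bar> + 1) + \<bar>\<gamma>\<bar> + 1"
proof -
  have "\<bar>real_of_int (arc_digit q \<gamma> x)\<bar> \<le> \<bar>real q * arc_rep \<gamma> x - \<gamma>\<bar> + 1" unfolding arc_digit_def by linarith
  also have "\<bar>real q * arc_rep \<gamma> x - \<gamma>\<bar> \<le> real q * \<bar>arc_rep \<gamma> x\<bar> + \<bar>\<gamma>\<bar>"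
    using abs_triangle_ineq4[of "real q * arc_rep \<gamma> x" \<gamma>] by (simp add: abs_mult)
  also have "real q * \<bar>arc_rep \<gamma> x\<bar> \<le> real q * (\<bar>\<gamma>\<bar> + 1)"
    using arc_rep_bounds[of \<gamma> x] by (intro mult_left_mono) auto
  finally show ?thesis by simp
qed

text \<open>The terms telescope by \<open>arc_rep_mult\<close>. This expansion is what recovers a
  point from its digits, hence from its digit sums.\<close>

lemma arc_rep_sums:
  assumes "q \<ge> 2"
  shows "(\<lambda>n. of_int (arc_digit q \<gamma> (real q ^ n * x)) / real q ^ Suc n) sums arc_rep \<gamma> x"
proof -
  have p: "(\<Sum>n<N. of_int (arc_digit q \<gamma> (real q ^ n * x)) / real q ^ Suc n) = arc_rep \<gamma> x - arc_rep \<gamma> (real q ^ N * x) / real q ^ N" for N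
  proof (induction N)
    case (Suc N)
    have "arc_rep \<gamma> (real q ^ Suc N * x) = real q * arc_rep \<gamma> (real q ^ N * x) - of_int (arc_digit q \<gamma> (real q ^ N * x))"
      using arc_rep_mult[of \<gamma> q "real q ^ N * x"] by (simp add: mult_ac)
    then have "arc_rep \<gamma> (real q ^ Suc N * x) / real q ^ Suc N
       = arc_rep \<gamma> (real q ^ N * x) / real q ^ N - of_int (arc_digit q \<gamma> (real q ^ N * x)) / real q ^ Suc N"
      using assms by (simp add: diff_divide_distrib)
    then show ?case using Suc by simp
  qed simp
  have "(\<lambda>N. arc_rep \<gamma> (real q ^ N * x) / real q ^ N) \<longlonglongrightarrow> 0"
  proof (rule Lim_null_comparison)
    show "\<forall>\<^sub>F N in sequentially. norm (arc_rep \<gamma> (real q ^ N * x) / real q ^ N) \<le> (\<bar>\<gamma>\<bar> + 1) * (1 / real q) ^ N"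
    proof (rule always_eventually, rule allI)
      fix N
      have "\<bar>arc_rep \<gamma> (real q ^ N * x)\<bar> \<le> \<bar>\<gamma>\<bar> + 1" using arc_rep_bounds[of \<gamma> "real q ^ N * x"] by auto
      then show "norm (arc_rep \<gamma> (real q ^ N * x) / real q ^ N) \<le> (\<bar>\<gamma>\<bar> + 1) * (1 / real q) ^ N"
        by (simp add: power_divide divide_right_mono)
    qed
    show "(\<lambda>N. (\<bar>\<gamma>\<bar> + 1) * (1 / real q) ^ N) \<longlonglongrightarrow> 0"
      using assms by (intro tendsto_mult_right_zero LIMSEQ_power_zero) auto
  qed
  then have "(\<lambda>N. arc_rep \<gamma> x - arc_rep \<gamma> (real q ^ N * x) / real q ^ N) \<longlonglongrightarrow> arc_rep \<gamma> x - 0" by (intro tendsto_intros)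
  then show ?thesis unfolding sums_def p by simp
qed

text \<open>By induction the lifted orbits y n + m n stay in order and at most 1 apart. As both y n
  lie in a window of length 1/q, this forces m' n - m n to be 0 or 1. Multiplying y' n - y n by q
  gives a number in [0, 1] in the first case and in [-1, 0] in the second, which preserves order and
  distance.\<close>

lemma digit_sum_monotone:
  assumes q: "q \<ge> 2" and x: "x \<in> arc_core q \<gamma>" "x' \<in> arc_core q \<gamma>" and le: "arc_rep \<gamma> x \<le> arc_rep \<gamma> x'"
  shows "digit_sum q \<gamma> n x \<le> digit_sum q \<gamma> n x' \<and> digit_sum q \<gamma> n x' \<le> digit_sum q \<gamma> n x + 1"
proof -
  define y y' where "y = (\<lambda>n. arc_rep \<gamma> (real q ^ n * x))" and "y' = (\<lambda>n. arc_rep \<gamma> (real q ^ n * x'))"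
  define m m' where "m = (\<lambda>n. digit_sum q \<gamma> n x)" and "m' = (\<lambda>n. digit_sum q \<gamma> n x')"
  have b: "\<gamma> \<le> y n" "y n \<le> \<gamma> + 1 / real q" "\<gamma> \<le> y' n" "y' n \<le> \<gamma> + 1 / real q" for n
    using x by (auto simp: y_def y'_def arc_rep_def arc_core_def)
  have q1: "1 / real q \<le> 1 / 2" using q by (intro divide_left_mono) auto
  have step: "y (Suc n) + of_int (m (Suc n)) = real q * y n + of_int (m n)"
    "y' (Suc n) + of_int (m' (Suc n)) = real q * y' n + of_int (m' n)" for n
    using arc_rep_mult[of \<gamma> q "real q ^ n * x"] arc_rep_mult[of \<gamma> q "real q ^ n * x'"]
    by (simp_all add: y_def y'_def m_def m'_def digit_sum_def mult_ac)
  have mm: "m n \<le> m' n \<and> m' n \<le> m n + 1"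
    if "y n + of_int (m n) \<le> y' n + of_int (m' n)" "y' n + of_int (m' n) \<le> y n + of_int (m n) + 1" for n
  proof -
    have "real_of_int (m n) < of_int (m' n) + 1" using that(1) b[of n] q1 by linarith
    moreover have "real_of_int (m' n) < of_int (m n) + 2" using that(2) b[of n] q1 by linarith
    ultimately show ?thesis by linarith
  qed
  have "y n + of_int (m n) \<le> y' n + of_int (m' n) \<and> y' n + of_int (m' n) \<le> y n + of_int (m n) + 1" for n
  proof (induction n)
    case 0
    show ?case using le b[of 0] q1 by (simp add: y_def y'_def m_def m'_def digit_sum_def)
  next
    case (Suc n)
    have qd: "real q * (y' n - y n) \<le> 1" "- 1 \<le> real q * (y' n - y n)"
    proof -
      have "y' n - y n \<le> 1 / real q" "- (1 / real q) \<le> y' n - y n" using b[of n] by linarith+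
      then show "real q * (y' n - y n) \<le> 1" "- 1 \<le> real q * (y' n - y n)" using q by (simp_all add: field_simps)
    qed
    have "m' n = m n \<or> m' n = m n + 1" using mm[of n] Suc by linarith
    then show ?case
    proof
      assume e: "m' n = m n"
      then have "0 \<le> real q * (y' n - y n)" using Suc by simp
      then show ?thesis using qd e unfolding step by (simp add: algebra_simps)
    next
      assume e: "m' n = m n + 1"
      then have "real q * (y' n - y n) \<le> 0" using Suc by (simp add: mult_nonneg_nonpos)
      then show ?thesis using qd e unfolding step by (simp add: algebra_simps)
    qed
  qed
  then show ?thesis using mm by (simp add: m_def m'_def)
qed

lemma digit_sum_diff_le_1:
  assumes "q \<ge> 2" "x \<in> arc_core q \<gamma>" "x' \<in> arc_core q \<gamma>"
  shows "digit_sum q \<gamma> n x \<le> digit_sum q \<gamma> n x' + 1"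
  using digit_sum_monotone[OF assms, of n] digit_sum_monotone[OF assms(1,3,2), of n] by linarith

lemma arc_rep_measurable: "arc_rep \<gamma> \<in> borel_measurable borel"
proof -
  have "(\<lambda>x. frac (x - \<gamma>)) \<in> borel_measurable borel"
    by (rule measurable_compose[OF _ frac_measurable]) simp
  then show ?thesis unfolding arc_rep_def[abs_def] by simp
qed

lemma arc_digit_measurable: "(\<lambda>x. real_of_int (arc_digit q \<gamma> x)) \<in> borel_measurable borel"
proof -
  have "(\<lambda>y::real. real_of_int \<lfloor>y\<rfloor>) \<in> borel_measurable borel" by measurable
  moreover have "(\<lambda>x. real q * arc_rep \<gamma> x - \<gamma>) \<in> borel_measurable borel" using arc_rep_measurable by simp
  ultimately show ?thesis unfolding arc_digit_def by (rule measurable_compose[rotated])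
qed

lemma digit_sum_measurable: "(\<lambda>x. real_of_int (digit_sum q \<gamma> n x)) \<in> borel_measurable borel"
proof -
  have "(\<lambda>x. real_of_int (arc_digit q \<gamma> (real q ^ i * x))) \<in> borel_measurable borel" for i
    by (rule measurable_compose[OF _ arc_digit_measurable]) simp
  then show ?thesis unfolding digit_sum_def of_int_sum by (rule borel_measurable_sum)
qed

lemma arc_core_sets: "arc_core q \<gamma> \<in> sets torus"
proof -
  have "{x. frac (real q ^ n * x - \<gamma>) \<le> 1 / real q} \<in> sets borel" for n
  proof -
    have "(\<lambda>x. frac (real q ^ n * x - \<gamma>)) \<in> borel_measurable borel"
      by (rule measurable_compose[OF _ frac_measurable]) simp
    then have "(\<lambda>x. frac (real q ^ n * x - \<gamma>)) -` {..1 / real q} \<in> sets borel"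
      by (rule measurable_sets_borel) simp
    then show ?thesis by (simp add: vimage_def)
  qed
  then have "(\<Inter>n. {x. frac (real q ^ n * x - \<gamma>) \<le> 1 / real q}) \<in> sets borel" by (intro sets.countable_INT) auto
  moreover have "arc_core q \<gamma> = {0..<1} \<inter> (\<Inter>n. {x. frac (real q ^ n * x - \<gamma>) \<le> 1 / real q})"
    by (auto simp: arc_core_def)
  ultimately show ?thesis by (simp add: sets_torus)
qed

lemma measurable_torus:
  assumes "f \<in> borel_measurable borel" "sets M = sets torus"
  shows "f \<in> borel_measurable M"
proof -
  have "f \<in> borel_measurable torus" unfolding torus_def by (rule measurable_restrict_space1[OF assms(1)])
  then show ?thesis using measurable_cong_sets[OF assms(2) refl] by blast
qed

section \<open>Uniqueness of the invariant measure on an arc\<close>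

locale invariant =
  fixes q :: nat and M :: "real measure"
  assumes inv: "M \<in> invariant_measures q"
begin

sublocale prob_space M using inv by (simp add: invariant_measures_def)

lemma sets_M: "sets M = sets torus" using inv by (simp add: invariant_measures_def)

lemma space_M: "space M = {0..<1}" using sets_eq_imp_space_eq[OF sets_M] by (simp add: space_torus)

lemma meas_M: "f \<in> borel_measurable borel \<Longrightarrow> f \<in> borel_measurable M"
  by (rule measurable_torus[OF _ sets_M])

lemma distr_T: "distr M torus (Tmap q) = M"
proof -
  have "distr M M (Tmap q) = distr M torus (Tmap q)" by (rule distr_cong[OF refl sets_M refl])
  then show ?thesis using inv by (simp add: invariant_measures_def)
qed

lemma iter_measurable: "(\<lambda>x. frac (real q ^ n * x)) \<in> measurable torus torus"
  "(\<lambda>x. frac (real q ^ n * x)) \<in> measurable M torus"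
proof -
  show "(\<lambda>x. frac (real q ^ n * x)) \<in> measurable torus torus" by (rule frac_in_torus_measurable) simp
  then show "(\<lambda>x. frac (real q ^ n * x)) \<in> measurable M torus"
    using measurable_cong_sets[OF sets_M refl, of torus] by blast
qed

lemma distr_iter: "distr M torus (\<lambda>x. frac (real q ^ n * x)) = M"
proof (induction n)
  case 0
  have "distr M torus (\<lambda>x. frac (real q ^ 0 * x)) = distr M M (\<lambda>x. x)"
    by (rule distr_cong) (auto simp: sets_M space_M)
  then show ?case by (simp add: distr_id)
next
  case (Suc n)
  have "frac (real q * frac y) = frac (real q * y)" for y
  proof -
    have "real q * frac y = real q * y + of_int (- int q * \<lfloor>y\<rfloor>)" by (simp add: frac_def algebra_simps)
    then show ?thesis by (simp only: frac_add_of_int_right)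
  qed
  then have "Tmap q \<circ> (\<lambda>x. frac (real q ^ n * x)) = (\<lambda>x. frac (real q ^ Suc n * x))"
    by (simp add: Tmap_def o_def mult.assoc)
  then have "distr M torus (\<lambda>x. frac (real q ^ Suc n * x)) = distr (distr M torus (\<lambda>x. frac (real q ^ n * x))) torus (Tmap q)"
    using distr_distr[OF Tmap_measurable[of q] iter_measurable(2)[of n]] by simp
  then show ?case using Suc distr_T by simp
qed

lemma integrable_bounded:
  assumes "f \<in> borel_measurable borel" "\<And>x. \<bar>f x\<bar> \<le> B"
  shows "integrable M (f :: real \<Rightarrow> real)"
  using assms by (intro integrable_const_bound[of _ B] meas_M) auto

lemma integral_iter:
  assumes "f \<in> borel_measurable borel"
  shows "(\<integral>x. (f (frac (real q ^ n * x)) :: real) \<partial>M) = (\<integral>x. f x \<partial>M)"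
proof -
  have "(\<integral>x. f x \<partial>M) = (\<integral>x. f x \<partial>distr M torus (\<lambda>x. frac (real q ^ n * x)))" by (simp add: distr_iter)
  also have "\<dots> = (\<integral>x. f (frac (real q ^ n * x)) \<partial>M)"
    by (rule integral_distr[OF iter_measurable(2)]) (rule measurable_torus[OF assms refl])
  finally show ?thesis by simp
qed

text \<open>By invariance all digits have the same mean, which is the rotation number of the
  lift.\<close>

lemma integral_digit_sum: "(\<integral>x. real_of_int (digit_sum q \<gamma> n x) \<partial>M) = real n * (\<integral>x. real_of_int (arc_digit q \<gamma> x) \<partial>M)"
proof -
  have i: "integrable M (\<lambda>x. real_of_int (arc_digit q \<gamma> (real q ^ i * x)))" for i
    by (rule integrable_bounded[OF _ abs_arc_digit_le]) (rule measurable_compose[OF _ arc_digit_measurable], simp)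
  have "(\<integral>x. real_of_int (digit_sum q \<gamma> n x) \<partial>M) = (\<Sum>i<n. \<integral>x. real_of_int (arc_digit q \<gamma> (real q ^ i * x)) \<partial>M)"
    unfolding digit_sum_def of_int_sum by (rule Bochner_Integration.integral_sum[OF i])
  also have "\<dots> = (\<Sum>i<n. \<integral>x. real_of_int (arc_digit q \<gamma> x) \<partial>M)"
    using integral_iter[OF arc_digit_measurable, of q \<gamma>] by (simp add: arc_digit_frac)
  finally show ?thesis by simp
qed

lemma integrable_digit_sum: "integrable M (\<lambda>x. real_of_int (digit_sum q \<gamma> n x))"
  unfolding digit_sum_def of_int_sum
  by (intro Bochner_Integration.integrable_sum integrable_bounded[OF _ abs_arc_digit_le] measurable_compose[OF _ arc_digit_measurable]) simp

lemma AE_arc_core: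
  assumes "measure M (arc \<gamma> (1 / real q)) = 1"
  shows "AE x in M. x \<in> arc_core q \<gamma>"
proof -
  have "AE x in M. x \<in> arc \<gamma> (1 / real q)" by (rule AE_prob_1[OF assms])
  then have "AE x in distr M torus (\<lambda>x. frac (real q ^ n * x)). x \<in> arc \<gamma> (1 / real q)" for n
    unfolding distr_iter .
  then have "AE x in M. frac (real q ^ n * x) \<in> arc \<gamma> (1 / real q)" for n
  proof (subst (asm) AE_distr_iff[OF iter_measurable(2)])
    have "{x \<in> space torus. x \<in> arc \<gamma> (1 / real q)} = arc \<gamma> (1 / real q)"
      by (auto simp: arc_def space_torus)
    then show "{x \<in> space torus. x \<in> arc \<gamma> (1 / real q)} \<in> sets torus" using arc_sets by simp
  qed
  then have "AE x in M. \<forall>n. frac (real q ^ n * x) \<in> arc \<gamma> (1 / real q)" by (simp add: AE_all_countable)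
  with AE_space show ?thesis
  proof eventually_elim
    case (elim x)
    show ?case using elim by (auto simp: arc_core_def arc_def space_M frac_frac_diff)
  qed
qed

end

text \<open>Digit sums of length n vary by at most 1 on the core, so comparison at a common point
  gives |n r - n s| <= 2 for all n, hence r = s. Being integers, they take two adjacent values, and
  their mean determines the mass of the upper level set. By monotonicity these level sets are
  nested.\<close>

lemma invariant_measure_on_arc_unique:
  assumes q: "q \<ge> 2" and M: "M \<in> invariant_measures q" "measure M (arc \<gamma> (1 / real q)) = 1"
    and N: "N \<in> invariant_measures q" "measure N (arc \<gamma> (1 / real q)) = 1"
  shows "M = N"
proof -
  interpret M: invariant q M by unfold_locales (rule M)
  interpret N: invariant q N by unfold_locales (rule N)
  define G where "G = arc_core q \<gamma>"
  have aeM: "AE x in M. x \<in> G" and aeN: "AE x in N. x \<in> G"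
    unfolding G_def by (rule M.AE_arc_core[OF M(2)], rule N.AE_arc_core[OF N(2)])
  have Gs: "G \<in> sets torus" unfolding G_def by (rule arc_core_sets)
  have "G \<noteq> {}"
  proof
    assume "G = {}"
    then have "AE x in M. False" using aeM by simp
    then show False by simp
  qed
  then obtain x0 where x0: "x0 \<in> G" by blast
  have spread: "digit_sum q \<gamma> n x \<le> digit_sum q \<gamma> n x' + 1" if "x \<in> G" "x' \<in> G" for n x x'
    using digit_sum_diff_le_1[OF q] that by (simp add: G_def)
  define r s where "r = (\<integral>x. real_of_int (arc_digit q \<gamma> x) \<partial>M)" and "s = (\<integral>x. real_of_int (arc_digit q \<gamma> x) \<partial>N)"
  have near: "\<bar>(\<integral>x. real_of_int (digit_sum q \<gamma> n x) \<partial>P) - of_int (digit_sum q \<gamma> n x0)\<bar> \<le> 1"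
    if P: "invariant q P" "AE x in P. x \<in> G" for P n
  proof -
    interpret P: invariant q P by (rule P)
    have "AE x in P. real_of_int (digit_sum q \<gamma> n x) \<le> of_int (digit_sum q \<gamma> n x0) + 1 \<and> of_int (digit_sum q \<gamma> n x0) - 1 \<le> real_of_int (digit_sum q \<gamma> n x)"
      using P(2)
    proof eventually_elim
      case (elim x)
      then show ?case using spread[OF elim x0, of n] spread[OF x0 elim, of n] by linarith
    qed
    then have "AE x in P. real_of_int (digit_sum q \<gamma> n x) \<le> of_int (digit_sum q \<gamma> n x0) + 1"
      "AE x in P. of_int (digit_sum q \<gamma> n x0) - 1 \<le> real_of_int (digit_sum q \<gamma> n x)" by auto
    then have "(\<integral>x. real_of_int (digit_sum q \<gamma> n x) \<partial>P) \<le> of_int (digit_sum q \<gamma> n x0) + 1"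
      "of_int (digit_sum q \<gamma> n x0) - 1 \<le> (\<integral>x. real_of_int (digit_sum q \<gamma> n x) \<partial>P)"
      using P.integral_le_const[OF P.integrable_digit_sum] P.integral_ge_const[OF P.integrable_digit_sum] by blast+
    then show ?thesis by auto
  qed
  have rs: "r = s"
  proof (rule ccontr)
    assume "r \<noteq> s"
    then obtain n where n: "2 / \<bar>r - s\<bar> < real n" using reals_Archimedean2 by blast
    have "\<bar>real n * r - real n * s\<bar> \<le> 2"
      using near[OF M.invariant_axioms aeM, of n] near[OF N.invariant_axioms aeN, of n]
      unfolding M.integral_digit_sum N.integral_digit_sum r_def[symmetric] s_def[symmetric] by linarith
    then have "real n * \<bar>r - s\<bar> \<le> 2" by (simp add: right_diff_distrib[symmetric] abs_mult)
    then show False using n \<open>r \<noteq> s\<close> by (simp add: field_simps)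
  qed
  \<comment> \<open>The value at x0 is either the larger or the smaller of the two possible values,
    depending on whether a smaller one occurs.\<close>
  have "\<exists>k. \<forall>x\<in>G. k \<le> digit_sum q \<gamma> n x \<and> digit_sum q \<gamma> n x \<le> k + 1" for n
  proof (cases "\<exists>x\<in>G. digit_sum q \<gamma> n x < digit_sum q \<gamma> n x0")
    case True
    then obtain x1 where x1: "x1 \<in> G" "digit_sum q \<gamma> n x1 < digit_sum q \<gamma> n x0" by blast
    show ?thesis
    proof (intro exI[of _ "digit_sum q \<gamma> n x0 - 1"] ballI)
      fix x assume "x \<in> G"
      then show "digit_sum q \<gamma> n x0 - 1 \<le> digit_sum q \<gamma> n x \<and> digit_sum q \<gamma> n x \<le> digit_sum q \<gamma> n x0 - 1 + 1"
        using spread[OF x0, of x n] spread[OF _ x1(1), of x n] x1(2) by linarith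
    qed
  next
    case False
    show ?thesis
    proof (intro exI[of _ "digit_sum q \<gamma> n x0"] ballI)
      fix x assume "x \<in> G"
      then show "digit_sum q \<gamma> n x0 \<le> digit_sum q \<gamma> n x \<and> digit_sum q \<gamma> n x \<le> digit_sum q \<gamma> n x0 + 1"
        using spread[OF _ x0, of x n] False by (simp add: not_less)
    qed
  qed
  then obtain k where k: "\<And>n x. x \<in> G \<Longrightarrow> k n \<le> digit_sum q \<gamma> n x" "\<And>n x. x \<in> G \<Longrightarrow> digit_sum q \<gamma> n x \<le> k n + 1"
  proof -
    have "\<exists>k. \<forall>n. \<forall>x\<in>G. k n \<le> digit_sum q \<gamma> n x \<and> digit_sum q \<gamma> n x \<le> k n + 1"
      by (rule choice) (use \<open>\<And>n. \<exists>k. \<forall>x\<in>G. k \<le> digit_sum q \<gamma> n x \<and> digit_sum q \<gamma> n x \<le> k + 1\<close> in blast)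
    then show ?thesis using that by blast
  qed
  define U where "U = (\<lambda>n. {x \<in> G. k n < digit_sum q \<gamma> n x})"
  have Us: "U n \<in> sets torus" for n
  proof -
    have "{x. real_of_int (k n) < real_of_int (digit_sum q \<gamma> n x)} \<in> sets borel"
      using measurable_sets_borel[OF digit_sum_measurable[of q \<gamma> n], of "{real_of_int (k n)<..}"] by (simp add: vimage_def)
    moreover have "U n = G \<inter> {x. real_of_int (k n) < real_of_int (digit_sum q \<gamma> n x)}" by (auto simp: U_def)
    ultimately show ?thesis using Gs by (auto simp: sets_torus)
  qed
  have digit_sum_U: "real_of_int (digit_sum q \<gamma> n x) = of_int (k n) + indicator (U n) x" if "x \<in> G" for n x
    using k[OF that, of n] that by (auto simp: U_def indicator_def)
  have measU: "measure P (U n) = real n * (\<integral>x. real_of_int (arc_digit q \<gamma> x) \<partial>P) - of_int (k n)"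
    if P: "invariant q P" "AE x in P. x \<in> G" for P n
  proof -
    interpret P: invariant q P by (rule P)
    have Up: "U n \<in> sets P" using Us P.sets_M by simp
    have "(\<integral>x. real_of_int (digit_sum q \<gamma> n x) \<partial>P) = (\<integral>x. of_int (k n) + indicator (U n) x \<partial>P)"
    proof (rule integral_cong_AE)
      show "(\<lambda>x. real_of_int (digit_sum q \<gamma> n x)) \<in> borel_measurable P" by (rule P.meas_M[OF digit_sum_measurable])
      show "(\<lambda>x. of_int (k n) + indicator (U n) x :: real) \<in> borel_measurable P" using Up by simp
      show "AE x in P. real_of_int (digit_sum q \<gamma> n x) = of_int (k n) + indicator (U n) x"
        using P(2) by eventually_elim (rule digit_sum_U)
    qed
    also have "\<dots> = of_int (k n) + measure P (U n)" using Up
      by (subst Bochner_Integration.integral_add) (auto simp: P.prob_space P.emeasure_eq_measure)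
    finally show ?thesis unfolding P.integral_digit_sum by simp
  qed
  \<comment> \<open>A chain is closed under intersection, so it is a generator on which agreement
    extends; the whole space is added as a set of finite measure that exhausts it.\<close>
  define E where "E = insert {0..<1::real} (range U)"
  have EP: "E \<subseteq> Pow {0..<1}" using Us sets.sets_into_space by (auto simp: E_def sets_torus)
  have UU: "U n \<subseteq> U n' \<or> U n' \<subseteq> U n" for n n'
  proof (rule ccontr)
    assume "\<not> ?thesis"
    then obtain x x' where x: "x \<in> G" "k n < digit_sum q \<gamma> n x" "\<not> k n' < digit_sum q \<gamma> n' x"
      and x': "x' \<in> G" "k n' < digit_sum q \<gamma> n' x'" "\<not> k n < digit_sum q \<gamma> n x'" by (auto simp: U_def)
    show False
    proof (cases "arc_rep \<gamma> x \<le> arc_rep \<gamma> x'")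
      case True
      then have "digit_sum q \<gamma> n x \<le> digit_sum q \<gamma> n x'" using digit_sum_monotone[OF q] x x' by (simp add: G_def)
      then show False using x x' by simp
    next
      case False
      then have "digit_sum q \<gamma> n' x' \<le> digit_sum q \<gamma> n' x" using digit_sum_monotone[OF q, of x' \<gamma> x n'] x x' by (simp add: G_def)
      then show False using x x' by simp
    qed
  qed
  have EI: "Int_stable E"
  proof (rule Int_stableI)
    fix A B assume "A \<in> E" "B \<in> E"
    moreover have "A \<subseteq> {0..<1}" "B \<subseteq> {0..<1}" using EP \<open>A \<in> E\<close> \<open>B \<in> E\<close> by auto
    ultimately consider "A \<subseteq> B" | "B \<subseteq> A" using UU unfolding E_def by blast
    then show "A \<inter> B \<in> E" using \<open>A \<in> E\<close> \<open>B \<in> E\<close> by cases (auto simp: inf.absorb1 inf.absorb2)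
  qed
  \<comment> \<open>F need not contain every Borel set. Agreement on F still suffices, because on G
    the point itself is an F-measurable function, so a Borel set coincides almost everywhere with a
    set of F.\<close>
  define F where "F = sigma {0..<1::real} E"
  have sF: "sets F = sigma_sets {0..<1} E" and spF: "space F = {0..<1}" using EP by (simp_all add: F_def space_measure_of_conv)
  have Et: "E \<subseteq> sets torus" using Us by (auto simp: E_def sets_torus)
  have Ft: "sets F \<subseteq> sets torus" unfolding sF
    using sets.sigma_sets_subset[OF Et] by (simp add: space_torus)
  have subM: "subalgebra M F" "subalgebra N F" using Ft by (simp_all add: subalgebra_def spF M.space_M N.space_M M.sets_M N.sets_M)
  have "restr_to_subalg M F = restr_to_subalg N F"
  proof (rule measure_eqI_generator_eq[OF EI EP, where A = "\<lambda>_. {0..<1}"])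
    show "sets (restr_to_subalg M F) = sigma_sets {0..<1} E" "sets (restr_to_subalg N F) = sigma_sets {0..<1} E"
      using sets_restr_to_subalg subM sF by auto
    show "range (\<lambda>_. {0..<1}) \<subseteq> E" by (simp add: E_def)
    have m: "emeasure (restr_to_subalg M F) X = emeasure M X" "emeasure (restr_to_subalg N F) X = emeasure N X" if "X \<in> E" for X
      using that subM by (auto intro!: emeasure_restr_to_subalg simp: sF)
    have t: "emeasure M {0..<1} = 1" "emeasure N {0..<1} = 1" using M.emeasure_space_1 N.emeasure_space_1 M.space_M N.space_M by auto
    have "{0..<1} \<in> E" by (simp add: E_def)
    then show "emeasure (restr_to_subalg M F) {0..<1} \<noteq> \<infinity>" using m t by simp
    fix X assume X: "X \<in> E"
    have "emeasure M X = emeasure N X"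
    proof (cases "X = {0..<1}")
      case True then show ?thesis using t by simp
    next
      case False
      then obtain n where "X = U n" using X by (auto simp: E_def)
      then show ?thesis using measU[OF M.invariant_axioms aeM, of n] measU[OF N.invariant_axioms aeN, of n] rs
        by (simp add: M.emeasure_eq_measure N.emeasure_eq_measure r_def s_def)
    qed
    then show "emeasure (restr_to_subalg M F) X = emeasure (restr_to_subalg N F) X" using m X by simp
  qed simp
  then have agree: "emeasure M X = emeasure N X" if "X \<in> sets F" for X
    using emeasure_restr_to_subalg[OF subM(1) that] emeasure_restr_to_subalg[OF subM(2) that] by simp
  \<comment> \<open>A digit is the difference of consecutive digit sums, and on G these are
    \<open>k n\<close> plus the indicator of \<open>U n\<close>; thus h is F-measurable and equals
    \<open>arc_rep\<close> on G.\<close>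
  define h where "h = (\<lambda>x. \<Sum>n. ((of_int (k (Suc n)) + indicator (U (Suc n)) x) - (of_int (k n) + indicator (U n) x)) / real q ^ Suc n)"
  have UF: "U n \<in> sets F" for n unfolding sF by (rule sigma_sets.Basic) (simp add: E_def)
  have hF: "h \<in> borel_measurable F" unfolding h_def
    using UF by (intro borel_measurable_suminf) simp
  have hG: "frac (h x) = x" if "x \<in> G" for x
  proof -
    have "h x = (\<Sum>n. of_int (arc_digit q \<gamma> (real q ^ n * x)) / real q ^ Suc n)"
      unfolding h_def digit_sum_U[OF that, symmetric] by (simp add: digit_sum_def)
    then have "h x = arc_rep \<gamma> x" using arc_rep_sums[OF q] by (simp add: sums_iff)
    then show ?thesis using that by (simp add: frac_arc_rep G_def arc_core_def)
  qed
  show "M = N"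
  proof (rule measure_eqI)
    show "sets M = sets N" by (simp add: M.sets_M N.sets_M)
    fix A assume A: "A \<in> sets M"
    define X where "X = (\<lambda>x. frac (h x)) -` A \<inter> space F"
    have "(\<lambda>x. frac (h x)) \<in> borel_measurable F" using hF by measurable
    moreover have "A \<in> sets borel" using A M.sets_M by (simp add: sets_torus)
    ultimately have XF: "X \<in> sets F" unfolding X_def by (rule measurable_sets)
    have "emeasure P A = emeasure P X" if P: "invariant q P" "AE x in P. x \<in> G" for P
    proof (rule emeasure_eq_AE)
      interpret P: invariant q P by (rule P)
      show "A \<in> sets P" using A M.sets_M P.sets_M by simp
      show "X \<in> sets P" using XF Ft P.sets_M by auto
      show "AE x in P. x \<in> A \<longleftrightarrow> x \<in> X" using P(2)
      proof eventually_elim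
        case (elim x)
        then show ?case using hG[OF elim] by (auto simp: X_def spF G_def arc_core_def)
      qed
    qed
    then show "emeasure M A = emeasure N A"
      using aeM aeN M.invariant_axioms N.invariant_axioms agree[OF XF] by metis
  qed
qed

section \<open>Maximizing measures\<close>

lemma fc_measurable: "(\<lambda>x. real_of_ereal (fc q c x)) \<in> borel_measurable borel"
  unfolding fc_def Let_def by measurable

theorem theorem4p1:
  fixes q :: nat
  assumes "q \<ge> 2"
  shows "(\<forall>c::real. \<exists>!\<nu>. \<nu> \<in> invariant_measures q \<and> ub_integral \<nu> (fc q c) = beta q c)
    \<and> (\<forall>c::real. \<forall>\<nu>. \<nu> \<in> invariant_measures q \<and> ub_integral \<nu> (fc q c) = beta q c
          \<longrightarrow> sturmian q \<nu>)
    \<and> (\<exists>C::real. C > 0 \<and> (\<forall>c x::real. \<forall>n::nat. n \<ge> 1 \<longrightarrow>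
          (\<Sum>i<n. fc q c (real q ^ i * x)) - ereal (real n) * beta q c \<le> ereal C))"
proof -
  obtain K where K: "\<And>c. \<exists>\<gamma> g \<beta>. continuous_on UNIV g \<and> (\<forall>x. \<bar>g x\<bar> \<le> K) \<and> (\<forall>x. g (x + 1) = g x) \<and>
    (\<forall>x. frac (x - \<gamma>) \<le> 1 / real q \<longrightarrow> fc q c x = ereal (\<beta> + g (real q * x) - g x)) \<and>
    (\<forall>x. \<not> frac (x - \<gamma>) \<le> 1 / real q \<longrightarrow> fc q c x < ereal (\<beta> + g (real q * x) - g x))"
    using exists_subaction[OF assms] by blast
  have main: "\<exists>\<gamma>. (\<forall>\<nu>\<in>invariant_measures q. ub_integral \<nu> (fc q c) = beta q c \<longleftrightarrow> measure \<nu> (arc \<gamma> (1 / real q)) = 1)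
     \<and> (\<forall>x n. (\<Sum>i<n. fc q c (real q ^ i * x)) - ereal (real n) * beta q c \<le> ereal (2 * K))" for c
  proof -
    obtain \<gamma> g \<beta> where g: "continuous_on UNIV g" "\<And>x. \<bar>g x\<bar> \<le> K" "\<And>x. g (x + 1) = g x"
      and eq: "\<And>x. frac (x - \<gamma>) \<le> 1 / real q \<Longrightarrow> fc q c x = ereal (\<beta> + g (real q * x) - g x)"
      and less: "\<And>x. \<not> frac (x - \<gamma>) \<le> 1 / real q \<Longrightarrow> fc q c x < ereal (\<beta> + g (real q * x) - g x)"
      using K[of c] by blast
    define s where "s = (\<lambda>x. \<beta> + g (real q * x) - g x)"
    have gm: "g \<in> borel_measurable borel" by (rule borel_measurable_continuous_onI[OF g(1)])
    have sm: "s \<in> borel_measurable borel" unfolding s_def using gm by measurable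
    have gfrac: "g (frac x) = g x" for x by (rule periodic_frac) (rule g(3))
    have le: "fc q c x \<le> ereal (s x)" for x
      using eq[of x] less[of x] by (cases "frac (x - \<gamma>) \<le> 1 / real q") (auto simp: s_def less_imp_le)
    have int_s: "integrable \<nu> s \<and> (\<integral>x. s x \<partial>\<nu>) = \<beta>" if "\<nu> \<in> invariant_measures q" for \<nu>
    proof -
      interpret invariant q \<nu> by unfold_locales (rule that)
      have i1: "integrable \<nu> g" by (rule integrable_bounded[OF gm g(2)])
      have i2: "integrable \<nu> (\<lambda>x. g (real q * x))"
        by (rule integrable_bounded[OF _ g(2)]) (use gm in measurable)
      have "(\<integral>x. g (real q * x) \<partial>\<nu>) = (\<integral>x. g x \<partial>\<nu>)"
        using integral_iter[OF gm, of 1] by (simp add: gfrac)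
      then show ?thesis unfolding s_def using i1 i2 prob_space by simp
    qed
    have opt: "ub_integral \<nu> (fc q c) \<le> ereal \<beta> \<and> (ub_integral \<nu> (fc q c) = ereal \<beta> \<longleftrightarrow> measure \<nu> (arc \<gamma> (1 / real q)) = 1)"
      if nu: "\<nu> \<in> invariant_measures q" for \<nu>
    proof -
      interpret invariant q \<nu> by unfold_locales (rule nu)
      define f where "f = (\<lambda>x. real_of_ereal (fc q c x))"
      have fm: "f \<in> borel_measurable \<nu>" unfolding f_def by (rule meas_M[OF fc_measurable])
      have arcs: "arc \<gamma> (1 / real q) \<in> events" using arc_sets sets_M by simp
      have int: "integrable \<nu> s" "(\<integral>x. s x \<partial>\<nu>) = \<beta>" using int_s[OF nu] by auto
      have arc_iff: "x \<in> arc \<gamma> (1 / real q) \<longleftrightarrow> frac (x - \<gamma>) \<le> 1 / real q" if "x \<in> space \<nu>" for x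
        using that by (auto simp: arc_def space_M)
      show ?thesis
      proof (cases "(AE x in \<nu>. fc q c x \<noteq> - \<infinity>) \<and> integrable \<nu> f")
        case True
        then have ub: "ub_integral \<nu> (fc q c) = ereal (\<integral>x. f x \<partial>\<nu>)" by (simp add: ub_integral_def f_def)
        have aele: "AE x in \<nu>. f x \<le> s x" using conjunct1[OF True]
        proof eventually_elim
          case (elim x)
          then show ?case using le[of x] by (cases "fc q c x") (auto simp: f_def)
        qed
        then have "(\<integral>x. f x \<partial>\<nu>) \<le> \<beta>" using integral_mono_AE[OF conjunct2[OF True] int(1)] int(2) by simp
        moreover have "(\<integral>x. f x \<partial>\<nu>) = \<beta> \<longleftrightarrow> measure \<nu> (arc \<gamma> (1 / real q)) = 1"
        proof -
          have "(\<integral>x. f x \<partial>\<nu>) = \<beta> \<longleftrightarrow> (\<integral>x. s x - f x \<partial>\<nu>) = 0" using True int by auto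
          also have "\<dots> \<longleftrightarrow> (AE x in \<nu>. s x - f x = 0)"
            using True int aele by (intro integral_nonneg_eq_0_iff_AE) auto
          also have "\<dots> \<longleftrightarrow> (AE x in \<nu>. x \<in> arc \<gamma> (1 / real q))"
          proof -
            have "AE x in \<nu>. s x - f x = 0 \<longleftrightarrow> x \<in> arc \<gamma> (1 / real q)"
              using conjunct1[OF True] AE_space
            proof eventually_elim
              case (elim x)
              show ?case
              proof (cases "frac (x - \<gamma>) \<le> 1 / real q")
                case t: True
                then show ?thesis using eq[OF t] arc_iff elim by (simp add: f_def s_def)
              next
                case nt: False
                then have "fc q c x < ereal (s x)" using less by (simp add: s_def)
                then have "f x < s x" using elim(1) by (cases "fc q c x") (auto simp: f_def)
                then show ?thesis using nt arc_iff elim by simp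
              qed
            qed
            then show ?thesis by (rule eventually_subst)
          qed
          also have "\<dots> \<longleftrightarrow> measure \<nu> (arc \<gamma> (1 / real q)) = 1" using prob_eq_1[OF arcs] by simp
          finally show ?thesis .
        qed
        ultimately show ?thesis unfolding ub by simp
      next
        case False
        then have ub: "ub_integral \<nu> (fc q c) = - \<infinity>" by (auto simp: ub_integral_def f_def)
        \<comment> \<open>For a measure carried by the arc f equals the integrable function s almost
          everywhere, so the default value of \<open>ub_integral\<close> cannot occur.\<close>
        have "measure \<nu> (arc \<gamma> (1 / real q)) \<noteq> 1"
        proof
          assume "measure \<nu> (arc \<gamma> (1 / real q)) = 1"
          then have "AE x in \<nu>. x \<in> arc \<gamma> (1 / real q)" using prob_eq_1[OF arcs] by simp
          then have ae: "AE x in \<nu>. fc q c x = ereal (s x)"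
          proof eventually_elim
            case (elim x) then show ?case using eq[of x] by (simp add: arc_def s_def)
          qed
          then have "AE x in \<nu>. fc q c x \<noteq> - \<infinity>" by eventually_elim simp
          moreover have "integrable \<nu> f"
          proof -
            have "AE x in \<nu>. s x = f x" using ae by eventually_elim (simp add: f_def)
            then show ?thesis using int(1) fm integrable_cong_AE_imp by blast
          qed
          ultimately show False using False by blast
        qed
        then show ?thesis unfolding ub by simp
      qed
    qed
    have beta: "beta q c = ereal \<beta>"
    proof (rule antisym)
      show "beta q c \<le> ereal \<beta>" unfolding beta_def using opt by (intro SUP_least) auto
      obtain \<nu> where "\<nu> \<in> invariant_measures q" "measure \<nu> (arc \<gamma> (1 / real q)) = 1"
        using exists_invariant_measure_on_arc[OF assms] by blast
      then show "ereal \<beta> \<le> beta q c" unfolding beta_def using opt by (metis SUP_upper)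
    qed
    have "(\<Sum>i<n. fc q c (real q ^ i * x)) - ereal (real n) * beta q c \<le> ereal (2 * K)" for x n
    proof -
      have tel: "(\<Sum>i<n. s (real q ^ i * x)) = real n * \<beta> + g (real q ^ n * x) - g x" for n
        by (induction n) (auto simp: s_def algebra_simps)
      have "(\<Sum>i<n. fc q c (real q ^ i * x)) \<le> (\<Sum>i<n. ereal (s (real q ^ i * x)))"
        by (intro sum_mono le)
      also have "\<dots> = ereal (real n * \<beta> + g (real q ^ n * x) - g x)" by (simp add: tel)
      also have "\<dots> \<le> ereal (real n * \<beta> + 2 * K)"
        using g(2)[of x] g(2)[of "real q ^ n * x"] by simp
      finally have "(\<Sum>i<n. fc q c (real q ^ i * x)) - ereal (real n * \<beta>) \<le> ereal (real n * \<beta> + 2 * K) - ereal (real n * \<beta>)"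
        by (intro ereal_minus_mono) auto
      then show ?thesis by (simp add: beta)
    qed
    then show ?thesis using opt beta by (intro exI[of _ \<gamma>]) auto
  qed
  have K0: "0 \<le> K" using K[of 0] by (metis abs_ge_zero order_trans)
  have "\<exists>!\<nu>. \<nu> \<in> invariant_measures q \<and> ub_integral \<nu> (fc q c) = beta q c" for c
  proof -
    obtain \<gamma> where \<gamma>: "\<forall>\<nu>\<in>invariant_measures q. ub_integral \<nu> (fc q c) = beta q c \<longleftrightarrow> measure \<nu> (arc \<gamma> (1 / real q)) = 1"
      using main[of c] by blast
    obtain \<nu> where "\<nu> \<in> invariant_measures q" "measure \<nu> (arc \<gamma> (1 / real q)) = 1"
      using exists_invariant_measure_on_arc[OF assms] by blast
    then show ?thesis using \<gamma> invariant_measure_on_arc_unique[OF assms] by (intro ex1I[of _ \<nu>]) auto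
  qed
  moreover have "sturmian q \<nu>" if "\<nu> \<in> invariant_measures q" "ub_integral \<nu> (fc q c) = beta q c" for c \<nu>
    using main[of c] that unfolding sturmian_def by blast
  \<comment> \<open>K is only known to be nonnegative, hence the added 1 for a positive
    constant.\<close>
  moreover have "(\<Sum>i<n. fc q c (real q ^ i * x)) - ereal (real n) * beta q c \<le> ereal (2 * K + 1)" for c x n
  proof -
    have "(\<Sum>i<n. fc q c (real q ^ i * x)) - ereal (real n) * beta q c \<le> ereal (2 * K)" using main[of c] by blast
    also have "\<dots> \<le> ereal (2 * K + 1)" by simp
    finally show ?thesis .
  qed
  moreover have "2 * K + 1 > 0" using K0 by simp
  ultimately show ?thesis by blast
qed

end
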